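(* Let $k$ be an algebraically closed field, let $w$ be an integer, and let $\mathsf{T}$ be a $k$-linear algebraic triangulated category which is idempotent complete and classically generated by a $w$-spherical object. If $w \leq 0$, then $\mathsf{T}$ has no non-trivial t-structures. It has one family of non-trivial co-t-structures, all of which are (de)suspensions of a canonical one. If $w \geq 1$, then $\mathsf{T}$ has no non-trivial co-t-structures. It has one family of non-trivial t-structures, all of which are (de)suspensions of a canonical one.
   Context: $\Sigma$ denotes the suspension functor of a triangulated category. A triangulated category is algebraic if it is the stable category of a Frobenius category. An additive category is idempotent complete if each idempotent $e$ in the endomorphism ring of an object $a$ has the form $e=\iota\pi$, where $\iota$ and $\pi$ are the inclusion and projection of a direct summand of $a$. An object $s$ of a $k$-linear triangulated category $\mathsf{S}$ is $w$-spherical if its graded endomorphism algebra $\mathrm{Hom}_{\mathsf{S}}(s,\Sigma^* s)$ is isomorphic to $k[X]/(X^2)$ with $X$ placed in cohomological degree $w$. A triangulated category $\mathsf{S}$ is classically generated by an object $s$ if each object of $\mathsf{S}$ can be built from $s$ using finitely many (de)suspensions, distinguished triangles, and direct summands. The category $\mathsf{T}$ is determined up to triangulated equivalence by the stated properties. A torsion pair in a triangulated category $\mathsf{S}$ is a pair $(\mathsf{M},\mathsf{N})$ of full subcategories closed under direct sums and summands such that $\mathrm{Hom}_{\mathsf{S}}(m,n)=0$ for all $m\in\mathsf{M}$, $n\in\mathsf{N}$, and such that each object $s\in\mathsf{S}$ appears in a distinguished triangle $m\to s\to n$ with $m\in\mathsf{M}$, $n\in\mathsf{N}$. A torsion pair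 $(\mathsf{M},\mathsf{N})$ is called a t-structure if $\Sigma\mathsf{M}\subseteq\mathsf{M}$, and a co-t-structure if $\Sigma^{-1}\mathsf{M}\subseteq\mathsf{M}$. In each case the structure is called trivial if it is $(\mathsf{S},0)$ or $(0,\mathsf{S})$, and non-trivial otherwise. The (de)suspensions of a (co-)t-structure $(\mathsf{M},\mathsf{N})$ are the pairs $(\Sigma^i\mathsf{M},\Sigma^i\mathsf{N})$ for integers $i$. *)

theory Defs
  imports "HOL-Computational_Algebra.Polynomial"
begin

section \<open>Additive categories\<close>

text \<open>
  Objects live in a type \<open>'o\<close> and morphisms in a type \<open>'m\<close>. Morphism sets of distinct pairs of
  objects are disjoint (see \<open>hom_unique\<close> below), so a morphism determines its source and target.
  \<open>g \<cdot> f\<close> is ``\<open>g\<close> after \<open>f\<close>''.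
\<close>

record ('o, 'm) precat =
  Obj :: "'o set"
  Hom :: "'o \<Rightarrow> 'o \<Rightarrow> 'm set"
  Id :: "'o \<Rightarrow> 'm"
  Zero :: "'o \<Rightarrow> 'o \<Rightarrow> 'm"
  Comp :: "'m \<Rightarrow> 'm \<Rightarrow> 'm"  (infixl \<open>\<cdot>\<index>\<close> 70)
  Add :: "'m \<Rightarrow> 'm \<Rightarrow> 'm"  (infixl \<open>\<oplus>\<index>\<close> 65)

locale preadditive_category =
  fixes C :: "('o, 'm, 'x) precat_scheme" (structure)
  assumes hom_obj: "f \<in> Hom C a b \<Longrightarrow> a \<in> Obj C \<and> b \<in> Obj C"
    and hom_unique: "f \<in> Hom C a b \<Longrightarrow> f \<in> Hom C a' b' \<Longrightarrow> a = a' \<and> b = b'"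
    and id_hom: "a \<in> Obj C \<Longrightarrow> Id C a \<in> Hom C a a"
    and comp_hom: "f \<in> Hom C a b \<Longrightarrow> g \<in> Hom C b c \<Longrightarrow> g \<cdot> f \<in> Hom C a c"
    and id_left: "f \<in> Hom C a b \<Longrightarrow> Id C b \<cdot> f = f"
    and id_right: "f \<in> Hom C a b \<Longrightarrow> f \<cdot> Id C a = f"
    and comp_assoc: "f \<in> Hom C a b \<Longrightarrow> g \<in> Hom C b c \<Longrightarrow> h \<in> Hom C c d \<Longrightarrow>
          (h \<cdot> g) \<cdot> f = h \<cdot> (g \<cdot> f)"
    and zero_hom: "a \<in> Obj C \<Longrightarrow> b \<in> Obj C \<Longrightarrow> Zero C a b \<in> Hom C a b"
    and add_hom: "f \<in> Hom C a b \<Longrightarrow> g \<in> Hom C a b \<Longrightarrow> f \<oplus> g \<in> Hom C a b"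
    and add_assoc: "f \<in> Hom C a b \<Longrightarrow> g \<in> Hom C a b \<Longrightarrow> h \<in> Hom C a b \<Longrightarrow>
          (f \<oplus> g) \<oplus> h = f \<oplus> (g \<oplus> h)"
    and add_commute: "f \<in> Hom C a b \<Longrightarrow> g \<in> Hom C a b \<Longrightarrow> f \<oplus> g = g \<oplus> f"
    and add_zero: "f \<in> Hom C a b \<Longrightarrow> f \<oplus> Zero C a b = f"
    and add_inverse: "f \<in> Hom C a b \<Longrightarrow> \<exists>g \<in> Hom C a b. f \<oplus> g = Zero C a b"
    and comp_add_right: "f \<in> Hom C a b \<Longrightarrow> f' \<in> Hom C a b \<Longrightarrow> g \<in> Hom C b c \<Longrightarrow>
          g \<cdot> (f \<oplus> f') = g \<cdot> f \<oplus> g \<cdot> f'"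
    and comp_add_left: "f \<in> Hom C a b \<Longrightarrow> g \<in> Hom C b c \<Longrightarrow> g' \<in> Hom C b c \<Longrightarrow>
          (g \<oplus> g') \<cdot> f = g \<cdot> f \<oplus> g' \<cdot> f"

definition neg :: "('o, 'm, 'x) precat_scheme \<Rightarrow> 'm \<Rightarrow> 'm" where
  "neg C f = (THE g. \<exists>a b. f \<in> Hom C a b \<and> g \<in> Hom C a b \<and> f \<oplus>\<^bsub>C\<^esub> g = Zero C a b)"

definition isomorphism :: "('o, 'm, 'x) precat_scheme \<Rightarrow> 'o \<Rightarrow> 'o \<Rightarrow> 'm \<Rightarrow> bool" where
  "isomorphism C a b f \<longleftrightarrow> f \<in> Hom C a b \<and>
     (\<exists>g \<in> Hom C b a. g \<cdot>\<^bsub>C\<^esub> f = Id C a \<and> f \<cdot>\<^bsub>C\<^esub> g = Id C b)"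

definition isomorphic :: "('o, 'm, 'x) precat_scheme \<Rightarrow> 'o \<Rightarrow> 'o \<Rightarrow> bool" where
  "isomorphic C a b \<longleftrightarrow> (\<exists>f. isomorphism C a b f)"

definition zero_objects :: "('o, 'm, 'x) precat_scheme \<Rightarrow> 'o set" where
  "zero_objects C = {z \<in> Obj C. Id C z = Zero C z z}"

definition is_biproduct ::
  "('o, 'm, 'x) precat_scheme \<Rightarrow> 'o \<Rightarrow> 'o \<Rightarrow> 'o \<Rightarrow> 'm \<Rightarrow> 'm \<Rightarrow> 'm \<Rightarrow> 'm \<Rightarrow> bool" where
  "is_biproduct C a b c i p j q \<longleftrightarrow>
     i \<in> Hom C a c \<and> p \<in> Hom C c a \<and> j \<in> Hom C b c \<and> q \<in> Hom C c b \<and>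
     p \<cdot>\<^bsub>C\<^esub> i = Id C a \<and> q \<cdot>\<^bsub>C\<^esub> j = Id C b \<and>
     q \<cdot>\<^bsub>C\<^esub> i = Zero C a b \<and> p \<cdot>\<^bsub>C\<^esub> j = Zero C b a \<and>
     i \<cdot>\<^bsub>C\<^esub> p \<oplus>\<^bsub>C\<^esub> j \<cdot>\<^bsub>C\<^esub> q = Id C c"

definition direct_sum :: "('o, 'm, 'x) precat_scheme \<Rightarrow> 'o \<Rightarrow> 'o \<Rightarrow> 'o \<Rightarrow> bool" where
  "direct_sum C a b c \<longleftrightarrow> (\<exists>i p j q. is_biproduct C a b c i p j q)"

definition summand_via :: "('o, 'm, 'x) precat_scheme \<Rightarrow> 'o \<Rightarrow> 'o \<Rightarrow> 'm \<Rightarrow> 'm \<Rightarrow> bool" where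
  "summand_via C b a i p \<longleftrightarrow> (\<exists>c j q. is_biproduct C b c a i p j q)"

definition direct_summand :: "('o, 'm, 'x) precat_scheme \<Rightarrow> 'o \<Rightarrow> 'o \<Rightarrow> bool" where
  "direct_summand C b a \<longleftrightarrow> (\<exists>i p. summand_via C b a i p)"

locale additive_category = preadditive_category +
  assumes zero_object: "zero_objects C \<noteq> {}"
    and biproducts: "a \<in> Obj C \<Longrightarrow> b \<in> Obj C \<Longrightarrow> \<exists>c. direct_sum C a b c"

definition idempotent_complete :: "('o, 'm, 'x) precat_scheme \<Rightarrow> bool" where
  "idempotent_complete C \<longleftrightarrow>
     (\<forall>a \<in> Obj C. \<forall>e \<in> Hom C a a. e \<cdot>\<^bsub>C\<^esub> e = e \<longrightarrow>
        (\<exists>b i p. summand_via C b a i p \<and> e = i \<cdot>\<^bsub>C\<^esub> p))"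

locale additive_functor =
  fixes C :: "('o, 'm, 'x) precat_scheme" and D :: "('p, 'n, 'y) precat_scheme"
    and F :: "'o \<Rightarrow> 'p" and Fm :: "'m \<Rightarrow> 'n"
  assumes F_obj: "a \<in> Obj C \<Longrightarrow> F a \<in> Obj D"
    and F_hom: "f \<in> Hom C a b \<Longrightarrow> Fm f \<in> Hom D (F a) (F b)"
    and F_id: "a \<in> Obj C \<Longrightarrow> Fm (Id C a) = Id D (F a)"
    and F_comp: "f \<in> Hom C a b \<Longrightarrow> g \<in> Hom C b c \<Longrightarrow> Fm (g \<cdot>\<^bsub>C\<^esub> f) = Fm g \<cdot>\<^bsub>D\<^esub> Fm f"
    and F_add: "f \<in> Hom C a b \<Longrightarrow> g \<in> Hom C a b \<Longrightarrow> Fm (f \<oplus>\<^bsub>C\<^esub> g) = Fm f \<oplus>\<^bsub>D\<^esub> Fm g"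

locale additive_equivalence = additive_functor +
  assumes fully_faithful: "a \<in> Obj C \<Longrightarrow> b \<in> Obj C \<Longrightarrow>
        bij_betw Fm (Hom C a b) (Hom D (F a) (F b))"
    and essentially_surjective: "d \<in> Obj D \<Longrightarrow> \<exists>a \<in> Obj C. isomorphic D (F a) d"


section \<open>Triangulated categories\<close>

text \<open>
  \<open>Sus\<close> and \<open>SusM\<close> are the object and morphism part of the suspension functor. A distinguished
  triangle \<open>a \<rightarrow> b \<rightarrow> c \<rightarrow> Sus a\<close> is recorded by its three morphisms, which determine the objects.
  The suspension is only required to be an autoequivalence, as it is for stable categories; a
  strict automorphism is a special case.
\<close>

record ('o, 'm) susp_cat = "('o, 'm) precat" +
  Sus :: "'o \<Rightarrow> 'o"
  SusM :: "'m \<Rightarrow> 'm"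

record ('o, 'm) tri_cat = "('o, 'm) susp_cat" +
  Tri :: "('m \<times> 'm \<times> 'm) set"

definition candidate_triangle ::
  "('o, 'm, 'x) susp_cat_scheme \<Rightarrow> 'o \<Rightarrow> 'o \<Rightarrow> 'o \<Rightarrow> 'm \<Rightarrow> 'm \<Rightarrow> 'm \<Rightarrow> bool" where
  "candidate_triangle T a b c f g h \<longleftrightarrow>
     f \<in> Hom T a b \<and> g \<in> Hom T b c \<and> h \<in> Hom T c (Sus T a)"

definition triangle_iso ::
  "('o, 'm, 'x) susp_cat_scheme \<Rightarrow> 'm \<times> 'm \<times> 'm \<Rightarrow> 'm \<times> 'm \<times> 'm \<Rightarrow> bool" where
  "triangle_iso T = (\<lambda>(f, g, h) (f', g', h').
     \<exists>a b c a' b' c' \<alpha> \<beta> \<gamma>.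
       candidate_triangle T a b c f g h \<and> candidate_triangle T a' b' c' f' g' h' \<and>
       isomorphism T a a' \<alpha> \<and> isomorphism T b b' \<beta> \<and> isomorphism T c c' \<gamma> \<and>
       \<beta> \<cdot>\<^bsub>T\<^esub> f = f' \<cdot>\<^bsub>T\<^esub> \<alpha> \<and> \<gamma> \<cdot>\<^bsub>T\<^esub> g = g' \<cdot>\<^bsub>T\<^esub> \<beta> \<and>
       SusM T \<alpha> \<cdot>\<^bsub>T\<^esub> h = h' \<cdot>\<^bsub>T\<^esub> \<gamma>)"

locale triangulated_category =
  additive_category T + suspension: additive_equivalence T T "Sus T" "SusM T"
  for T :: "('o, 'm, 'x) tri_cat_scheme" (structure) +
  assumes tri_candidate: "(f, g, h) \<in> Tri T \<Longrightarrow> \<exists>a b c. candidate_triangle T a b c f g h"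
    and tri_iso: "t \<in> Tri T \<Longrightarrow> triangle_iso T t t' \<Longrightarrow> t' \<in> Tri T"
    and tri_id: "a \<in> Obj T \<Longrightarrow> z \<in> zero_objects T \<Longrightarrow>
          (Id T a, Zero T a z, Zero T z (Sus T a)) \<in> Tri T"
    and tri_cone: "f \<in> Hom T a b \<Longrightarrow> \<exists>g h. (f, g, h) \<in> Tri T"
    and tri_rotate: "candidate_triangle T a b c f g h \<Longrightarrow>
          (f, g, h) \<in> Tri T \<longleftrightarrow> (g, h, neg T (SusM T f)) \<in> Tri T"
    and tri_morphism:
      "(f, g, h) \<in> Tri T \<Longrightarrow> candidate_triangle T a b c f g h \<Longrightarrow>
       (f', g', h') \<in> Tri T \<Longrightarrow> candidate_triangle T a' b' c' f' g' h' \<Longrightarrow>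
       \<alpha> \<in> Hom T a a' \<Longrightarrow> \<beta> \<in> Hom T b b' \<Longrightarrow> \<beta> \<cdot> f = f' \<cdot> \<alpha> \<Longrightarrow>
       \<exists>\<gamma> \<in> Hom T c c'. \<gamma> \<cdot> g = g' \<cdot> \<beta> \<and> SusM T \<alpha> \<cdot> h = h' \<cdot> \<gamma>"
    and octahedral:
      "(f, f1, f2) \<in> Tri T \<Longrightarrow> candidate_triangle T a b d f f1 f2 \<Longrightarrow>
       (g, g1, g2) \<in> Tri T \<Longrightarrow> candidate_triangle T b c e g g1 g2 \<Longrightarrow>
       (g \<cdot> f, h1, h2) \<in> Tri T \<Longrightarrow> candidate_triangle T a c y (g \<cdot> f) h1 h2 \<Longrightarrow>
       \<exists>u v. (u, v, SusM T f1 \<cdot> g2) \<in> Tri T \<and> u \<in> Hom T d y \<and> v \<in> Hom T y e \<and>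
         u \<cdot> f1 = h1 \<cdot> g \<and> h2 \<cdot> u = f2 \<and> v \<cdot> h1 = g1 \<and> g2 \<cdot> v = SusM T f \<cdot> h2"

locale linear_triangulated_category =
  triangulated_category T
  for T :: "('o, 'm, 'x) tri_cat_scheme" (structure) +
  fixes scale :: "'k::field \<Rightarrow> 'm \<Rightarrow> 'm"
  assumes scale_hom: "f \<in> Hom T a b \<Longrightarrow> scale c f \<in> Hom T a b"
    and scale_add_right: "f \<in> Hom T a b \<Longrightarrow> g \<in> Hom T a b \<Longrightarrow>
          scale c (f \<oplus> g) = scale c f \<oplus> scale c g"
    and scale_add_left: "f \<in> Hom T a b \<Longrightarrow> scale (c + d) f = scale c f \<oplus> scale d f"
    and scale_scale: "f \<in> Hom T a b \<Longrightarrow> scale c (scale d f) = scale (c * d) f"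
    and scale_one: "f \<in> Hom T a b \<Longrightarrow> scale 1 f = f"
    and scale_comp_left: "f \<in> Hom T a b \<Longrightarrow> g \<in> Hom T b e \<Longrightarrow> scale c g \<cdot> f = scale c (g \<cdot> f)"
    and scale_comp_right: "f \<in> Hom T a b \<Longrightarrow> g \<in> Hom T b e \<Longrightarrow> g \<cdot> scale c f = scale c (g \<cdot> f)"
    and scale_susp: "f \<in> Hom T a b \<Longrightarrow> SusM T (scale c f) = scale c (SusM T f)"

definition triangle_equivalence ::
  "('o, 'm, 'x) tri_cat_scheme \<Rightarrow> ('p, 'n, 'y) tri_cat_scheme \<Rightarrow>
   ('o \<Rightarrow> 'p) \<Rightarrow> ('m \<Rightarrow> 'n) \<Rightarrow> ('o \<Rightarrow> 'n) \<Rightarrow> bool" where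
  "triangle_equivalence T S F Fm \<eta> \<longleftrightarrow>
     additive_equivalence T S F Fm \<and>
     (\<forall>a \<in> Obj T. isomorphism S (F (Sus T a)) (Sus S (F a)) (\<eta> a)) \<and>
     (\<forall>a b. \<forall>f \<in> Hom T a b. \<eta> b \<cdot>\<^bsub>S\<^esub> Fm (SusM T f) = SusM S (Fm f) \<cdot>\<^bsub>S\<^esub> \<eta> a) \<and>
     (\<forall>a b c f g h. candidate_triangle T a b c f g h \<longrightarrow> (f, g, h) \<in> Tri T \<longrightarrow>
        (Fm f, Fm g, \<eta> a \<cdot>\<^bsub>S\<^esub> Fm h) \<in> Tri S)"


section \<open>Frobenius categories and their stable categories\<close>

text \<open>
  Exact categories in the sense of Quillen; \<open>Conf\<close> is the class of conflations (admissible short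
  exact sequences).
\<close>

record ('o, 'm) exact_cat = "('o, 'm) precat" +
  Conf :: "('m \<times> 'm) set"

definition inflation :: "('o, 'm, 'x) exact_cat_scheme \<Rightarrow> 'm \<Rightarrow> bool" where
  "inflation E i \<longleftrightarrow> (\<exists>p. (i, p) \<in> Conf E)"

definition deflation :: "('o, 'm, 'x) exact_cat_scheme \<Rightarrow> 'm \<Rightarrow> bool" where
  "deflation E p \<longleftrightarrow> (\<exists>i. (i, p) \<in> Conf E)"

definition kernel_cokernel_pair ::
  "('o, 'm, 'x) precat_scheme \<Rightarrow> 'o \<Rightarrow> 'o \<Rightarrow> 'o \<Rightarrow> 'm \<Rightarrow> 'm \<Rightarrow> bool" where
  "kernel_cokernel_pair C a b c i p \<longleftrightarrow>
     i \<in> Hom C a b \<and> p \<in> Hom C b c \<and> p \<cdot>\<^bsub>C\<^esub> i = Zero C a c \<and>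
     (\<forall>x. \<forall>f \<in> Hom C x b. p \<cdot>\<^bsub>C\<^esub> f = Zero C x c \<longrightarrow> (\<exists>!g. g \<in> Hom C x a \<and> i \<cdot>\<^bsub>C\<^esub> g = f)) \<and>
     (\<forall>x. \<forall>f \<in> Hom C b x. f \<cdot>\<^bsub>C\<^esub> i = Zero C a x \<longrightarrow> (\<exists>!g. g \<in> Hom C c x \<and> g \<cdot>\<^bsub>C\<^esub> p = f))"

definition pushout ::
  "('o, 'm, 'x) precat_scheme \<Rightarrow> 'o \<Rightarrow> 'o \<Rightarrow> 'o \<Rightarrow> 'o \<Rightarrow> 'm \<Rightarrow> 'm \<Rightarrow> 'm \<Rightarrow> 'm \<Rightarrow> bool" where
  "pushout C a b c d f g f' g' \<longleftrightarrow>
     f \<in> Hom C a b \<and> g \<in> Hom C a c \<and> f' \<in> Hom C c d \<and> g' \<in> Hom C b d \<and>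
     g' \<cdot>\<^bsub>C\<^esub> f = f' \<cdot>\<^bsub>C\<^esub> g \<and>
     (\<forall>x. \<forall>u \<in> Hom C b x. \<forall>v \<in> Hom C c x. u \<cdot>\<^bsub>C\<^esub> f = v \<cdot>\<^bsub>C\<^esub> g \<longrightarrow>
        (\<exists>!t. t \<in> Hom C d x \<and> t \<cdot>\<^bsub>C\<^esub> g' = u \<and> t \<cdot>\<^bsub>C\<^esub> f' = v))"

definition pullback ::
  "('o, 'm, 'x) precat_scheme \<Rightarrow> 'o \<Rightarrow> 'o \<Rightarrow> 'o \<Rightarrow> 'o \<Rightarrow> 'm \<Rightarrow> 'm \<Rightarrow> 'm \<Rightarrow> 'm \<Rightarrow> bool" where
  "pullback C a b c d f g f' g' \<longleftrightarrow>
     f \<in> Hom C b a \<and> g \<in> Hom C c a \<and> f' \<in> Hom C d c \<and> g' \<in> Hom C d b \<and>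
     f \<cdot>\<^bsub>C\<^esub> g' = g \<cdot>\<^bsub>C\<^esub> f' \<and>
     (\<forall>x. \<forall>u \<in> Hom C x b. \<forall>v \<in> Hom C x c. f \<cdot>\<^bsub>C\<^esub> u = g \<cdot>\<^bsub>C\<^esub> v \<longrightarrow>
        (\<exists>!t. t \<in> Hom C x d \<and> g' \<cdot>\<^bsub>C\<^esub> t = u \<and> f' \<cdot>\<^bsub>C\<^esub> t = v))"

text \<open>
  In \<open>pushout C a b c d f g f' g'\<close> the morphism \<open>f'\<close> is the one opposite to \<open>f\<close> in the square,
  and likewise for pullbacks.
\<close>

locale exact_category = additive_category E
  for E :: "('o, 'm, 'x) exact_cat_scheme" (structure) +
  assumes conf_pair: "(i, p) \<in> Conf E \<Longrightarrow> \<exists>a b c. kernel_cokernel_pair E a b c i p"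
    and conf_iso:
      "(i, p) \<in> Conf E \<Longrightarrow> i \<in> Hom E a b \<Longrightarrow> p \<in> Hom E b c \<Longrightarrow>
       i' \<in> Hom E a' b' \<Longrightarrow> p' \<in> Hom E b' c' \<Longrightarrow>
       isomorphism E a a' \<alpha> \<Longrightarrow> isomorphism E b b' \<beta> \<Longrightarrow> isomorphism E c c' \<gamma> \<Longrightarrow>
       \<beta> \<cdot> i = i' \<cdot> \<alpha> \<Longrightarrow> \<gamma> \<cdot> p = p' \<cdot> \<beta> \<Longrightarrow> (i', p') \<in> Conf E"
    and inflation_id: "a \<in> Obj E \<Longrightarrow> inflation E (Id E a)"
    and deflation_id: "a \<in> Obj E \<Longrightarrow> deflation E (Id E a)"
    and inflation_comp: "i \<in> Hom E a b \<Longrightarrow> j \<in> Hom E b c \<Longrightarrow>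
          inflation E i \<Longrightarrow> inflation E j \<Longrightarrow> inflation E (j \<cdot> i)"
    and deflation_comp: "p \<in> Hom E a b \<Longrightarrow> q \<in> Hom E b c \<Longrightarrow>
          deflation E p \<Longrightarrow> deflation E q \<Longrightarrow> deflation E (q \<cdot> p)"
    and inflation_pushout: "i \<in> Hom E a b \<Longrightarrow> inflation E i \<Longrightarrow> f \<in> Hom E a c \<Longrightarrow>
          \<exists>d i' f'. pushout E a b c d i f i' f' \<and> inflation E i'"
    and deflation_pullback: "p \<in> Hom E b a \<Longrightarrow> deflation E p \<Longrightarrow> f \<in> Hom E c a \<Longrightarrow>
          \<exists>d p' f'. pullback E a b c d p f p' f' \<and> deflation E p'"

definition injective :: "('o, 'm, 'x) exact_cat_scheme \<Rightarrow> 'o \<Rightarrow> bool" where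
  "injective E j \<longleftrightarrow> j \<in> Obj E \<and>
     (\<forall>a b. \<forall>i \<in> Hom E a b. \<forall>f \<in> Hom E a j. inflation E i \<longrightarrow> (\<exists>g \<in> Hom E b j. g \<cdot>\<^bsub>E\<^esub> i = f))"

definition projective :: "('o, 'm, 'x) exact_cat_scheme \<Rightarrow> 'o \<Rightarrow> bool" where
  "projective E j \<longleftrightarrow> j \<in> Obj E \<and>
     (\<forall>b c. \<forall>p \<in> Hom E b c. \<forall>f \<in> Hom E j c. deflation E p \<longrightarrow> (\<exists>g \<in> Hom E j b. p \<cdot>\<^bsub>E\<^esub> g = f))"

locale frobenius_category = exact_category +
  assumes enough_injectives: "a \<in> Obj E \<Longrightarrow> \<exists>j i. injective E j \<and> i \<in> Hom E a j \<and> inflation E i"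
    and enough_projectives: "a \<in> Obj E \<Longrightarrow> \<exists>j p. projective E j \<and> p \<in> Hom E j a \<and> deflation E p"
    and injective_iff_projective: "injective E j \<longleftrightarrow> projective E j"

text \<open>
  The stable category has the same objects; its morphisms are residue classes modulo morphisms
  factoring through an injective (equivalently, projective) object.
\<close>

definition stable_class :: "('o, 'm, 'x) exact_cat_scheme \<Rightarrow> 'm \<Rightarrow> 'm set" where
  "stable_class E f = {g. \<exists>a b j u v. f \<in> Hom E a b \<and> g \<in> Hom E a b \<and> injective E j \<and>
     u \<in> Hom E a j \<and> v \<in> Hom E j b \<and> g = f \<oplus>\<^bsub>E\<^esub> v \<cdot>\<^bsub>E\<^esub> u}"

text \<open>
  The suspension of \<open>a\<close> is the cokernel \<open>c\<close> in a chosen conflation \<open>a \<rightarrow> j \<rightarrow> c\<close> with \<open>j\<close> injective.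
  Different choices yield triangle equivalent stable categories.
\<close>

definition injective_embedding ::
  "('o, 'm, 'x) exact_cat_scheme \<Rightarrow> 'o \<Rightarrow> 'o \<times> 'o \<times> 'm \<times> 'm" where
  "injective_embedding E a = (SOME (j, c, i, p).
     injective E j \<and> i \<in> Hom E a j \<and> p \<in> Hom E j c \<and> (i, p) \<in> Conf E)"

definition inj_obj :: "('o, 'm, 'x) exact_cat_scheme \<Rightarrow> 'o \<Rightarrow> 'o" where
  "inj_obj E a = (case injective_embedding E a of (j, c, i, p) \<Rightarrow> j)"

definition cosyzygy :: "('o, 'm, 'x) exact_cat_scheme \<Rightarrow> 'o \<Rightarrow> 'o" where
  "cosyzygy E a = (case injective_embedding E a of (j, c, i, p) \<Rightarrow> c)"

definition inj_incl :: "('o, 'm, 'x) exact_cat_scheme \<Rightarrow> 'o \<Rightarrow> 'm" where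
  "inj_incl E a = (case injective_embedding E a of (j, c, i, p) \<Rightarrow> i)"

definition inj_proj :: "('o, 'm, 'x) exact_cat_scheme \<Rightarrow> 'o \<Rightarrow> 'm" where
  "inj_proj E a = (case injective_embedding E a of (j, c, i, p) \<Rightarrow> p)"

text \<open>
  Operations on classes are computed on representatives; as the result does not depend on the
  representatives, the unions below are unions of a single class. The suspension of the class of
  \<open>f\<close> is the class of any \<open>s\<close> induced on cokernels by an extension \<open>u\<close> of \<open>f\<close> to the chosen
  injectives.
\<close>

definition stable_susp_cat :: "('o, 'm, 'x) exact_cat_scheme \<Rightarrow> ('o, 'm set) susp_cat" where
  "stable_susp_cat E = \<lparr>
     Obj = Obj E,
     Hom = (\<lambda>a b. stable_class E ` Hom E a b),
     Id = (\<lambda>a. stable_class E (Id E a)),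
     Zero = (\<lambda>a b. stable_class E (Zero E a b)),
     Comp = (\<lambda>G F. \<Union>g\<in>G. \<Union>f\<in>F. stable_class E (g \<cdot>\<^bsub>E\<^esub> f)),
     Add = (\<lambda>F G. \<Union>f\<in>F. \<Union>g\<in>G. stable_class E (f \<oplus>\<^bsub>E\<^esub> g)),
     Sus = cosyzygy E,
     SusM = (\<lambda>F. \<Union>{stable_class E s | s. \<exists>f\<in>F. \<exists>a b u. f \<in> Hom E a b \<and>
        u \<in> Hom E (inj_obj E a) (inj_obj E b) \<and> s \<in> Hom E (cosyzygy E a) (cosyzygy E b) \<and>
        u \<cdot>\<^bsub>E\<^esub> inj_incl E a = inj_incl E b \<cdot>\<^bsub>E\<^esub> f \<and>
        s \<cdot>\<^bsub>E\<^esub> inj_proj E a = inj_proj E b \<cdot>\<^bsub>E\<^esub> u}) \<rparr>"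

text \<open>
  The standard triangle on \<open>f : a \<rightarrow> b\<close> is \<open>a \<rightarrow> b \<rightarrow> d \<rightarrow> cosyzygy E a\<close>, where \<open>d\<close> is the pushout of
  the chosen embedding of \<open>a\<close> along \<open>f\<close> (Happel).
\<close>

definition standard_triangle :: "('o, 'm, 'x) exact_cat_scheme \<Rightarrow> 'm \<Rightarrow> 'm \<Rightarrow> 'm \<Rightarrow> bool" where
  "standard_triangle E f g h \<longleftrightarrow> (\<exists>a b d f'.
     pushout E a (inj_obj E a) b d (inj_incl E a) f g f' \<and>
     h \<in> Hom E d (cosyzygy E a) \<and> h \<cdot>\<^bsub>E\<^esub> f' = inj_proj E a \<and>
     h \<cdot>\<^bsub>E\<^esub> g = Zero E b (cosyzygy E a))"

definition stable_category :: "('o, 'm, 'x) exact_cat_scheme \<Rightarrow> ('o, 'm set) tri_cat" where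
  "stable_category E = susp_cat.extend (stable_susp_cat E) (tri_cat.fields
     {t. \<exists>f g h. standard_triangle E f g h \<and>
        triangle_iso (stable_susp_cat E) (stable_class E f, stable_class E g, stable_class E h) t})"

text \<open>
  \<open>T\<close> is algebraic if \<open>algebraic_via T E\<close> for some \<open>E\<close>. HOL cannot quantify existentially over the
  types of objects and morphisms of \<open>E\<close>, so theorems about algebraic \<open>T\<close> take an arbitrary \<open>E\<close>, of
  arbitrary types, as a parameter. No linear structure is required of \<open>E\<close>.
\<close>

definition algebraic_via ::
  "('o, 'm, 'x) tri_cat_scheme \<Rightarrow> ('p, 'n, 'y) exact_cat_scheme \<Rightarrow> bool" where
  "algebraic_via T E \<longleftrightarrow> frobenius_category E \<and>
     (\<exists>F Fm \<eta>. triangle_equivalence T (stable_category E) F Fm \<eta>)"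


section \<open>Spherical objects\<close>

text \<open>
  The degree \<open>n\<close> part of the graded morphism space, i.e. \<open>Hom(a, \<Sigma>\<^sup>n b)\<close>. As the suspension is
  fully faithful, negative powers on the second argument can be moved to the first, which avoids
  choosing a quasi-inverse of the suspension. Note that \<open>nat\<close> truncates negative integers to \<open>0\<close>.
\<close>

definition graded_hom :: "('o, 'm, 'x) susp_cat_scheme \<Rightarrow> 'o \<Rightarrow> 'o \<Rightarrow> int \<Rightarrow> 'm set" where
  "graded_hom T a b n = Hom T ((Sus T ^^ nat (- n)) a) ((Sus T ^^ nat n) b)"

text \<open>
  The composite of \<open>g\<close> of degree \<open>n\<close> with \<open>f\<close> of degree \<open>m\<close>, i.e. \<open>\<Sigma>\<^sup>m(g) \<circ> f\<close>. Both factors are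
  suspended until they are composable; the result is the unique morphism of degree \<open>m + n\<close>
  in the normal form of \<open>graded_hom\<close> that is taken to this composite by a power of the suspension.
\<close>

definition graded_comp ::
  "('o, 'm, 'x) susp_cat_scheme \<Rightarrow> 'o \<Rightarrow> 'o \<Rightarrow> int \<Rightarrow> int \<Rightarrow> 'm \<Rightarrow> 'm \<Rightarrow> 'm" where
  "graded_comp T a c n m g f = (THE h. h \<in> graded_hom T a c (m + n) \<and>
     (SusM T ^^ (nat (- m) + nat (- n) - nat (- (m + n)))) h =
       (SusM T ^^ nat m) g \<cdot>\<^bsub>T\<^esub> (SusM T ^^ nat (- n)) f)"

text \<open>
  The degree \<open>n\<close> part of \<open>k[X]/(X\<^sup>2)\<close> with \<open>X\<close> in degree \<open>w\<close>; residue classes are represented by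
  polynomials of degree less than \<open>2\<close>, with multiplication \<open>(p * q) mod X\<^sup>2\<close>.
\<close>

definition dual_numbers_part :: "int \<Rightarrow> int \<Rightarrow> 'k::field poly set" where
  "dual_numbers_part w n = {p. degree p < 2 \<and> (\<forall>i. coeff p i \<noteq> 0 \<longrightarrow> int i * w = n)}"

definition spherical_object ::
  "('o, 'm, 'x) susp_cat_scheme \<Rightarrow> ('k::field \<Rightarrow> 'm \<Rightarrow> 'm) \<Rightarrow> int \<Rightarrow> 'o \<Rightarrow> bool" where
  "spherical_object T scale w s \<longleftrightarrow> s \<in> Obj T \<and>
     (\<exists>\<phi> :: int \<Rightarrow> 'k poly \<Rightarrow> 'm.
        (\<forall>n. bij_betw (\<phi> n) (dual_numbers_part w n) (graded_hom T s s n)) \<and>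
        (\<forall>n. \<forall>p \<in> dual_numbers_part w n. \<forall>q \<in> dual_numbers_part w n.
           \<phi> n (p + q) = \<phi> n p \<oplus>\<^bsub>T\<^esub> \<phi> n q) \<and>
        (\<forall>n c. \<forall>p \<in> dual_numbers_part w n. \<phi> n (smult c p) = scale c (\<phi> n p)) \<and>
        (\<forall>m n. \<forall>p \<in> dual_numbers_part w m. \<forall>q \<in> dual_numbers_part w n.
           \<phi> (m + n) ((q * p) mod monom 1 2) = graded_comp T s s n m (\<phi> n q) (\<phi> m p)) \<and>
        \<phi> 0 1 = Id T s)"


section \<open>Classical generation\<close>

text \<open>
  Closure under cones suffices: by rotation and (de)suspension, any two objects of a
  distinguished triangle then give the third.
\<close>

inductive_set built_from :: "('o, 'm, 'x) tri_cat_scheme \<Rightarrow> 'o \<Rightarrow> 'o set"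
  for T :: "('o, 'm, 'x) tri_cat_scheme" and s :: 'o where
  generator: "s \<in> built_from T s"
| suspension: "a \<in> built_from T s \<Longrightarrow> Sus T a \<in> built_from T s"
| desuspension: "Sus T a \<in> built_from T s \<Longrightarrow> a \<in> Obj T \<Longrightarrow> a \<in> built_from T s"
| cone: "(f, g, h) \<in> Tri T \<Longrightarrow> candidate_triangle T a b c f g h \<Longrightarrow>
    a \<in> built_from T s \<Longrightarrow> b \<in> built_from T s \<Longrightarrow> c \<in> built_from T s"
| summand: "a \<in> built_from T s \<Longrightarrow> direct_summand T b a \<Longrightarrow> b \<in> built_from T s"

definition classically_generated :: "('o, 'm, 'x) tri_cat_scheme \<Rightarrow> 'o \<Rightarrow> bool" where
  "classically_generated T s \<longleftrightarrow> s \<in> Obj T \<and> Obj T \<subseteq> built_from T s"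


section \<open>Torsion pairs, t-structures and co-t-structures\<close>

text \<open>Full subcategories are given by their sets of objects.\<close>

definition torsion_pair :: "('o, 'm, 'x) tri_cat_scheme \<Rightarrow> 'o set \<Rightarrow> 'o set \<Rightarrow> bool" where
  "torsion_pair T M N \<longleftrightarrow> M \<subseteq> Obj T \<and> N \<subseteq> Obj T \<and>
     (\<forall>a \<in> M. \<forall>b \<in> M. \<forall>c. direct_sum T a b c \<longrightarrow> c \<in> M) \<and>
     (\<forall>a \<in> N. \<forall>b \<in> N. \<forall>c. direct_sum T a b c \<longrightarrow> c \<in> N) \<and>
     (\<forall>a \<in> M. \<forall>b. direct_summand T b a \<longrightarrow> b \<in> M) \<and>
     (\<forall>a \<in> N. \<forall>b. direct_summand T b a \<longrightarrow> b \<in> N) \<and>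
     (\<forall>m \<in> M. \<forall>n \<in> N. Hom T m n = {Zero T m n}) \<and>
     (\<forall>s \<in> Obj T. \<exists>m \<in> M. \<exists>n \<in> N. \<exists>f g h.
        candidate_triangle T m s n f g h \<and> (f, g, h) \<in> Tri T)"

text \<open>
  \<open>shift T i M\<close> is \<open>\<Sigma>\<^sup>i M\<close>, closed under isomorphism; for negative \<open>i\<close> it consists of the objects
  whose \<open>(-i)\<close>-fold suspension is isomorphic to an object of \<open>M\<close>.
\<close>

definition shift :: "('o, 'm, 'x) susp_cat_scheme \<Rightarrow> int \<Rightarrow> 'o set \<Rightarrow> 'o set" where
  "shift T i M = {x \<in> Obj T. \<exists>m \<in> M.
     isomorphic T ((Sus T ^^ nat (- i)) x) ((Sus T ^^ nat i) m)}"

definition t_structure :: "('o, 'm, 'x) tri_cat_scheme \<Rightarrow> 'o set \<Rightarrow> 'o set \<Rightarrow> bool" where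
  "t_structure T M N \<longleftrightarrow> torsion_pair T M N \<and> shift T 1 M \<subseteq> M"

definition co_t_structure :: "('o, 'm, 'x) tri_cat_scheme \<Rightarrow> 'o set \<Rightarrow> 'o set \<Rightarrow> bool" where
  "co_t_structure T M N \<longleftrightarrow> torsion_pair T M N \<and> shift T (- 1) M \<subseteq> M"

definition trivial_pair :: "('o, 'm, 'x) precat_scheme \<Rightarrow> 'o set \<Rightarrow> 'o set \<Rightarrow> bool" where
  "trivial_pair T M N \<longleftrightarrow>
     M = Obj T \<and> N = zero_objects T \<or> M = zero_objects T \<and> N = Obj T"

end

theory Submission
  imports Defs
begin

text \<open>
  Let \<open>\<sigma> i\<close> be the \<open>i\<close>-th shift of the spherical object. Then \<open>Hom(\<sigma> i, \<sigma> j) = 0\<close> unless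
  \<open>j - i \<in> {0, w}\<close>, and \<open>End(\<sigma> i)\<close> is local with radical of square zero. For \<open>w \<ge> 1\<close> the factors of an
  iterated extension of the \<open>\<sigma> i\<close> can be sorted by decreasing \<open>i\<close>, which gives the canonical
  t-structure; for \<open>w \<le> 0\<close> one kills the maps to \<open>\<sigma> i\<close> from the largest \<open>i\<close> downwards, which gives the
  canonical co-t-structure.

  For the classification, compare the extremal degrees of the maps \<open>m \<rightarrow> \<sigma> i\<close> and \<open>\<sigma> i \<rightarrow> n\<close>: where
  these meet, \<open>Hom(m, n) \<noteq> 0\<close>. Hence a non-trivial structure \<open>(M, N)\<close> is separated by a degree \<open>c\<close> and
  so contained in, thus equal to, a shift of the canonical one. For the other sign of \<open>w\<close> one
  compares the opposite extremal degrees, using a non-zero map \<open>\<sigma> i \<rightarrow> \<sigma> (i + w)\<close>. The separation is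
  then so wide that also \<open>Hom(n, \<Sigma> m) = 0\<close>; all truncations split, which is impossible for a suitable
  \<open>\<sigma> i\<close> or, if \<open>w = 0\<close>, for the cone of a nilpotent endomorphism.
\<close>

section \<open>Preadditive categories\<close>

text \<open>The sign of \<open>w\<close> decides which long exact sequences have a vanishing end.
  For \<open>w \<ge> 1\<close> there are no maps from \<sigma> i to \<sigma> j with
  \<open>j < i\<close>; truncation is functorial, and the cone of one nonzero map to the extreme
  degree already leaves that degree, because End(\<sigma> a) is a division ring. For
  \<open>w \<le> 0\<close> there are no maps from \<sigma> i to \<sigma> j with
  \<open>j > i\<close>; truncation is not functorial, one fibre or cone need not leave the degree,
  and for \<open>w = 0\<close> a nonzero map can be killed by a nonzero nilpotent endomorphism. What
  remains is Hom(\<sigma> q, \<Sigma> \<sigma> i) = 0 for \<open>i \<ge> q\<close>, so that maps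
  extend from fibres: generators of Hom(-, \<sigma> q) are removed one at a time, and extremal
  degrees are compared at the last of them. Nilpotents are absorbed by one device: an equation f = f
  e with a non-unit e gives f = f e e = 0. The constant \<open>w\<close> in the separating bounds
  comes from comparing maps into the \<sigma> i with maps out of them; a nonzero \<sigma> i
  \<rightarrow> \<sigma> (i + w) relates the two with that offset.\<close>

context preadditive_category
begin

text \<open>A morphism determines its endpoints, so composability becomes an equation between
  \<open>src\<close> and \<open>tgt\<close>. Typing side conditions are then settled by rewriting,
  and \<open>hom_iff\<close> translates back to membership in \<open>Hom\<close>.\<close>

definition arr :: "'m \<Rightarrow> bool" where
  "arr f \<longleftrightarrow> (\<exists>a b. f \<in> Hom C a b)"

definition src :: "'m \<Rightarrow> 'o" where
  "src f = (THE a. \<exists>b. f \<in> Hom C a b)"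

definition tgt :: "'m \<Rightarrow> 'o" where
  "tgt f = (THE b. \<exists>a. f \<in> Hom C a b)"

lemma hom_iff: "f \<in> Hom C a b \<longleftrightarrow> arr f \<and> src f = a \<and> tgt f = b"
proof -
  have "src f = a \<and> tgt f = b" if "f \<in> Hom C a b" for a b
    unfolding src_def tgt_def using that hom_unique by (blast intro: the_equality)
  then show ?thesis
    unfolding arr_def by blast
qed

lemma arr_hom: "arr f \<Longrightarrow> f \<in> Hom C (src f) (tgt f)"
  by (simp add: hom_iff)

lemma src_obj [simp]: "arr f \<Longrightarrow> src f \<in> Obj C"
  and tgt_obj [simp]: "arr f \<Longrightarrow> tgt f \<in> Obj C"
  using hom_obj arr_hom by blast+

lemma comp_arr [simp]:
  assumes "arr f" "arr g" "src g = tgt f"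
  shows "arr (g \<cdot> f)" "src (g \<cdot> f) = src f" "tgt (g \<cdot> f) = tgt g"
  using comp_hom[of f "src f" "tgt f" g "tgt g"] assms by (auto simp: hom_iff)

lemma id_arr [simp]:
  assumes "a \<in> Obj C"
  shows "arr (Id C a)" "src (Id C a) = a" "tgt (Id C a) = a"
  using id_hom[OF assms] by (auto simp: hom_iff)

lemma zero_arr [simp]:
  assumes "a \<in> Obj C" "b \<in> Obj C"
  shows "arr (Zero C a b)" "src (Zero C a b) = a" "tgt (Zero C a b) = b"
  using zero_hom[OF assms] by (auto simp: hom_iff)

lemma add_arr [simp]:
  assumes "arr f" "arr g" "src g = src f" "tgt g = tgt f"
  shows "arr (f \<oplus> g)" "src (f \<oplus> g) = src f" "tgt (f \<oplus> g) = tgt f"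
  using add_hom[of f "src f" "tgt f" g] assms by (auto simp: hom_iff)

lemma comp_id [simp]:
  "arr f \<Longrightarrow> tgt f = b \<Longrightarrow> Id C b \<cdot> f = f"
  "arr f \<Longrightarrow> src f = a \<Longrightarrow> f \<cdot> Id C a = f"
  using id_left[of f] id_right[of f] by (auto simp: hom_iff)

lemma assoc [simp]:
  "arr f \<Longrightarrow> arr g \<Longrightarrow> arr h \<Longrightarrow> src g = tgt f \<Longrightarrow> src h = tgt g \<Longrightarrow> (h \<cdot> g) \<cdot> f = h \<cdot> (g \<cdot> f)"
  using comp_assoc[of f "src f" "tgt f" g "tgt g" h "tgt h"] by (simp add: hom_iff)

text \<open>\<open>assoc\<close> moves all brackets to the right, which hides a known composite
  \<open>g \<cdot> f\<close> inside \<open>g \<cdot> (f \<cdot> e)\<close>; this is the rewrite in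
  its reassociated form.\<close>

lemma assoc_eq:
  "g \<cdot> f = k \<Longrightarrow> arr g \<Longrightarrow> arr f \<Longrightarrow> src g = tgt f \<Longrightarrow> arr e \<Longrightarrow> src f = tgt e \<Longrightarrow>
    g \<cdot> (f \<cdot> e) = k \<cdot> e"
  using assoc by metis

lemma comp_add [simp]:
  "arr f \<Longrightarrow> arr f' \<Longrightarrow> arr g \<Longrightarrow> src f' = src f \<Longrightarrow> tgt f' = tgt f \<Longrightarrow> src g = tgt f \<Longrightarrow>
    g \<cdot> (f \<oplus> f') = g \<cdot> f \<oplus> g \<cdot> f'"
  using comp_add_right[of f "src f" "tgt f" f' g "tgt g"] by (simp add: hom_iff)

lemma add_comp [simp]:
  "arr f \<Longrightarrow> arr g \<Longrightarrow> arr g' \<Longrightarrow> src g' = src g \<Longrightarrow> tgt g' = tgt g \<Longrightarrow> src g = tgt f \<Longrightarrow>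
    (g \<oplus> g') \<cdot> f = g \<cdot> f \<oplus> g' \<cdot> f"
  using comp_add_left[of f "src f" "tgt f" g "tgt g" g'] by (simp add: hom_iff)

lemma sum_assoc [simp]:
  "arr f \<Longrightarrow> arr g \<Longrightarrow> arr h \<Longrightarrow> src g = src f \<Longrightarrow> tgt g = tgt f \<Longrightarrow> src h = src f \<Longrightarrow> tgt h = tgt f \<Longrightarrow>
    (f \<oplus> g) \<oplus> h = f \<oplus> (g \<oplus> h)"
  using add_assoc[of f "src f" "tgt f" g h] by (simp add: hom_iff)

lemma sum_commute:
  "arr f \<Longrightarrow> arr g \<Longrightarrow> src g = src f \<Longrightarrow> tgt g = tgt f \<Longrightarrow> f \<oplus> g = g \<oplus> f"
  using add_commute[of f "src f" "tgt f" g] by (simp add: hom_iff)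

lemma sum_zero [simp]:
  assumes "arr f" "src f = a" "tgt f = b"
  shows "f \<oplus> Zero C a b = f" "Zero C a b \<oplus> f = f"
  using add_zero[of f a b] sum_commute[of f "Zero C a b"] assms
  by (auto simp: hom_iff)

lemma sum_cancel:
  assumes "arr f" "arr g" "arr h" "src g = src f" "tgt g = tgt f" "src h = src f" "tgt h = tgt f"
    "f \<oplus> g = f \<oplus> h"
  shows "g = h"
proof -
  obtain f' where f': "f' \<in> Hom C (src f) (tgt f)" "f \<oplus> f' = Zero C (src f) (tgt f)"
    using add_inverse arr_hom assms(1) by metis
  have f'f: "f' \<oplus> f = Zero C (src f) (tgt f)"
    using sum_commute[of f f'] f' assms by (simp add: hom_iff)
  have "f' \<oplus> (f \<oplus> g) = f' \<oplus> (f \<oplus> h)"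
    using assms by simp
  then have "(f' \<oplus> f) \<oplus> g = (f' \<oplus> f) \<oplus> h"
    using assms f' by (simp add: hom_iff)
  then show ?thesis
    using assms f'f by simp
qed

lemma neg_eqI:
  assumes "arr f" "arr g" "src g = src f" "tgt g = tgt f" "f \<oplus> g = Zero C (src f) (tgt f)"
  shows "neg C f = g"
  unfolding neg_def
proof (rule the_equality)
  show "\<exists>a b. f \<in> Hom C a b \<and> g \<in> Hom C a b \<and> f \<oplus> g = Zero C a b"
    using assms by (auto simp: hom_iff)
  show "h = g" if "\<exists>a b. f \<in> Hom C a b \<and> h \<in> Hom C a b \<and> f \<oplus> h = Zero C a b" for h
    using that assms sum_cancel[of f h g] by (auto simp: hom_iff)
qed

lemma neg_arr [simp]:
  assumes "arr f"
  shows "arr (neg C f)" "src (neg C f) = src f" "tgt (neg C f) = tgt f"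
    "f \<oplus> neg C f = Zero C (src f) (tgt f)" "neg C f \<oplus> f = Zero C (src f) (tgt f)"
proof -
  obtain g where g: "g \<in> Hom C (src f) (tgt f)" "f \<oplus> g = Zero C (src f) (tgt f)"
    using add_inverse arr_hom assms(1) by metis
  then have *: "neg C f = g"
    using neg_eqI assms by (simp add: hom_iff)
  show "arr (neg C f)" "src (neg C f) = src f" "tgt (neg C f) = tgt f"
    "f \<oplus> neg C f = Zero C (src f) (tgt f)"
    using g * by (auto simp: hom_iff)
  then show "neg C f \<oplus> f = Zero C (src f) (tgt f)"
    using sum_commute[of f "neg C f"] assms by simp
qed

lemma neg_neg [simp]: "arr f \<Longrightarrow> neg C (neg C f) = f"
  by (rule neg_eqI) auto

lemma comp_zero [simp]:
  assumes "arr g" "src g = b" "a \<in> Obj C"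
  shows "g \<cdot> Zero C a b = Zero C a (tgt g)"
proof -
  have b: "b \<in> Obj C"
    using assms by auto
  let ?z = "Zero C a b"
  have "g \<cdot> ?z \<oplus> g \<cdot> ?z = g \<cdot> (?z \<oplus> ?z)"
    by (rule comp_add[symmetric]) (use assms b in auto)
  also have "?z \<oplus> ?z = ?z"
    using assms b by simp
  also have "g \<cdot> ?z = g \<cdot> ?z \<oplus> Zero C a (tgt g)"
    by (rule sum_zero(1)[symmetric]) (use assms b in auto)
  finally show ?thesis
    by (rule sum_cancel[rotated -1]) (use assms b in auto)
qed

lemma zero_comp [simp]:
  assumes "arr f" "tgt f = b" "c \<in> Obj C"
  shows "Zero C b c \<cdot> f = Zero C (src f) c"
proof -
  have b: "b \<in> Obj C"
    using assms by auto
  let ?z = "Zero C b c"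
  have "?z \<cdot> f \<oplus> ?z \<cdot> f = (?z \<oplus> ?z) \<cdot> f"
    by (rule add_comp[symmetric]) (use assms b in auto)
  also have "?z \<oplus> ?z = ?z"
    using assms b by simp
  also have "?z \<cdot> f = ?z \<cdot> f \<oplus> Zero C (src f) c"
    by (rule sum_zero(1)[symmetric]) (use assms b in auto)
  finally show ?thesis
    by (rule sum_cancel[rotated -1]) (use assms b in auto)
qed

lemma comp_neg [simp]: "arr f \<Longrightarrow> arr g \<Longrightarrow> src g = tgt f \<Longrightarrow> g \<cdot> neg C f = neg C (g \<cdot> f)"
  by (rule neg_eqI[symmetric]) (auto simp flip: comp_add)

lemma neg_comp [simp]: "arr f \<Longrightarrow> arr g \<Longrightarrow> src g = tgt f \<Longrightarrow> neg C g \<cdot> f = neg C (g \<cdot> f)"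
  by (rule neg_eqI[symmetric]) (auto simp flip: add_comp)

lemma neg_zero [simp]: "a \<in> Obj C \<Longrightarrow> b \<in> Obj C \<Longrightarrow> neg C (Zero C a b) = Zero C a b"
  by (rule neg_eqI) auto

lemma diff_zeroD:
  assumes "f \<oplus> neg C g = Zero C a b" "arr f" "arr g" "src g = src f" "tgt g = tgt f" "src f = a" "tgt f = b"
  shows "f = g"
proof -
  have "neg C g \<oplus> f = neg C g \<oplus> g"
    using assms sum_commute[of f "neg C g"] by simp
  then show ?thesis
    using assms by (intro sum_cancel[of "neg C g" f g]) auto
qed

lemma diff_add [simp]:
  assumes "arr f" "arr g" "src g = src f" "tgt g = tgt f"
  shows "g \<oplus> (f \<oplus> neg C g) = f"
proof -
  have "f \<oplus> neg C g = neg C g \<oplus> f"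
    by (rule sum_commute) (use assms in auto)
  also have "g \<oplus> (neg C g \<oplus> f) = (g \<oplus> neg C g) \<oplus> f"
    by (rule sum_assoc[symmetric]) (use assms in auto)
  also have "\<dots> = f"
    using assms by (simp del: sum_assoc)
  finally show ?thesis .
qed

lemma neg_eq_zeroD:
  assumes "neg C f = Zero C a b" "arr f" "src f = a" "tgt f = b"
  shows "f = Zero C a b"
proof -
  have "f = neg C (neg C f)"
    using assms(2) by simp
  also have "\<dots> = Zero C a b"
    unfolding assms(1) using assms by (intro neg_zero) auto
  finally show ?thesis .
qed

text \<open>Stated elementwise rather than as \<open>Hom C a b = {Zero C a b}\<close>, so that it
  holds vacuously when \<open>a\<close> or \<open>b\<close> is not an object and carries no side
  conditions.\<close>

definition van :: "'o \<Rightarrow> 'o \<Rightarrow> bool" where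
  "van a b \<longleftrightarrow> (\<forall>f \<in> Hom C a b. f = Zero C a b)"

definition iso :: "'m \<Rightarrow> bool" where
  "iso f \<longleftrightarrow> arr f \<and> (\<exists>g. arr g \<and> src g = tgt f \<and> tgt g = src f \<and>
     g \<cdot> f = Id C (src f) \<and> f \<cdot> g = Id C (tgt f))"

text \<open>No complement is asked for, unlike for \<open>direct_summand\<close>. Retracts compose
  and are easily produced by fill-in arguments; once idempotents split,
  \<open>retract_direct_summand\<close> supplies the complement.\<close>

definition retract :: "'o \<Rightarrow> 'o \<Rightarrow> bool" where
  "retract a b \<longleftrightarrow> (\<exists>i \<in> Hom C a b. \<exists>p \<in> Hom C b a. p \<cdot> i = Id C a)"

lemma vanD: "van a b \<Longrightarrow> arr f \<Longrightarrow> src f = a \<Longrightarrow> tgt f = b \<Longrightarrow> f = Zero C a b"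
  by (auto simp: van_def hom_iff)

lemma vanI: "(\<And>f. arr f \<Longrightarrow> src f = a \<Longrightarrow> tgt f = b \<Longrightarrow> f = Zero C a b) \<Longrightarrow> van a b"
  by (auto simp: van_def hom_iff)

lemma not_vanE:
  assumes "\<not> van a b"
  obtains f where "arr f" "src f = a" "tgt f = b" "f \<noteq> Zero C a b"
  using assms by (auto simp: van_def hom_iff)

lemma isomorphism_iff: "isomorphism C a b f \<longleftrightarrow> iso f \<and> src f = a \<and> tgt f = b"
  by (auto simp: isomorphism_def iso_def hom_iff)

lemma iso_arr: "iso f \<Longrightarrow> arr f"
  by (simp add: iso_def)

lemma isoI:
  "arr f \<Longrightarrow> arr g \<Longrightarrow> src g = tgt f \<Longrightarrow> tgt g = src f \<Longrightarrow> g \<cdot> f = Id C (src f) \<Longrightarrow>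
    f \<cdot> g = Id C (tgt f) \<Longrightarrow> iso f"
  by (auto simp: iso_def)

definition inv :: "'m \<Rightarrow> 'm" where
  "inv f = (SOME g. arr g \<and> src g = tgt f \<and> tgt g = src f \<and> g \<cdot> f = Id C (src f) \<and> f \<cdot> g = Id C (tgt f))"

lemma inv [simp]:
  assumes "iso f"
  shows "arr (inv f)" "src (inv f) = tgt f" "tgt (inv f) = src f"
    "inv f \<cdot> f = Id C (src f)" "f \<cdot> inv f = Id C (tgt f)"
  using someI_ex[of "\<lambda>g. arr g \<and> src g = tgt f \<and> tgt g = src f \<and> g \<cdot> f = Id C (src f) \<and> f \<cdot> g = Id C (tgt f)"] assms
  unfolding iso_def inv_def by auto

lemma iso_inv [simp]: "iso f \<Longrightarrow> iso (inv f)"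
  by (rule isoI[of _ f]) (auto simp: iso_arr)

lemma inv_comp [simp]:
  "iso f \<Longrightarrow> arr g \<Longrightarrow> tgt g = src f \<Longrightarrow> inv f \<cdot> (f \<cdot> g) = g"
  "iso f \<Longrightarrow> arr g \<Longrightarrow> tgt g = tgt f \<Longrightarrow> f \<cdot> (inv f \<cdot> g) = g"
  by (simp_all flip: assoc add: iso_arr)

lemma iso_id [simp]: "a \<in> Obj C \<Longrightarrow> iso (Id C a)"
  by (rule isoI[of _ "Id C a"]) auto

text \<open>Left and right inverse agree. Needed where two composites are invertible for separate
  reasons, which yields one-sided inverses by different formulas.\<close>

lemma iso_two_sided:
  assumes "arr f" "arr g" "arr h" "src g = tgt f" "tgt g = src f" "src h = tgt f" "tgt h = src f"
    "g \<cdot> f = Id C (src f)" "f \<cdot> h = Id C (tgt f)"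
  shows "iso f"
proof -
  have "g = g \<cdot> (f \<cdot> h)"
    unfolding assms(9) using assms(1-7) by simp
  also have "\<dots> = (g \<cdot> f) \<cdot> h"
    using assms(1-7) by simp
  also have "\<dots> = h"
    unfolding assms(8) using assms(1-7) by simp
  finally have "g = h" .
  then have "f \<cdot> g = Id C (tgt f)"
    using assms(9) by (simp only:)
  then show ?thesis
    by (rule isoI[OF assms(1,2,4,5,8)])
qed

lemma iso_comp: "iso f \<Longrightarrow> iso g \<Longrightarrow> src g = tgt f \<Longrightarrow> iso (g \<cdot> f)"
  by (rule isoI[of _ "inv f \<cdot> inv g"]) (auto simp: iso_arr)

lemma iso_neg: "iso f \<Longrightarrow> iso (neg C f)"
  by (rule isoI[of _ "neg C (inv f)"]) (auto simp: iso_arr)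

lemma iso_left_cancel:
  assumes "iso f" "f \<cdot> g = Zero C a c" "arr g" "tgt g = src f" "src g = a" "tgt f = c"
  shows "g = Zero C a (src f)"
proof -
  have "g = inv f \<cdot> (f \<cdot> g)"
    using assms(1,3,4) by simp
  also have "\<dots> = Zero C a (src f)"
    unfolding assms(2) using assms(1,3-6) iso_arr[OF assms(1)] by auto
  finally show ?thesis .
qed

lemma iso_right_cancel:
  assumes "iso f" "g \<cdot> f = Zero C a c" "arr g" "src g = tgt f" "src f = a" "tgt g = c"
  shows "g = Zero C (tgt f) c"
proof -
  have "g = (g \<cdot> f) \<cdot> inv f"
    using assms(1,3,4) iso_arr[OF assms(1)] by simp
  also have "\<dots> = Zero C (tgt f) c"
    unfolding assms(2) using assms(1,3-6) iso_arr[OF assms(1)] by auto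
  finally show ?thesis .
qed

lemma retractE:
  assumes "retract a b"
  obtains i p where "arr i" "src i = a" "tgt i = b" "arr p" "src p = b" "tgt p = a" "p \<cdot> i = Id C a"
  using assms by (auto simp: retract_def hom_iff)

lemma retractI:
  "arr i \<Longrightarrow> src i = a \<Longrightarrow> tgt i = b \<Longrightarrow> arr p \<Longrightarrow> src p = b \<Longrightarrow> tgt p = a \<Longrightarrow> p \<cdot> i = Id C a \<Longrightarrow> retract a b"
  unfolding retract_def by (metis hom_iff)

lemma retract_refl: "a \<in> Obj C \<Longrightarrow> retract a a"
  by (rule retractI[of "Id C a" _ _ "Id C a"]) auto

lemma retract_obj: "retract a b \<Longrightarrow> a \<in> Obj C \<and> b \<in> Obj C"
  by (elim retractE) auto

lemma retract_trans:
  assumes "retract a b" "retract b c"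
  shows "retract a c"
proof -
  obtain i p where 1: "arr i" "src i = a" "tgt i = b" "arr p" "src p = b" "tgt p = a" "p \<cdot> i = Id C a"
    using assms(1) by (rule retractE)
  obtain j q where 2: "arr j" "src j = b" "tgt j = c" "arr q" "src q = c" "tgt q = b" "q \<cdot> j = Id C b"
    using assms(2) by (rule retractE)
  show ?thesis
    using 1 2 assoc_eq[of q j "Id C b" i] by (intro retractI[of "j \<cdot> i" _ _ "p \<cdot> q"]) auto
qed

lemma iso_retract:
  assumes "iso f"
  shows "retract (src f) (tgt f)" "retract (tgt f) (src f)"
  using assms retractI[of f _ _ "inv f"] retractI[of "inv f" _ _ f] by (auto simp: iso_arr)

lemma isomorphic_retract:
  assumes "isomorphic C a b"
  shows "retract a b" "retract b a"
  using assms iso_retract by (auto simp: isomorphic_def isomorphism_iff)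

lemma isomorphic_sym: "isomorphic C a b \<Longrightarrow> isomorphic C b a"
  by (auto simp: isomorphic_def isomorphism_def)

lemma isomorphicI: "iso f \<Longrightarrow> src f = a \<Longrightarrow> tgt f = b \<Longrightarrow> isomorphic C a b"
  by (auto simp: isomorphic_def isomorphism_iff)

lemma isomorphicE:
  assumes "isomorphic C a b"
  obtains f where "iso f" "arr f" "src f = a" "tgt f = b"
  using assms iso_arr unfolding isomorphic_def isomorphism_iff by metis

lemma isomorphic_trans: "isomorphic C a b \<Longrightarrow> isomorphic C b c \<Longrightarrow> isomorphic C a c"
  by (metis isomorphicE iso_comp isomorphicI comp_arr(2,3))

lemma isomorphic_refl: "a \<in> Obj C \<Longrightarrow> isomorphic C a a"
  by (rule isomorphicI[of "Id C a"]) auto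

lemma isomorphic_obj: "isomorphic C a b \<Longrightarrow> a \<in> Obj C \<and> b \<in> Obj C"
  by (elim isomorphicE) auto

lemma van_retract_left:
  assumes "retract a a'" "van a' b"
  shows "van a b"
proof (rule vanI)
  fix f assume f: "arr f" "src f = a" "tgt f = b"
  obtain i p where 1: "arr i" "src i = a" "tgt i = a'" "arr p" "src p = a'" "tgt p = a" "p \<cdot> i = Id C a"
    using assms(1) by (rule retractE)
  have "f = (f \<cdot> p) \<cdot> i"
    using f 1 by simp
  also have "f \<cdot> p = Zero C a' b"
    using assms(2) f 1 by (intro vanD) auto
  finally show "f = Zero C a b"
    using 1 f by (metis zero_comp tgt_obj)
qed

lemma van_retract_right:
  assumes "retract b b'" "van a b'"
  shows "van a b"
proof (rule vanI)
  fix f assume f: "arr f" "src f = a" "tgt f = b"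
  obtain i p where 1: "arr i" "src i = b" "tgt i = b'" "arr p" "src p = b'" "tgt p = b" "p \<cdot> i = Id C b"
    using assms(1) by (rule retractE)
  have "f = p \<cdot> (i \<cdot> f)"
    using f 1 by (simp flip: assoc)
  also have "i \<cdot> f = Zero C a b'"
    using assms(2) f 1 by (intro vanD) auto
  finally show "f = Zero C a b"
    using 1 f by (metis comp_zero src_obj)
qed

lemma zero_objects_iff: "z \<in> zero_objects C \<longleftrightarrow> z \<in> Obj C \<and> Id C z = Zero C z z"
  by (auto simp: zero_objects_def)

lemma van_zero_left: "z \<in> zero_objects C \<Longrightarrow> van z a"
  by (rule vanI) (metis comp_id(2) comp_zero zero_objects_iff)

lemma van_zero_right: "z \<in> zero_objects C \<Longrightarrow> van a z"
  by (rule vanI) (metis comp_id(1) zero_comp zero_objects_iff)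

lemma van_self: "a \<in> Obj C \<Longrightarrow> van a a \<Longrightarrow> a \<in> zero_objects C"
  by (simp add: zero_objects_iff vanD)

lemma zero_retract:
  assumes "z \<in> zero_objects C" "a \<in> Obj C"
  shows "retract z a"
  using assms by (intro retractI[of "Zero C z a" _ _ "Zero C a z"]) (auto simp: zero_objects_iff)

lemma retract_zero: "retract a z \<Longrightarrow> z \<in> zero_objects C \<Longrightarrow> a \<in> zero_objects C"
  using retract_obj van_retract_left van_self van_zero_left van_retract_right by metis


text \<open>The inverse is \<open>1 - n\<close>.\<close>

lemma iso_one_plus_nilpotent:
  assumes "arr n" "src n = a" "tgt n = a" "n \<cdot> n = Zero C a a"
  shows "iso (Id C a \<oplus> n)"
proof -
  have a: "a \<in> Obj C"
    using assms(1,2) by auto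
  \<comment> \<open>Quantified over \<open>n\<close> so as to be used twice: for the given map, and
    for its negative, which yields the product in the other order.\<close>
  have *: "(Id C a \<oplus> n) \<cdot> (Id C a \<oplus> neg C n) = Id C a" if "arr n" "src n = a" "tgt n = a" "n \<cdot> n = Zero C a a" for n
  proof -
    have "(Id C a \<oplus> n) \<cdot> (Id C a \<oplus> neg C n) = (Id C a \<oplus> n) \<oplus> (Id C a \<oplus> n) \<cdot> neg C n"
      using that a by (subst comp_add) auto
    also have "(Id C a \<oplus> n) \<cdot> neg C n = neg C n \<oplus> neg C (n \<cdot> n)"
      using that(1-3) a by (subst add_comp) auto
    also have "\<dots> = neg C n"
      using that a by simp
    also have "Id C a \<oplus> n \<oplus> neg C n = Id C a \<oplus> (n \<oplus> neg C n)"
      using that(1-3) a by (subst sum_assoc) auto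
    finally show ?thesis
      using that a by simp
  qed
  have 1: "(Id C a \<oplus> n) \<cdot> (Id C a \<oplus> neg C n) = Id C a"
    using * assms by blast
  have "(Id C a \<oplus> neg C n) \<cdot> (Id C a \<oplus> neg C (neg C n)) = Id C a"
    by (rule *) (use assms a in auto)
  then have 2: "(Id C a \<oplus> neg C n) \<cdot> (Id C a \<oplus> n) = Id C a"
    unfolding neg_neg[OF assms(1)] .
  show ?thesis
    by (rule isoI[of _ "Id C a \<oplus> neg C n"]) (use 1 2 assms(1-3) a in \<open>simp_all del: comp_add add_comp\<close>)
qed

end

section \<open>Triangles\<close>

context triangulated_category
begin

section \<open>The suspension functor\<close>

lemma sus_obj [simp]: "a \<in> Obj T \<Longrightarrow> Sus T a \<in> Obj T"
  by (rule suspension.F_obj)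

lemma sus_arr [simp]:
  assumes "arr f"
  shows "arr (SusM T f)" "src (SusM T f) = Sus T (src f)" "tgt (SusM T f) = Sus T (tgt f)"
  using suspension.F_hom[of f "src f" "tgt f"] assms by (auto simp: hom_iff)

lemma sus_id [simp]: "a \<in> Obj T \<Longrightarrow> SusM T (Id T a) = Id T (Sus T a)"
  by (rule suspension.F_id)

lemma sus_comp [simp]:
  "arr f \<Longrightarrow> arr g \<Longrightarrow> src g = tgt f \<Longrightarrow> SusM T (g \<cdot> f) = SusM T g \<cdot> SusM T f"
  using suspension.F_comp[of f "src f" "tgt f" g "tgt g"] by (simp add: hom_iff)

lemma sus_add [simp]:
  "arr f \<Longrightarrow> arr g \<Longrightarrow> src g = src f \<Longrightarrow> tgt g = tgt f \<Longrightarrow> SusM T (f \<oplus> g) = SusM T f \<oplus> SusM T g"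
  using suspension.F_add[of f "src f" "tgt f" g] by (simp add: hom_iff)

lemma sus_zero [simp]:
  assumes "a \<in> Obj T" "b \<in> Obj T"
  shows "SusM T (Zero T a b) = Zero T (Sus T a) (Sus T b)"
proof -
  let ?z = "Zero T a b"
  have "SusM T ?z \<oplus> SusM T ?z = SusM T (?z \<oplus> ?z)"
    by (rule sus_add[symmetric]) (use assms in auto)
  also have "?z \<oplus> ?z = ?z"
    using assms by simp
  also have "SusM T ?z = SusM T ?z \<oplus> Zero T (Sus T a) (Sus T b)"
    by (rule sum_zero(1)[symmetric]) (use assms in auto)
  finally show ?thesis
    by (rule sum_cancel[rotated -1]) (use assms in auto)
qed

lemma sus_neg [simp]: "arr f \<Longrightarrow> SusM T (neg T f) = neg T (SusM T f)"
  by (rule neg_eqI[symmetric]) (auto simp flip: sus_add)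

lemma sus_faithful:
  assumes "SusM T f = SusM T g" "arr f" "arr g" "src g = src f" "tgt g = tgt f"
  shows "f = g"
proof -
  have "bij_betw (SusM T) (Hom T (src f) (tgt f)) (Hom T (Sus T (src f)) (Sus T (tgt f)))"
    using assms by (intro suspension.fully_faithful) auto
  then show ?thesis
    using assms by (auto simp: bij_betw_def hom_iff dest: inj_onD)
qed

lemma sus_full:
  assumes "arr g" "src g = Sus T a" "tgt g = Sus T b" "a \<in> Obj T" "b \<in> Obj T"
  obtains f where "arr f" "src f = a" "tgt f = b" "SusM T f = g"
proof -
  have "bij_betw (SusM T) (Hom T a b) (Hom T (Sus T a) (Sus T b))"
    using assms by (intro suspension.fully_faithful) auto
  then have "g \<in> SusM T ` Hom T a b"
    using assms by (simp add: bij_betw_def hom_iff)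
  then show ?thesis
    using that by (auto simp: hom_iff)
qed

lemma sus_zeroD:
  assumes "SusM T f = Zero T (Sus T a) (Sus T b)" "arr f" "src f = a" "tgt f = b"
  shows "f = Zero T a b"
proof (rule sus_faithful)
  show "SusM T f = SusM T (Zero T a b)"
    unfolding assms(1) using assms by (intro sus_zero[symmetric]) auto
qed (use assms in auto)

lemma sus_iso [simp]: "iso f \<Longrightarrow> iso (SusM T f)"
  by (rule isoI[of _ "SusM T (inv f)"]) (auto simp: iso_arr simp flip: sus_comp)

lemma sus_iso_reflect:
  assumes "iso (SusM T f)" "arr f"
  shows "iso f"
proof -
  obtain g where g: "arr g" "src g = tgt f" "tgt g = src f" "SusM T g = inv (SusM T f)"
    using sus_full[of "inv (SusM T f)" "tgt f" "src f"] assms by auto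
  have "g \<cdot> f = Id T (src f)"
    by (rule sus_faithful) (use assms g in simp_all)
  moreover have "f \<cdot> g = Id T (tgt f)"
    by (rule sus_faithful) (use assms g in simp_all)
  ultimately show ?thesis
    using assms g by (intro isoI[of f g]) auto
qed

lemma van_sus:
  assumes "a \<in> Obj T" "b \<in> Obj T"
  shows "van (Sus T a) (Sus T b) \<longleftrightarrow> van a b"
proof
  show "van (Sus T a) (Sus T b) \<Longrightarrow> van a b"
    by (rule vanI) (metis assms sus_arr sus_zeroD vanD)
  show "van a b \<Longrightarrow> van (Sus T a) (Sus T b)"
    by (rule vanI) (metis assms sus_full sus_zero vanD)
qed

lemma retract_sus:
  assumes "a \<in> Obj T" "b \<in> Obj T"
  shows "retract (Sus T a) (Sus T b) \<longleftrightarrow> retract a b"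
proof
  assume "retract (Sus T a) (Sus T b)"
  then obtain i p where "arr i" "src i = Sus T a" "tgt i = Sus T b" "arr p" "src p = Sus T b"
    "tgt p = Sus T a" "p \<cdot> i = Id T (Sus T a)"
    by (rule retractE)
  note ip = this
  obtain i' where i': "arr i'" "src i' = a" "tgt i' = b" "SusM T i' = i"
    using ip assms by (auto intro: sus_full[of i a b])
  obtain p' where p': "arr p'" "src p' = b" "tgt p' = a" "SusM T p' = p"
    using ip assms by (auto intro: sus_full[of p b a])
  have "p' \<cdot> i' = Id T a"
    by (rule sus_faithful) (use i' p' ip assms in simp_all)
  then show "retract a b"
    using i' p' by (intro retractI)
next
  assume "retract a b"
  then obtain i p where "arr i" "src i = a" "tgt i = b" "arr p" "src p = b" "tgt p = a" "p \<cdot> i = Id T a"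
    by (rule retractE)
  then show "retract (Sus T a) (Sus T b)"
    using assms by (intro retractI[of "SusM T i" _ _ "SusM T p"]) (auto simp flip: sus_comp)
qed

lemma isomorphic_sus:
  assumes "a \<in> Obj T" "b \<in> Obj T"
  shows "isomorphic T (Sus T a) (Sus T b) \<longleftrightarrow> isomorphic T a b"
proof
  assume "isomorphic T (Sus T a) (Sus T b)"
  then obtain f where f: "iso f" "arr f" "src f = Sus T a" "tgt f = Sus T b"
    by (rule isomorphicE)
  then obtain f' where "arr f'" "src f' = a" "tgt f' = b" "SusM T f' = f"
    using assms by (auto intro: sus_full[of f a b])
  then show "isomorphic T a b"
    using f sus_iso_reflect[of f'] by (auto intro: isomorphicI)
next
  assume "isomorphic T a b"
  then obtain f where "iso f" "arr f" "src f = a" "tgt f = b"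
    by (rule isomorphicE)
  then show "isomorphic T (Sus T a) (Sus T b)"
    by (intro isomorphicI[of "SusM T f"]) auto
qed

lemma sus_surj:
  assumes "a \<in> Obj T"
  obtains b \<theta> where "b \<in> Obj T" "iso \<theta>" "arr \<theta>" "src \<theta> = Sus T b" "tgt \<theta> = a"
  using suspension.essentially_surjective[OF assms] by (auto elim: isomorphicE)


section \<open>Distinguished triangles: rotation, signs and suspension\<close>

definition tri :: "'m \<Rightarrow> 'm \<Rightarrow> 'm \<Rightarrow> bool" where
  "tri f g h \<longleftrightarrow> (f, g, h) \<in> Tri T"

lemma triD:
  assumes "tri f g h"
  shows "arr f" "arr g" "arr h" "src g = tgt f" "src h = tgt g" "tgt h = Sus T (src f)"
  using tri_candidate[of f g h] assms by (auto simp: tri_def candidate_triangle_def hom_iff)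

lemma tri_iff: "candidate_triangle T a b c f g h \<and> (f, g, h) \<in> Tri T \<longleftrightarrow>
    tri f g h \<and> src f = a \<and> tgt f = b \<and> tgt g = c"
  using triD[of f g h] by (auto simp: candidate_triangle_def tri_def hom_iff)

lemma tri_rot:
  assumes "arr f" "arr g" "arr h" "src g = tgt f" "src h = tgt g" "tgt h = Sus T (src f)"
  shows "tri f g h \<longleftrightarrow> tri g h (neg T (SusM T f))"
  unfolding tri_def
  by (rule tri_rotate[of "src f" "tgt f" "tgt g"]) (use assms in \<open>auto simp: candidate_triangle_def hom_iff\<close>)

lemma tri_rotD:
  assumes "tri f g h"
  shows "tri g h (neg T (SusM T f))"
  using tri_rot[OF triD[OF assms]] assms by simp

lemma tri_transport:
  assumes "tri f g h" "iso \<alpha>" "iso \<beta>" "iso \<gamma>" "src \<alpha> = src f" "src \<beta> = tgt f" "src \<gamma> = tgt g"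
    "arr f'" "arr g'" "arr h'" "src f' = tgt \<alpha>" "tgt f' = tgt \<beta>" "src g' = tgt \<beta>" "tgt g' = tgt \<gamma>"
    "src h' = tgt \<gamma>" "tgt h' = Sus T (tgt \<alpha>)"
    "\<beta> \<cdot> f = f' \<cdot> \<alpha>" "\<gamma> \<cdot> g = g' \<cdot> \<beta>" "SusM T \<alpha> \<cdot> h = h' \<cdot> \<gamma>"
  shows "tri f' g' h'"
  unfolding tri_def
proof (rule tri_iso)
  show "(f, g, h) \<in> Tri T"
    using assms(1) by (simp add: tri_def)
  have c: "candidate_triangle T (src f) (tgt f) (tgt g) f g h"
    using triD[OF assms(1)] by (simp add: candidate_triangle_def hom_iff)
  have c': "candidate_triangle T (tgt \<alpha>) (tgt \<beta>) (tgt \<gamma>) f' g' h'"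
    using assms(8-16) by (simp add: candidate_triangle_def hom_iff)
  have "isomorphism T (src f) (tgt \<alpha>) \<alpha>" "isomorphism T (tgt f) (tgt \<beta>) \<beta>"
    "isomorphism T (tgt g) (tgt \<gamma>) \<gamma>"
    using assms(2-7) by (auto simp: isomorphism_iff)
  with c c' show "triangle_iso T (f, g, h) (f', g', h')"
    unfolding triangle_iso_def prod.case using assms(17-19) by blast
qed

lemma tri_transport':
  assumes "tri f g h" "iso \<alpha>" "iso \<beta>" "iso \<gamma>" "src \<alpha> = src f" "src \<beta> = tgt f" "src \<gamma> = tgt g"
  shows "tri (\<beta> \<cdot> (f \<cdot> inv \<alpha>)) (\<gamma> \<cdot> (g \<cdot> inv \<beta>)) (SusM T \<alpha> \<cdot> (h \<cdot> inv \<gamma>))"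
  by (rule tri_transport[OF assms]) (use assms triD[OF assms(1)] in \<open>simp_all add: iso_arr\<close>)

text \<open>Transport along -1 on a single vertex changes the sign of the two morphisms adjacent to
  it.\<close>

lemma tri_signs:
  assumes "tri f g h"
  shows "tri (neg T f) (neg T g) h" "tri (neg T f) g (neg T h)" "tri f (neg T g) (neg T h)"
proof -
  note [simp] = triD[OF assms]
  have i: "iso (Id T (src f))" "iso (Id T (tgt f))" "iso (Id T (tgt g))"
    by simp_all
  show "tri (neg T f) (neg T g) h"
    by (rule tri_transport[OF assms i(1) iso_neg[OF i(2)] i(3)]) auto
  show "tri (neg T f) g (neg T h)"
    by (rule tri_transport[OF assms iso_neg[OF i(1)] i(2) i(3)]) auto
  show "tri f (neg T g) (neg T h)"
    by (rule tri_transport[OF assms i(1) i(2) iso_neg[OF i(3)]]) auto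
qed

text \<open>Three rotations suspend the triangle and negate all three morphisms; two of the signs
  cancel by \<open>tri_signs\<close>, one remains.\<close>

lemma tri_sus:
  assumes "arr f" "arr g" "arr h" "src g = tgt f" "src h = tgt g" "tgt h = Sus T (src f)"
  shows "tri f g h \<longleftrightarrow> tri (SusM T f) (SusM T g) (neg T (SusM T h))"
proof -
  have "tri f g h \<longleftrightarrow> tri (neg T (SusM T f)) (neg T (SusM T g)) (neg T (SusM T h))"
    using assms tri_rot[of f g h] tri_rot[of g h "neg T (SusM T f)"]
      tri_rot[of h "neg T (SusM T f)" "neg T (SusM T g)"] by simp
  also have "\<dots> \<longleftrightarrow> tri (SusM T f) (SusM T g) (neg T (SusM T h))"
    using tri_signs(1)[of "SusM T f" "SusM T g" "neg T (SusM T h)"]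
      tri_signs(1)[of "neg T (SusM T f)" "neg T (SusM T g)" "neg T (SusM T h)"] assms by auto
  finally show ?thesis .
qed

lemma tri_id0: "a \<in> Obj T \<Longrightarrow> z \<in> zero_objects T \<Longrightarrow> tri (Id T a) (Zero T a z) (Zero T z (Sus T a))"
  using tri_id by (simp add: tri_def)

lemma zero_obj [simp]: "z \<in> zero_objects T \<Longrightarrow> z \<in> Obj T"
  by (simp add: zero_objects_iff)

lemma zero_sus [simp]: "z \<in> zero_objects T \<Longrightarrow> Sus T z \<in> zero_objects T"
  by (metis zero_objects_iff sus_obj sus_id sus_zero)

lemma zero_ex: obtains z where "z \<in> zero_objects T"
  using zero_object by blast

lemma tri_0id:
  assumes "a \<in> Obj T" "z \<in> zero_objects T"
  shows "tri (Zero T z a) (Id T a) (Zero T a (Sus T z))"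
  using tri_id0[OF assms(1) zero_sus[OF assms(2)]] assms
  by (subst tri_rot) auto

section \<open>Exactness of Hom on triangles\<close>

lemma tri_mor:
  assumes "tri f g h" "tri f' g' h'" "arr \<alpha>" "src \<alpha> = src f" "tgt \<alpha> = src f'"
    "arr \<beta>" "src \<beta> = tgt f" "tgt \<beta> = tgt f'" "\<beta> \<cdot> f = f' \<cdot> \<alpha>"
  obtains \<gamma> where "arr \<gamma>" "src \<gamma> = tgt g" "tgt \<gamma> = tgt g'" "\<gamma> \<cdot> g = g' \<cdot> \<beta>" "SusM T \<alpha> \<cdot> h = h' \<cdot> \<gamma>"
proof -
  have "\<exists>\<gamma> \<in> Hom T (tgt g) (tgt g'). \<gamma> \<cdot> g = g' \<cdot> \<beta> \<and> SusM T \<alpha> \<cdot> h = h' \<cdot> \<gamma>"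
    by (rule tri_morphism[of f g h "src f" "tgt f" _ f' g' h' "src f'" "tgt f'"])
      (use assms triD[OF assms(1)] triD[OF assms(2)] in \<open>auto simp: tri_def candidate_triangle_def hom_iff\<close>)
  then show ?thesis
    using that by (auto simp: hom_iff)
qed

lemma tri_cone_ex:
  assumes "arr f"
  obtains g h where "tri f g h"
  using tri_cone[of f "src f" "tgt f"] assms by (auto simp: hom_iff tri_def)

text \<open>The pair (1, f) starts a morphism from the trivial triangle on \<open>src f\<close>, so
  g f factors through a zero object.\<close>

lemma tri_comp:
  assumes "tri f g h"
  shows "g \<cdot> f = Zero T (src f) (tgt g)" "h \<cdot> g = Zero T (tgt f) (Sus T (src f))"
proof -
  have *: "g \<cdot> f = Zero T (src f) (tgt g)" if t: "tri f g h" for f g h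
  proof -
    note [simp] = triD[OF t]
    obtain z where z: "z \<in> zero_objects T" by (rule zero_ex)
    obtain \<gamma> where \<gamma>: "arr \<gamma>" "src \<gamma> = z" "tgt \<gamma> = tgt g" "\<gamma> \<cdot> Zero T (src f) z = g \<cdot> f"
      using tri_mor[OF tri_id0[OF _ z, of "src f"] t, of "Id T (src f)" f] z by auto
    have "\<gamma> \<cdot> Zero T (src f) z = Zero T (src f) (tgt g)"
      using \<gamma>(1-3) by simp
    then show ?thesis
      using \<gamma>(4) by simp
  qed
  show "g \<cdot> f = Zero T (src f) (tgt g)"
    using * assms .
  show "h \<cdot> g = Zero T (tgt f) (Sus T (src f))"
    using *[OF tri_rotD[OF assms]] triD[OF assms] by simp
qed

text \<open>Exactness of Hom(t, -). Rotating the trivial triangle on \<open>t\<close> gives t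
  \<rightarrow> 0 \<rightarrow> \<Sigma> t, and \<phi> together with the zero map starts a morphism
  from it to the rotated triangle; the third component, desuspended, is the lift. In
  \<open>lift1\<close> to \<open>lift3\<close> the number names the morphism lifted along. The
  statements \<open>extend1\<close> to \<open>extend3\<close> are those for Hom(-, t), numbered by
  the morphism that \<phi> annihilates.\<close>

lemma lift1:
  assumes t: "tri f g h" and \<phi>: "arr \<phi>" "src \<phi> = t" "tgt \<phi> = tgt f" "g \<cdot> \<phi> = Zero T t (tgt g)"
  obtains \<psi> where "arr \<psi>" "src \<psi> = t" "tgt \<psi> = src f" "f \<cdot> \<psi> = \<phi>"
proof -
  note [simp] = triD[OF t]
  obtain z where z: "z \<in> zero_objects T" by (rule zero_ex)
  have t': "t \<in> Obj T"
    using \<phi> by auto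
  note 1 = tri_rotD[OF tri_id0[OF t' z]]
  note 2 = tri_rotD[OF t]
  obtain \<gamma> where \<gamma>: "arr \<gamma>" "src \<gamma> = Sus T t" "tgt \<gamma> = Sus T (src f)"
    "SusM T \<phi> \<cdot> neg T (SusM T (Id T t)) = neg T (SusM T f) \<cdot> \<gamma>"
    using tri_mor[OF 1 2 \<phi>(1), of "Zero T z (tgt g)"] \<phi> t' z by auto
  obtain \<psi> where \<psi>: "arr \<psi>" "src \<psi> = t" "tgt \<psi> = src f" "SusM T \<psi> = \<gamma>"
    using sus_full[of \<gamma> t "src f"] \<gamma> t' by auto
  have "SusM T (neg T \<phi>) = SusM T \<phi> \<cdot> neg T (SusM T (Id T t))"
    using \<phi>(1-3) t' by simp
  also have "\<dots> = neg T (SusM T f) \<cdot> SusM T \<psi>"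
    unfolding \<gamma>(4) \<psi>(4) ..
  also have "\<dots> = SusM T (neg T (f \<cdot> \<psi>))"
    using \<psi>(1-3) by simp
  finally have "SusM T (neg T \<phi>) = SusM T (neg T (f \<cdot> \<psi>))" .
  then have "neg T \<phi> = neg T (f \<cdot> \<psi>)"
    by (rule sus_faithful) (use \<phi>(1-3) \<psi>(1-3) in auto)
  then have "neg T (neg T \<phi>) = neg T (neg T (f \<cdot> \<psi>))"
    by (simp only:)
  then have "f \<cdot> \<psi> = \<phi>"
    using \<phi>(1-3) \<psi> by simp
  with \<psi> that show ?thesis by blast
qed

lemma lift2:
  assumes t: "tri f g h" and \<phi>: "arr \<phi>" "src \<phi> = t" "tgt \<phi> = tgt g" "h \<cdot> \<phi> = Zero T t (Sus T (src f))"
  obtains \<psi> where "arr \<psi>" "src \<psi> = t" "tgt \<psi> = tgt f" "g \<cdot> \<psi> = \<phi>"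
  using lift1[OF tri_rotD[OF t], of \<phi> t] \<phi> triD[OF t] that by auto

lemma lift3:
  assumes t: "tri f g h" and \<phi>: "arr \<phi>" "src \<phi> = t" "tgt \<phi> = Sus T (src f)"
    "SusM T f \<cdot> \<phi> = Zero T t (Sus T (tgt f))"
  obtains \<psi> where "arr \<psi>" "src \<psi> = t" "tgt \<psi> = tgt g" "h \<cdot> \<psi> = \<phi>"
proof (rule lift2[OF tri_rotD[OF t], of \<phi> t])
  show "neg T (SusM T f) \<cdot> \<phi> = Zero T t (Sus T (src g))"
    using \<phi> triD[OF t] by (metis neg_comp neg_zero src_obj sus_arr tgt_obj)
qed (use \<phi> triD[OF t] that in auto)

lemma extend1:
  assumes t: "tri f g h" and \<phi>: "arr \<phi>" "src \<phi> = tgt f" "tgt \<phi> = t" "\<phi> \<cdot> f = Zero T (src f) t"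
  obtains \<psi> where "arr \<psi>" "src \<psi> = tgt g" "tgt \<psi> = t" "\<psi> \<cdot> g = \<phi>"
proof -
  note [simp] = triD[OF t]
  obtain z where z: "z \<in> zero_objects T" by (rule zero_ex)
  have t': "t \<in> Obj T"
    using \<phi> by auto
  obtain \<psi> where "arr \<psi>" "src \<psi> = tgt g" "tgt \<psi> = t" "\<psi> \<cdot> g = Id T t \<cdot> \<phi>"
    using tri_mor[OF t tri_0id[OF t' z], of "Zero T (src f) z" \<phi>] \<phi> t' z by auto
  with that show ?thesis
    using \<phi>(1-3) by auto
qed

lemma extend2:
  assumes t: "tri f g h" and \<phi>: "arr \<phi>" "src \<phi> = tgt g" "tgt \<phi> = t" "\<phi> \<cdot> g = Zero T (tgt f) t"
  obtains \<psi> where "arr \<psi>" "src \<psi> = Sus T (src f)" "tgt \<psi> = t" "\<psi> \<cdot> h = \<phi>"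
  using extend1[OF tri_rotD[OF t], of \<phi> t] \<phi> triD[OF t] that by auto

lemma extend3:
  assumes t: "tri f g h" and \<phi>: "arr \<phi>" "src \<phi> = Sus T (src f)" "tgt \<phi> = t" "\<phi> \<cdot> h = Zero T (tgt g) t"
  obtains \<psi> where "arr \<psi>" "src \<psi> = Sus T (tgt f)" "tgt \<psi> = t" "\<psi> \<cdot> SusM T f = \<phi>"
proof -
  note [simp] = triD[OF t]
  obtain \<psi> where "arr \<psi>" "src \<psi> = Sus T (tgt f)" "tgt \<psi> = t" "\<psi> \<cdot> neg T (SusM T f) = \<phi>"
    using extend2[OF tri_rotD[OF t], of \<phi> t] \<phi> by auto
  then show ?thesis
    using that[of "neg T \<psi>"] by simp
qed

text \<open>The obstruction group \<open>Hom(\<Sigma>\<^sup>-\<^sup>1 c, t)\<close> is written as \<open>Hom(c, \<Sigma> t)\<close>, which avoids choosing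
  desuspensions.\<close>

lemma extend_van:
  assumes t: "tri f g h" and v: "van (tgt g) (Sus T t)" and \<phi>: "arr \<phi>" "src \<phi> = src f" "tgt \<phi> = t"
  obtains \<psi> where "arr \<psi>" "src \<psi> = tgt f" "tgt \<psi> = t" "\<psi> \<cdot> f = \<phi>"
proof -
  note [simp] = triD[OF t]
  have t': "t \<in> Obj T"
    using \<phi> by auto
  have "SusM T \<phi> \<cdot> h = Zero T (tgt g) (Sus T t)"
    using v \<phi> by (intro vanD) auto
  then obtain \<psi>' where \<psi>': "arr \<psi>'" "src \<psi>' = Sus T (tgt f)" "tgt \<psi>' = Sus T t" "\<psi>' \<cdot> SusM T f = SusM T \<phi>"
    using extend3[OF t, of "SusM T \<phi>" "Sus T t"] \<phi> by auto
  then obtain \<psi> where \<psi>: "arr \<psi>" "src \<psi> = tgt f" "tgt \<psi> = t" "SusM T \<psi> = \<psi>'"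
    using sus_full[of \<psi>' "tgt f" t] t' by auto
  have "\<psi> \<cdot> f = \<phi>"
    by (rule sus_faithful) (use \<psi> \<psi>' \<phi> in auto)
  with \<psi> that show ?thesis by blast
qed

lemma lift_van:
  assumes t: "tri f g h" and v: "van t (Sus T (src f))" and \<phi>: "arr \<phi>" "src \<phi> = t" "tgt \<phi> = tgt g"
  obtains \<psi> where "arr \<psi>" "src \<psi> = t" "tgt \<psi> = tgt f" "g \<cdot> \<psi> = \<phi>"
  using lift2[OF t \<phi>] vanD[OF v, of "h \<cdot> \<phi>"] \<phi> triD[OF t] that by auto

text \<open>Exactness one place to the left of \<open>lift1\<close>: a map killed by
  \<open>f\<close> comes from Hom(t, \<Sigma>^-1 c) with c = \<open>tgt g\<close>, which is written
  Hom(\<Sigma> t, c) and vanishes.\<close>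

lemma mono_van:
  assumes t: "tri f g h" and v: "van (Sus T t) (tgt g)"
    and \<phi>: "arr \<phi>" "src \<phi> = t" "tgt \<phi> = src f" "f \<cdot> \<phi> = Zero T t (tgt f)"
  shows "\<phi> = Zero T t (src f)"
proof (rule sus_zeroD)
  note [simp] = triD[OF t]
  have t': "t \<in> Obj T"
    using \<phi> by auto
  have "SusM T f \<cdot> SusM T \<phi> = Zero T (Sus T t) (Sus T (tgt f))"
    using \<phi> t' by (simp flip: sus_comp)
  then obtain \<psi> where \<psi>: "arr \<psi>" "src \<psi> = Sus T t" "tgt \<psi> = tgt g" "h \<cdot> \<psi> = SusM T \<phi>"
    using lift3[OF t, of "SusM T \<phi>" "Sus T t"] \<phi> by auto
  have "\<psi> = Zero T (Sus T t) (tgt g)"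
    using v \<psi> by (intro vanD)
  then show "SusM T \<phi> = Zero T (Sus T t) (Sus T (src f))"
    using \<psi>(4) t' by auto
qed (use \<phi> in auto)

lemma van_ext_left:
  assumes "tri f g h" "van (src f) y" "van (tgt g) y"
  shows "van (tgt f) y"
proof (rule vanI)
  note [simp] = triD[OF assms(1)]
  fix \<phi> assume \<phi>: "arr \<phi>" "src \<phi> = tgt f" "tgt \<phi> = y"
  have y: "y \<in> Obj T"
    using \<phi> by auto
  have "\<phi> \<cdot> f = Zero T (src f) y"
    using \<phi> assms by (intro vanD) auto
  then obtain \<psi> where \<psi>: "arr \<psi>" "src \<psi> = tgt g" "tgt \<psi> = y" "\<psi> \<cdot> g = \<phi>"
    using extend1[OF assms(1) \<phi>] by blast
  have "\<psi> = Zero T (tgt g) y"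
    using assms \<psi> by (intro vanD)
  then show "\<phi> = Zero T (tgt f) y"
    using \<psi>(4) y by auto
qed

lemma van_ext_right:
  assumes "tri f g h" "van y (src f)" "van y (tgt g)"
  shows "van y (tgt f)"
proof (rule vanI)
  note [simp] = triD[OF assms(1)]
  fix \<phi> assume \<phi>: "arr \<phi>" "src \<phi> = y" "tgt \<phi> = tgt f"
  have y: "y \<in> Obj T"
    using \<phi> by auto
  have "g \<cdot> \<phi> = Zero T y (tgt g)"
    using \<phi> assms by (intro vanD) auto
  then obtain \<psi> where \<psi>: "arr \<psi>" "src \<psi> = y" "tgt \<psi> = src f" "f \<cdot> \<psi> = \<phi>"
    using lift1[OF assms(1) \<phi>] by blast
  have "\<psi> = Zero T y (src f)"
    using assms \<psi> by (intro vanD)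
  then show "\<phi> = Zero T y (tgt f)"
    using \<psi>(4) y by auto
qed


section \<open>Completing, comparing and splitting triangles\<close>

lemma tri_fibre_ex:
  assumes g: "arr g"
  obtains f h where "tri f g h"
proof -
  obtain u v where uv: "tri g u v"
    using tri_cone_ex[OF g] by blast
  note [simp] = triD[OF uv]
  obtain a \<theta> where \<theta>: "a \<in> Obj T" "iso \<theta>" "arr \<theta>" "src \<theta> = Sus T a" "tgt \<theta> = tgt u"
    by (rule sus_surj[of "tgt u"]) auto
  have i: "iso (Id T (src g))" "iso (Id T (tgt g))" "iso (inv \<theta>)"
    using g \<theta> by simp_all
  have t: "tri g (inv \<theta> \<cdot> u) (v \<cdot> \<theta>)"
    by (rule tri_transport[OF uv i]) (use \<theta> g in simp_all)
  obtain f where f: "arr f" "src f = a" "tgt f = src g" "SusM T f = v \<cdot> \<theta>"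
    using \<theta> g by (auto intro: sus_full[of "v \<cdot> \<theta>" a "src g"])
  have "tri (neg T f) g (inv \<theta> \<cdot> u)"
    by (subst tri_rot) (use f \<theta> g t in simp_all)
  with that show ?thesis by blast
qed

text \<open>The first vertex is prescribed exactly and not only up to isomorphism: \<open>f\<close>
  is a desuspension of the third morphism in a triangle that has \<open>h\<close> in the
  middle.\<close>

lemma tri_complete:
  assumes h: "arr h" "tgt h = Sus T a" "a \<in> Obj T"
  obtains f g where "tri f g h" "src f = a"
proof -
  obtain g k where t: "tri g h k"
    using tri_fibre_ex[OF h(1)] by blast
  note [simp] = triD[OF t]
  obtain f where f: "arr f" "src f = a" "tgt f = src g" "SusM T f = k"
    using h by (auto intro: sus_full[of k a "src g"])
  have "tri (neg T f) g h"
    by (subst tri_rot) (use f h t in simp_all)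
  with that[of "neg T f"] f show ?thesis by simp
qed

text \<open>An endomorphism of a triangle that is the identity on two terms differs from the identity on
  the third by a map of square zero.\<close>

lemma tri_endo_iso:
  assumes t: "tri f g h" and \<gamma>: "arr \<gamma>" "src \<gamma> = tgt g" "tgt \<gamma> = tgt g" "\<gamma> \<cdot> g = g" "h \<cdot> \<gamma> = h"
  shows "iso \<gamma>"
proof -
  note [simp] = triD[OF t]
  let ?c = "tgt g"
  let ?n = "\<gamma> \<oplus> neg T (Id T ?c)"
  have n: "arr ?n" "src ?n = ?c" "tgt ?n = ?c"
    using \<gamma>(1-3) by simp_all
  have "?n \<cdot> g = \<gamma> \<cdot> g \<oplus> neg T (Id T ?c) \<cdot> g"
    by (rule add_comp) (use \<gamma>(1-3) in simp_all)
  also have "\<dots> = Zero T (tgt f) ?c"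
    unfolding \<gamma>(4) by simp
  finally obtain \<psi> where \<psi>: "arr \<psi>" "src \<psi> = Sus T (src f)" "tgt \<psi> = ?c" "\<psi> \<cdot> h = ?n"
    using extend2[OF t n] by blast
  have "h \<cdot> ?n = h \<cdot> \<gamma> \<oplus> h \<cdot> neg T (Id T ?c)"
    by (rule comp_add) (use \<gamma>(1-3) in simp_all)
  also have "\<dots> = Zero T ?c (Sus T (src f))"
    unfolding \<gamma>(5) by simp
  finally have hn: "h \<cdot> ?n = Zero T ?c (Sus T (src f))" .
  \<comment> \<open>\<open>?n\<close> factors through \<open>h\<close> and is annihilated by
    \<open>h\<close>, hence squares to zero.\<close>
  have "?n \<cdot> ?n = \<psi> \<cdot> (h \<cdot> ?n)"
    unfolding \<psi>(4)[symmetric] using \<psi>(1-3) by (subst assoc) auto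
  also have "\<dots> = Zero T ?c ?c"
    unfolding hn using \<psi>(1-3) by simp
  finally have "iso (Id T ?c \<oplus> ?n)"
    by (intro iso_one_plus_nilpotent n)
  then show ?thesis
    using \<gamma>(1-3) by simp
qed

text \<open>Fill-ins of morphisms of triangles are not functorial, so the composite of the two
  fill-ins need not be the identity. By \<open>tri_endo_iso\<close> it is invertible, and correcting
  \<delta> by its inverse gives the retraction.\<close>

lemma retract_tri3:
  assumes t: "tri f g h" and t': "tri f' g' h'"
    and i: "arr i" "src i = src f" "tgt i = src f'" and p: "arr p" "src p = src f'" "tgt p = src f"
    and j: "arr j" "src j = tgt f" "tgt j = tgt f'" and q: "arr q" "src q = tgt f'" "tgt q = tgt f"
    and id: "p \<cdot> i = Id T (src f)" "q \<cdot> j = Id T (tgt f)"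
    and sq: "j \<cdot> f = f' \<cdot> i" "q \<cdot> f' = f \<cdot> p"
  shows "retract (tgt g) (tgt g')"
proof -
  note [simp] = triD[OF t] triD[OF t']
  obtain \<gamma> where \<gamma>: "arr \<gamma>" "src \<gamma> = tgt g" "tgt \<gamma> = tgt g'" "\<gamma> \<cdot> g = g' \<cdot> j" "SusM T i \<cdot> h = h' \<cdot> \<gamma>"
    using tri_mor[OF t t' i j sq(1)] by blast
  obtain \<delta> where \<delta>: "arr \<delta>" "src \<delta> = tgt g'" "tgt \<delta> = tgt g" "\<delta> \<cdot> g' = g \<cdot> q" "SusM T p \<cdot> h' = h \<cdot> \<delta>"
    using tri_mor[OF t' t p q sq(2)] by blast
  have "(\<delta> \<cdot> \<gamma>) \<cdot> g = \<delta> \<cdot> (g' \<cdot> j)"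
    unfolding \<gamma>(4)[symmetric] using \<gamma>(1-3) \<delta>(1-3) by simp
  also have "\<dots> = (\<delta> \<cdot> g') \<cdot> j"
    using \<delta>(1-3) j by simp
  also have "\<dots> = g \<cdot> (q \<cdot> j)"
    unfolding \<delta>(4) using j q by simp
  finally have 1: "(\<delta> \<cdot> \<gamma>) \<cdot> g = g"
    unfolding id by simp
  have "h \<cdot> (\<delta> \<cdot> \<gamma>) = (h \<cdot> \<delta>) \<cdot> \<gamma>"
    using \<gamma>(1-3) \<delta>(1-3) by simp
  also have "\<dots> = SusM T p \<cdot> (h' \<cdot> \<gamma>)"
    unfolding \<delta>(5)[symmetric] using \<gamma>(1-3) p by simp
  also have "\<dots> = SusM T (p \<cdot> i) \<cdot> h"
    unfolding \<gamma>(5)[symmetric] using i p by simp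
  finally have 2: "h \<cdot> (\<delta> \<cdot> \<gamma>) = h"
    unfolding id by simp
  have "iso (\<delta> \<cdot> \<gamma>)"
    by (rule tri_endo_iso[OF t _ _ _ 1 2]) (use \<gamma>(1-3) \<delta>(1-3) in simp_all)
  then have "(inv (\<delta> \<cdot> \<gamma>) \<cdot> \<delta>) \<cdot> \<gamma> = Id T (tgt g)"
    using \<gamma>(1-3) \<delta>(1-3) inv(4)[of "\<delta> \<cdot> \<gamma>"] by simp
  then show ?thesis
    using \<gamma>(1-3) \<delta>(1-3) inv(1-3)[OF \<open>iso (\<delta> \<cdot> \<gamma>)\<close>] 
    by (intro retractI[of \<gamma> _ _ "inv (\<delta> \<cdot> \<gamma>) \<cdot> \<delta>"]) simp_all
qed

lemma retract_tri2:
  assumes t: "tri f g h" and t': "tri f' g' h'"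
    and i: "arr i" "src i = src f" "tgt i = src f'" and p: "arr p" "src p = src f'" "tgt p = src f"
    and j: "arr j" "src j = tgt g" "tgt j = tgt g'" and q: "arr q" "src q = tgt g'" "tgt q = tgt g"
    and id: "p \<cdot> i = Id T (src f)" "q \<cdot> j = Id T (tgt g)"
    and sq: "SusM T i \<cdot> h = h' \<cdot> j" "SusM T p \<cdot> h' = h \<cdot> q"
  shows "retract (tgt f) (tgt f')"
proof -
  note [simp] = triD[OF t] triD[OF t']
  have "retract (tgt (neg T (SusM T f))) (tgt (neg T (SusM T f')))"
    by (rule retract_tri3[OF tri_rotD[OF tri_rotD[OF t]] tri_rotD[OF tri_rotD[OF t']],
          of j q "SusM T i" "SusM T p"])
      (use i p j q id sq in \<open>simp_all flip: sus_comp\<close>)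
  then show ?thesis
    using retract_sus[of "tgt f" "tgt f'"] by simp
qed

text \<open>The fill-ins \<gamma> and \<delta> in the two directions need not be inverse to each
  other, but both composites are invertible, so \<gamma> has an inverse on either side.\<close>

lemma tri_iso3:
  assumes t: "tri f g h" and t': "tri f g' h'"
  obtains \<gamma> where "iso \<gamma>" "arr \<gamma>" "src \<gamma> = tgt g" "tgt \<gamma> = tgt g'" "\<gamma> \<cdot> g = g'" "h' \<cdot> \<gamma> = h"
proof -
  note [simp] = triD[OF t] triD[OF t']
  have *: "\<exists>\<gamma>. arr \<gamma> \<and> src \<gamma> = tgt g \<and> tgt \<gamma> = tgt g' \<and> \<gamma> \<cdot> g = g' \<and> h' \<cdot> \<gamma> = h"
    if t: "tri f g h" and t': "tri f g' h'" for g h g' h'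
  proof -
    note [simp] = triD[OF t] triD[OF t']
    show ?thesis
      by (rule tri_mor[OF t t', of "Id T (src f)" "Id T (tgt f)"]) auto
  qed
  obtain \<gamma> where \<gamma>: "arr \<gamma>" "src \<gamma> = tgt g" "tgt \<gamma> = tgt g'" "\<gamma> \<cdot> g = g'" "h' \<cdot> \<gamma> = h"
    using *[OF t t'] by blast
  obtain \<delta> where \<delta>: "arr \<delta>" "src \<delta> = tgt g'" "tgt \<delta> = tgt g" "\<delta> \<cdot> g' = g" "h \<cdot> \<delta> = h'"
    using *[OF t' t] by blast
  have 1: "iso (\<delta> \<cdot> \<gamma>)"
    by (rule tri_endo_iso[OF t])
      (use \<gamma> \<delta> assoc_eq[of h \<delta> h' \<gamma>] in simp_all)
  have 2: "iso (\<gamma> \<cdot> \<delta>)"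
    by (rule tri_endo_iso[OF t'])
      (use \<gamma> \<delta> assoc_eq[of h' \<gamma> h \<delta>] in simp_all)
  have "iso \<gamma>"
    by (rule iso_two_sided[of _ "inv (\<delta> \<cdot> \<gamma>) \<cdot> \<delta>" "\<delta> \<cdot> inv (\<gamma> \<cdot> \<delta>)"])
      (use \<gamma>(1-3) \<delta>(1-3) inv[OF 1] inv[OF 2] in simp_all)
  with \<gamma> that show ?thesis by blast
qed

lemma split_retracts:
  assumes t: "tri f g h" and h: "h = Zero T (tgt g) (Sus T (src f))"
  shows "retract (src f) (tgt f)" "retract (tgt g) (tgt f)"
proof -
  note [simp] = triD[OF t]
  obtain \<psi> where \<psi>: "arr \<psi>" "src \<psi> = Sus T (tgt f)" "tgt \<psi> = Sus T (src f)" "\<psi> \<cdot> SusM T f = Id T (Sus T (src f))"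
    using extend3[OF t, of "Id T (Sus T (src f))" "Sus T (src f)"] h by auto
  have "retract (Sus T (src f)) (Sus T (tgt f))"
    using \<psi> by (intro retractI[of "SusM T f" _ _ \<psi>]) auto
  then show "retract (src f) (tgt f)"
    by (simp add: retract_sus)
  obtain \<phi> where \<phi>: "arr \<phi>" "src \<phi> = tgt g" "tgt \<phi> = tgt f" "g \<cdot> \<phi> = Id T (tgt g)"
    using lift2[OF t, of "Id T (tgt g)" "tgt g"] h by auto
  then show "retract (tgt g) (tgt f)"
    by (intro retractI[of \<phi> _ _ g]) auto
qed

text \<open>Typical use, together with \<open>retract_van1\<close>: if an object has no nonzero map
  to the right part of its truncation, it is a retract of the left part, and dually.\<close>

lemma retract_van3:
  assumes t: "tri f g h" and g: "g = Zero T (tgt f) (tgt g)"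
  shows "retract (tgt f) (src f)"
proof -
  note [simp] = triD[OF t]
  obtain \<phi> where "arr \<phi>" "src \<phi> = tgt f" "tgt \<phi> = src f" "f \<cdot> \<phi> = Id T (tgt f)"
    using lift1[OF t, of "Id T (tgt f)" "tgt f"] g by auto
  then show ?thesis
    by (intro retractI[of \<phi> _ _ f]) auto
qed

lemma retract_van1:
  assumes t: "tri f g h" and f: "f = Zero T (src f) (tgt f)"
  shows "retract (tgt f) (tgt g)"
proof -
  note [simp] = triD[OF t]
  have "Id T (tgt f) \<cdot> f = Zero T (src f) (tgt f)"
    using f by simp
  then obtain \<psi> where "arr \<psi>" "src \<psi> = tgt g" "tgt \<psi> = tgt f" "\<psi> \<cdot> g = Id T (tgt f)"
    using extend1[OF t, of "Id T (tgt f)" "tgt f"] by auto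
  then show ?thesis
    by (intro retractI[of g _ _ \<psi>]) auto
qed

lemma tri_octahedral:
  assumes "tri f f1 f2" "tri g g1 g2" "tri (g \<cdot> f) h1 h2" "src g = tgt f"
  obtains u v where "tri u v (SusM T f1 \<cdot> g2)" "arr u" "src u = tgt f1" "tgt u = tgt h1"
    "arr v" "src v = tgt h1" "tgt v = tgt g1" "u \<cdot> f1 = h1 \<cdot> g" "h2 \<cdot> u = f2" "v \<cdot> h1 = g1"
    "g2 \<cdot> v = SusM T f \<cdot> h2"
proof -
  note [simp] = triD[OF assms(1)] triD[OF assms(2)]
  have c: "candidate_triangle T (src f) (tgt g) (tgt h1) (g \<cdot> f) h1 h2"
    using triD[OF assms(3)] assms(4) by (auto simp: candidate_triangle_def hom_iff)
  have "\<exists>u v. (u, v, SusM T f1 \<cdot> g2) \<in> Tri T \<and> u \<in> Hom T (tgt f1) (tgt h1) \<and> v \<in> Hom T (tgt h1) (tgt g1) \<and>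
         u \<cdot> f1 = h1 \<cdot> g \<and> h2 \<cdot> u = f2 \<and> v \<cdot> h1 = g1 \<and> g2 \<cdot> v = SusM T f \<cdot> h2"
    by (rule octahedral[of f f1 f2 "src f" "tgt f" "tgt f1" g g1 g2 "tgt g" "tgt g1"])
      (use assms c in \<open>auto simp: tri_def candidate_triangle_def hom_iff\<close>)
  then show ?thesis
    using that by (auto simp: hom_iff tri_def)
qed


text \<open>Usually written a * b: the middle terms of triangles with outer terms \<open>a\<close>
  and \<open>b\<close>. Closed under isomorphism by \<open>ext_iso\<close>.\<close>

definition ext :: "'o \<Rightarrow> 'o \<Rightarrow> 'o set" where
  "ext a b = {x. \<exists>f g h. tri f g h \<and> src f = a \<and> tgt f = x \<and> tgt g = b}"

lemma extI: "tri f g h \<Longrightarrow> tgt f \<in> ext (src f) (tgt g)"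
  by (auto simp: ext_def)

lemma extE:
  assumes "x \<in> ext a b"
  obtains f g h where "tri f g h" "src f = a" "tgt f = x" "tgt g = b"
  using assms by (auto simp: ext_def)

lemma ext_obj:
  assumes "x \<in> ext a b"
  shows "x \<in> Obj T" "a \<in> Obj T" "b \<in> Obj T"
proof -
  obtain f g h where t: "tri f g h" "src f = a" "tgt f = x" "tgt g = b"
    using assms by (rule extE)
  show "x \<in> Obj T" "a \<in> Obj T" "b \<in> Obj T"
    using triD[OF t(1)] t(2-4) by auto
qed

lemma ext_iso:
  assumes "x \<in> ext a b" "isomorphic T a a'" "isomorphic T x x'" "isomorphic T b b'"
  shows "x' \<in> ext a' b'"
proof -
  obtain f g h where t: "tri f g h" "src f = a" "tgt f = x" "tgt g = b"
    using assms by (auto elim: extE)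
  obtain \<alpha> where \<alpha>: "iso \<alpha>" "arr \<alpha>" "src \<alpha> = a" "tgt \<alpha> = a'"
    using assms(2) by (rule isomorphicE)
  obtain \<beta> where \<beta>: "iso \<beta>" "arr \<beta>" "src \<beta> = x" "tgt \<beta> = x'"
    using assms(3) by (rule isomorphicE)
  obtain \<gamma> where \<gamma>: "iso \<gamma>" "arr \<gamma>" "src \<gamma> = b" "tgt \<gamma> = b'"
    using assms(4) by (rule isomorphicE)
  have "tri (\<beta> \<cdot> (f \<cdot> inv \<alpha>)) (\<gamma> \<cdot> (g \<cdot> inv \<beta>)) (SusM T \<alpha> \<cdot> (h \<cdot> inv \<gamma>))"
    by (rule tri_transport'[OF t(1) \<alpha>(1) \<beta>(1) \<gamma>(1)]) (use \<alpha> \<beta> \<gamma> t in simp_all)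
  then show ?thesis
    using extI[of "\<beta> \<cdot> (f \<cdot> inv \<alpha>)"] triD[OF t(1)] t(2-4) \<alpha> \<beta> \<gamma> by fastforce
qed

lemma ext_zero_left:
  assumes "x \<in> ext z b" "z \<in> zero_objects T"
  shows "isomorphic T x b"
proof -
  obtain f g h where t: "tri f g h" "src f = z" "tgt f = x" "tgt g = b"
    using assms by (auto elim: extE)
  have x: "x \<in> Obj T"
    using assms ext_obj by blast
  have "f = Zero T z x"
    using van_zero_left[OF assms(2), of x] t triD[OF t(1)] by (intro vanD) auto
  then have "tri (Zero T z x) g h"
    using t by simp
  then obtain \<gamma> where "iso \<gamma>" "src \<gamma> = tgt (Id T x)" "tgt \<gamma> = tgt g"
    using tri_iso3[OF tri_0id[OF x assms(2)]] by metis
  then show ?thesis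
    using t x by (intro isomorphicI) auto
qed

lemma ext_sus:
  assumes "x \<in> ext a b"
  shows "Sus T x \<in> ext (Sus T a) (Sus T b)"
proof -
  obtain f g h where t: "tri f g h" "src f = a" "tgt f = x" "tgt g = b"
    using assms by (auto elim: extE)
  have "tri (SusM T f) (SusM T g) (neg T (SusM T h))"
    using tri_sus[OF triD[OF t(1)]] t(1) by simp
  from extI[OF this] show ?thesis
    using triD[OF t(1)] t(2-4) by simp
qed

text \<open>One half of the associativity (a * b) * c = a * (b * c), read off from the octahedron on
  the composite of the two inclusions.\<close>

lemma ext_assoc_right:
  assumes "z \<in> ext a b" "x \<in> ext z c"
  obtains y where "y \<in> ext b c" "x \<in> ext a y"
proof -
  obtain f f1 f2 where f: "tri f f1 f2" "src f = a" "tgt f = z" "tgt f1 = b"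
    using assms by (auto elim: extE)
  obtain g g1 g2 where g: "tri g g1 g2" "src g = z" "tgt g = x" "tgt g1 = c"
    using assms by (auto elim: extE)
  note [simp] = triD[OF f(1)] triD[OF g(1)] f(2-4) g(2-4)
  obtain h1 h2 where h: "tri (g \<cdot> f) h1 h2"
    by (rule tri_cone_ex[of "g \<cdot> f"]) auto
  obtain u v where "tri u v (SusM T f1 \<cdot> g2)" "arr u" "src u = tgt f1" "tgt u = tgt h1"
    "arr v" "src v = tgt h1" "tgt v = tgt g1"
    using tri_octahedral[OF f(1) g(1) h] by (metis f(3) g(2))
  with extI[of u v "SusM T f1 \<cdot> g2"] extI[OF h] that[of "tgt h1"] show ?thesis
    by simp
qed

text \<open>The other half, from the octahedron on the composite of the two projections. It is built
  on rotated triangles, so the wanted triangle appears suspended and is desuspended at the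
  end.\<close>

lemma ext_assoc_left:
  assumes "x \<in> ext a y" "y \<in> ext b c"
  obtains z where "z \<in> ext a b" "x \<in> ext z c"
proof -
  obtain f f1 f2 where f: "tri f f1 f2" "src f = a" "tgt f = x" "tgt f1 = y"
    using assms by (auto elim: extE)
  obtain g g1 g2 where g: "tri g g1 g2" "src g = b" "tgt g = y" "tgt g1 = c"
    using assms by (auto elim: extE)
  note [simp] = triD[OF f(1)] triD[OF g(1)] f(2-4) g(2-4)
  obtain k l where k: "tri k (g1 \<cdot> f1) l"
    by (rule tri_fibre_ex[of "g1 \<cdot> f1"]) auto
  have [simp]: "tgt k = x"
    using triD(4)[OF k, symmetric] by simp
  have [simp]: "a \<in> Obj T" "b \<in> Obj T" "c \<in> Obj T"
    using ext_obj assms by blast+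
  have [simp]: "arr k" "arr l" "src l = c" "tgt l = Sus T (src k)"
    using triD[OF k] by simp_all
  obtain u v where uv: "tri u v (SusM T f2 \<cdot> neg T (SusM T g))" "arr u" "src u = tgt f2" "tgt u = tgt l"
    "arr v" "src v = tgt l" "tgt v = tgt g2"
    using tri_octahedral[OF tri_rotD[OF f(1)] tri_rotD[OF g(1)] tri_rotD[OF k]] by (metis f(4) triD(4)[OF g(1)] g(3))
  let ?z = "src k"
  obtain u' where u': "arr u'" "src u' = a" "tgt u' = ?z" "SusM T u' = u"
    using uv by (auto intro: sus_full[of u a ?z])
  obtain v' where v': "arr v'" "src v' = ?z" "tgt v' = b" "SusM T v' = v"
    using uv by (auto intro: sus_full[of v ?z b])
  have "tri u' v' (f2 \<cdot> g)"
    by (subst tri_sus) (use u' v' uv(1) in simp_all)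
  from extI[OF this] extI[OF k] that[of ?z] show ?thesis
    using u' v' by simp
qed


lemma van_iso:
  assumes "isomorphic T a a'" "isomorphic T b b'"
  shows "van a b \<longleftrightarrow> van a' b'"
  using assms isomorphic_retract van_retract_left van_retract_right by metis

lemma zero_sus_reflect: "Sus T x \<in> zero_objects T \<Longrightarrow> x \<in> Obj T \<Longrightarrow> x \<in> zero_objects T"
  using van_self[of x] van_zero_left[of "Sus T x" "Sus T x"] van_sus[of x x] by blast

lemma ext_zero_right: "a \<in> Obj T \<Longrightarrow> z \<in> zero_objects T \<Longrightarrow> a \<in> ext a z"
  using extI[OF tri_id0[of a z]] by simp

lemma ext_zero_left_id: "a \<in> Obj T \<Longrightarrow> z \<in> zero_objects T \<Longrightarrow> a \<in> ext z a"
  using extI[OF tri_0id[of a z]] by simp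

lemma ext_zero_right_iso:
  assumes "x \<in> ext a z" "z \<in> zero_objects T"
  shows "isomorphic T x a"
proof -
  obtain f g h where t: "tri f g h" "src f = a" "tgt f = x" "tgt g = z"
    using assms(1) by (rule extE)
  note [simp] = triD[OF t(1)]
  have z: "tgt g \<in> zero_objects T"
    using t(4) assms(2) by simp
  have g: "g = Zero T (tgt f) (tgt g)"
    using van_zero_right[OF z] by (intro vanD) auto
  obtain \<gamma> where \<gamma>: "arr \<gamma>" "src \<gamma> = tgt f" "tgt \<gamma> = src f" "f \<cdot> \<gamma> = Id T (tgt f)"
    using lift1[OF t(1), of "Id T (tgt f)" "tgt f"] g by auto
  obtain \<psi> where \<psi>: "arr \<psi>" "src \<psi> = tgt f" "tgt \<psi> = src f" "\<psi> \<cdot> f = Id T (src f)"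
    using extend_van[OF t(1) van_zero_left[OF z], of "Id T (src f)"] by auto
  have "iso f"
    by (rule iso_two_sided[of _ \<psi> \<gamma>]) (use \<gamma> \<psi> in simp_all)
  then show ?thesis
    using isomorphic_sym[OF isomorphicI[OF _ t(2,3)]] by simp
qed

text \<open>The third morphism of the larger triangle is the composite y' \<rightarrow> y
  \<rightarrow> \<Sigma> x \<rightarrow> \<Sigma> x', which makes inclusions and projections of the
  outer terms compatible with both connecting maps.\<close>

lemma retract_ext:
  assumes "u \<in> ext x y" "retract x x'" "retract y y'"
  obtains u' where "u' \<in> ext x' y'" "retract u u'"
proof -
  obtain f g h where t: "tri f g h" "src f = x" "tgt f = u" "tgt g = y"
    using assms(1) by (rule extE)
  obtain i p where i: "arr i" "src i = x" "tgt i = x'" and p: "arr p" "src p = x'" "tgt p = x"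
    and pi: "p \<cdot> i = Id T x"
    using assms(2) by (rule retractE)
  obtain j q where j: "arr j" "src j = y" "tgt j = y'" and q: "arr q" "src q = y'" "tgt q = y"
    and qj: "q \<cdot> j = Id T y"
    using assms(3) by (rule retractE)
  note [simp] = triD[OF t(1)] t(2-4)
  let ?h = "SusM T i \<cdot> (h \<cdot> q)"
  have x': "x' \<in> Obj T" "x \<in> Obj T"
    using i p by auto
  have h: "arr ?h" "src ?h = y'" "tgt ?h = Sus T x'"
    using i q by simp_all
  obtain f' g' where t': "tri f' g' ?h" "src f' = x'"
    using tri_complete[OF h(1,3) x'(1)] by blast
  have [simp]: "tgt g' = y'"
    using triD(5)[OF t'(1)] h by simp
  have "retract (tgt f) (tgt f')"
  proof (rule retract_tri2[OF t(1) t'(1), of i p j q])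
    show "SusM T i \<cdot> h = ?h \<cdot> j"
      using i j q qj by simp
    have "SusM T p \<cdot> SusM T i = Id T (Sus T x)"
      using pi i p x' by (simp flip: sus_comp)
    then show "SusM T p \<cdot> ?h = h \<cdot> q"
      using assoc_eq[of "SusM T p" "SusM T i" "Id T (Sus T x)" "h \<cdot> q"] i p q by simp
  qed (use i p j q pi qj t' in simp_all)
  moreover have "tgt f' \<in> ext x' y'"
    using extI[OF t'(1)] t'(2) by simp
  ultimately show ?thesis
    using that by simp
qed

lemma ext_desus:
  assumes "Sus T x \<in> ext (Sus T a) c" "x \<in> Obj T" "a \<in> Obj T"
  obtains b where "x \<in> ext a b" "isomorphic T (Sus T b) c" "b \<in> Obj T"
proof -
  obtain f g h where t: "tri f g h" "src f = Sus T a" "tgt f = Sus T x" "tgt g = c"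
    using assms(1) by (rule extE)
  obtain f' where f': "arr f'" "src f' = a" "tgt f' = x" "SusM T f' = f"
    using t triD[OF t(1)] assms by (auto intro: sus_full[of f a x])
  obtain g' h' where t': "tri f' g' h'"
    using tri_cone_ex[OF f'(1)] by blast
  note [simp] = triD[OF t']
  have "tri f (SusM T g') (neg T (SusM T h'))"
    using t' tri_sus[OF triD[OF t']] f' by simp
  then obtain \<gamma> where "iso \<gamma>" "src \<gamma> = tgt (SusM T g')" "tgt \<gamma> = tgt g"
    using tri_iso3[OF _ t(1)] by metis
  then have "isomorphic T (Sus T (tgt g')) c"
    using t by (intro isomorphicI) auto
  then show ?thesis
    using that[of "tgt g'"] extI[OF t'] f' by simp
qed

end

section \<open>Extensions of shifts of a spherical object\<close>

text \<open>What the classification uses about the \<sigma> i, without scalars. Suspension relates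
  them only up to isomorphism, being just an autoequivalence. \<open>\<sigma>_local\<close> and
  \<open>\<sigma>_division\<close> describe the endomorphism rings.
  \<open>\<sigma>_principal\<close> takes the place of finite dimension: in any nonempty set of maps
  between two of the \<sigma> i, one generates the others on either side, which makes the modules
  Hom(x, \<sigma> q) and Hom(\<sigma> q, x) finitely generated.\<close>

locale spherical_sequence = triangulated_category T
  for T :: "('o, 'm, 'x) tri_cat_scheme" (structure) +
  fixes \<sigma> :: "int \<Rightarrow> 'o" and w :: int
  assumes \<sigma>_obj [simp]: "\<sigma> i \<in> Obj T"
    and \<sigma>_sus: "isomorphic T (Sus T (\<sigma> i)) (\<sigma> (i + 1))"
    and \<sigma>_van: "j \<noteq> i \<Longrightarrow> j \<noteq> i + w \<Longrightarrow> van (\<sigma> i) (\<sigma> j)"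
    and \<sigma>_nonzero: "\<sigma> i \<notin> zero_objects T"
    and \<sigma>_local: "e \<in> Hom T (\<sigma> i) (\<sigma> i) \<Longrightarrow> e' \<in> Hom T (\<sigma> i) (\<sigma> i) \<Longrightarrow> \<not> iso e \<Longrightarrow> \<not> iso e' \<Longrightarrow>
          e \<cdot> e' = Zero T (\<sigma> i) (\<sigma> i)"
    and \<sigma>_division: "w \<noteq> 0 \<Longrightarrow> e \<in> Hom T (\<sigma> i) (\<sigma> i) \<Longrightarrow> \<not> iso e \<Longrightarrow> e = Zero T (\<sigma> i) (\<sigma> i)"
    and \<sigma>_top: "\<exists>X \<in> Hom T (\<sigma> i) (\<sigma> (i + w)). X \<noteq> Zero T (\<sigma> i) (\<sigma> (i + w)) \<and> (w = 0 \<longrightarrow> \<not> iso X)"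
    and \<sigma>_principal: "W \<subseteq> Hom T (\<sigma> j) (\<sigma> i) \<Longrightarrow> W \<noteq> {} \<Longrightarrow> \<exists>u \<in> W. \<forall>f \<in> W.
          (\<exists>e \<in> Hom T (\<sigma> i) (\<sigma> i). f = e \<cdot> u) \<and> (\<exists>e \<in> Hom T (\<sigma> j) (\<sigma> j). f = u \<cdot> e)"
    and \<sigma>_generates: "Obj T \<subseteq> built_from T (\<sigma> 0)"
    and idempotents_split: "idempotent_complete T"
begin

text \<open>Iterated extensions with factors \<sigma> j; each new factor enters at the left end, as
  the source of an inclusion.\<close>

inductive_set filt :: "int set \<Rightarrow> 'o set" for J :: "int set" where
  zero: "z \<in> zero_objects T \<Longrightarrow> z \<in> filt J"
| step: "j \<in> J \<Longrightarrow> y \<in> filt J \<Longrightarrow> x \<in> ext (\<sigma> j) y \<Longrightarrow> x \<in> filt J"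

text \<open>Closed under extensions and retracts but in general not under suspension:
  \<open>J\<close> controls the degrees of the factors.\<close>

definition thick :: "int set \<Rightarrow> 'o set" where
  "thick J = {x. \<exists>y \<in> filt J. retract x y}"

lemma filt_obj: "x \<in> filt J \<Longrightarrow> x \<in> Obj T"
  by (induction rule: filt.induct) (auto dest: ext_obj)

lemma filt_mono: "x \<in> filt J \<Longrightarrow> J \<subseteq> K \<Longrightarrow> x \<in> filt K"
  by (induction rule: filt.induct) (auto intro: filt.intros)

lemma filt_iso:
  assumes "x \<in> filt J" "isomorphic T x x'"
  shows "x' \<in> filt J"
  using assms(1)
proof cases
  case zero
  then show ?thesis
    using assms(2) isomorphic_retract retract_zero filt.zero by blast
next
  case (step j y)
  then have "x' \<in> ext (\<sigma> j) y"
    using ext_iso[OF step(3) _ assms(2)] isomorphic_refl ext_obj by simp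
  with step show ?thesis
    by (auto intro: filt.step)
qed

lemma filt_gen: "j \<in> J \<Longrightarrow> \<sigma> j \<in> filt J"
  using zero_ex ext_zero_right[OF \<sigma>_obj] filt.step[OF _ filt.zero] by metis

lemma filt_ext: "x \<in> filt J \<Longrightarrow> y \<in> filt J \<Longrightarrow> u \<in> ext x y \<Longrightarrow> u \<in> filt J"
proof (induction arbitrary: u rule: filt.induct)
  case (zero z)
  then show ?case
    using ext_zero_left filt_iso isomorphic_sym by blast
next
  case (step j x' x)
  obtain v where "v \<in> ext x' y" "u \<in> ext (\<sigma> j) v"
    using step.hyps(3) step.prems(2) by (rule ext_assoc_right)
  with step show ?case
    by (blast intro: filt.step)
qed

text \<open>Extensions with new factors entering at the right end. Maps out of \<sigma> q are
  analysed along the last projection x \<rightarrow> \<sigma> j, which needs this order.\<close>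

inductive_set filt_rev :: "int set \<Rightarrow> 'o set" for J :: "int set" where
  zero: "z \<in> zero_objects T \<Longrightarrow> z \<in> filt_rev J"
| step: "j \<in> J \<Longrightarrow> y \<in> filt_rev J \<Longrightarrow> x \<in> ext y (\<sigma> j) \<Longrightarrow> x \<in> filt_rev J"

lemma filt_rev_step: "y \<in> filt_rev J \<Longrightarrow> j \<in> J \<Longrightarrow> x \<in> ext (\<sigma> j) y \<Longrightarrow> x \<in> filt_rev J"
proof (induction arbitrary: x rule: filt_rev.induct)
  case (zero z)
  have "x \<in> Obj T"
    using ext_obj zero by blast
  then have "x \<in> ext z (\<sigma> j)"
    using ext_iso[OF ext_zero_left_id[of x z]] ext_zero_right_iso[of x "\<sigma> j" z] isomorphic_refl zero
    by simp
  with zero show ?case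
    by (blast intro: filt_rev.intros)
next
  case (step i y' y)
  obtain v where "v \<in> ext (\<sigma> j) y'" "x \<in> ext v (\<sigma> i)"
    using step.prems(2) step.hyps(3) by (rule ext_assoc_left)
  with step show ?case
    by (blast intro: filt_rev.step)
qed

lemma filt_rev_induct [consumes 1, case_names zero step]:
  assumes x: "x \<in> filt J" and 0: "\<And>z. z \<in> zero_objects T \<Longrightarrow> P z"
    and 1: "\<And>j y x. j \<in> J \<Longrightarrow> P y \<Longrightarrow> x \<in> ext y (\<sigma> j) \<Longrightarrow> P x"
  shows "P x"
proof -
  have "x \<in> filt_rev J"
    using x by (induction rule: filt.induct) (auto intro: filt_rev.zero filt_rev_step)
  then show ?thesis
    by (induction rule: filt_rev.induct) (auto intro: 0 1)
qed

lemma filt_sus: "x \<in> filt J \<Longrightarrow> Sus T x \<in> filt ((\<lambda>j. j + 1) ` J)"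
proof (induction rule: filt.induct)
  case (zero z)
  then show ?case
    by (simp add: filt.zero)
next
  case (step j y x)
  have "Sus T x \<in> ext (\<sigma> (j + 1)) (Sus T y)"
    using ext_iso[OF ext_sus[OF step.hyps(3)] \<sigma>_sus] isomorphic_refl ext_obj[OF step.hyps(3)] by simp
  with step show ?case
    by (blast intro: filt.step)
qed

lemma filt_desus: "y \<in> filt J \<Longrightarrow> x \<in> Obj T \<Longrightarrow> isomorphic T (Sus T x) y \<Longrightarrow> x \<in> filt ((\<lambda>j. j - 1) ` J)"
proof (induction arbitrary: x rule: filt.induct)
  case (zero z)
  then have "Sus T x \<in> zero_objects T"
    using isomorphic_retract retract_zero by blast
  then show ?case
    using zero zero_sus_reflect filt.zero by blast
next
  case (step j y' y)
  have "Sus T x \<in> ext (Sus T (\<sigma> (j - 1))) y'"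
    using ext_iso[OF step.hyps(3) _ isomorphic_sym[OF step.prems(2)]] \<sigma>_sus[of "j - 1"] isomorphic_sym
      isomorphic_refl ext_obj[OF step.hyps(3)] by simp
  then obtain b where "x \<in> ext (\<sigma> (j - 1)) b" "isomorphic T (Sus T b) y'" "b \<in> Obj T"
    using step.prems(1) \<sigma>_obj by (rule ext_desus)
  with step show ?case
    by (blast intro: filt.step)
qed

lemma thickI: "y \<in> filt J \<Longrightarrow> retract x y \<Longrightarrow> x \<in> thick J"
  by (auto simp: thick_def)

lemma thickE:
  assumes "x \<in> thick J"
  obtains y where "y \<in> filt J" "retract x y"
  using assms by (auto simp: thick_def)

lemma filt_thick: "x \<in> filt J \<Longrightarrow> x \<in> thick J"
  by (auto intro: thickI retract_refl filt_obj)

lemma thick_obj: "x \<in> thick J \<Longrightarrow> x \<in> Obj T"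
  by (auto simp: thick_def dest: retract_obj)

lemma thick_mono: "x \<in> thick J \<Longrightarrow> J \<subseteq> K \<Longrightarrow> x \<in> thick K"
  by (auto simp: thick_def intro: filt_mono)

lemma thick_gen: "j \<in> J \<Longrightarrow> \<sigma> j \<in> thick J"
  by (intro filt_thick filt_gen)

lemma thick_zero: "z \<in> zero_objects T \<Longrightarrow> z \<in> thick J"
  by (intro filt_thick filt.zero)

lemma thick_retract: "y \<in> thick J \<Longrightarrow> retract x y \<Longrightarrow> x \<in> thick J"
  by (auto simp: thick_def intro: retract_trans)

lemma thick_ext:
  assumes "x \<in> thick J" "y \<in> thick J" "u \<in> ext x y"
  shows "u \<in> thick J"
proof -
  obtain x' y' where 1: "x' \<in> filt J" "retract x x'" "y' \<in> filt J" "retract y y'"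
    using assms by (auto simp: thick_def)
  obtain u' where "u' \<in> ext x' y'" "retract u u'"
    using assms(3) 1(2,4) by (rule retract_ext)
  with 1 show ?thesis
    by (auto intro: thickI filt_ext)
qed

lemma thick_induct [consumes 1, case_names zero step retract]:
  assumes x: "x \<in> thick J" and 0: "\<And>z. z \<in> zero_objects T \<Longrightarrow> P z"
    and 1: "\<And>j y x. j \<in> J \<Longrightarrow> y \<in> thick J \<Longrightarrow> P y \<Longrightarrow> x \<in> ext (\<sigma> j) y \<Longrightarrow> P x"
    and 2: "\<And>x y. P y \<Longrightarrow> retract x y \<Longrightarrow> P x"
  shows "P x"
proof -
  have "P y" if "y \<in> filt J" for y
    using that by (induction rule: filt.induct) (auto intro: 0 1 filt_thick)
  with x 2 show ?thesis
    by (auto simp: thick_def)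
qed

lemma thick_sus:
  assumes "x \<in> thick J"
  shows "Sus T x \<in> thick ((\<lambda>j. j + 1) ` J)"
proof -
  obtain y where "y \<in> filt J" "retract x y"
    using assms by (rule thickE)
  then show ?thesis
    using retract_sus retract_obj by (intro thickI[OF filt_sus]) auto
qed

lemma thick_desus:
  assumes "Sus T x \<in> thick J" "x \<in> Obj T"
  shows "x \<in> thick ((\<lambda>j. j - 1) ` J)"
proof -
  obtain y where y: "y \<in> filt J" "retract (Sus T x) y"
    using assms by (auto elim: thickE)
  obtain x' \<theta> where x': "x' \<in> Obj T" "iso \<theta>" "arr \<theta>" "src \<theta> = Sus T x'" "tgt \<theta> = y"
    using sus_surj[OF filt_obj[OF y(1)]] .
  have i: "isomorphic T (Sus T x') y"
    using x' by (intro isomorphicI[of \<theta>])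
  have "retract (Sus T x) (Sus T x')"
    using y(2) isomorphic_retract(2)[OF i] retract_trans by blast
  then show ?thesis
    using filt_desus[OF y(1) x'(1) i] x'(1) assms(2) retract_sus by (auto intro: thickI)
qed

lemma direct_summand_retract: "direct_summand T b a \<Longrightarrow> retract b a"
  unfolding direct_summand_def summand_via_def is_biproduct_def retract_def by blast

text \<open>An object is built in finitely many steps, and each rule widens the interval by at most
  one: a cone of a \<rightarrow> b is an extension of b and \<Sigma> a. The boundedness of all Hom
  degrees rests on this.\<close>

lemma obj_thick:
  assumes "x \<in> Obj T"
  obtains n where "x \<in> thick {-n..n}"
proof -
  have "x \<in> built_from T (\<sigma> 0)"
    using assms \<sigma>_generates by blast
  then have "\<exists>n. x \<in> thick {-n..n}"
  proof (induction rule: built_from.induct)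
    case generator
    show ?case
      using thick_gen[of 0 "{-0..0}"] by (intro exI[of _ 0]) simp
  next
    case (suspension a)
    then obtain n where "a \<in> thick {-n..n}" by blast
    then have "Sus T a \<in> thick {-(n+1)..n+1}"
      using thick_sus thick_mono[of "Sus T a" "(\<lambda>j. j + 1) ` {-n..n}"] by force
    then show ?case by blast
  next
    case (desuspension a)
    then obtain n where "Sus T a \<in> thick {-n..n}" by blast
    then have "a \<in> thick {-(n+1)..n+1}"
      using desuspension thick_desus thick_mono[of a "(\<lambda>j. j - 1) ` {-n..n}"] by force
    then show ?case by blast
  next
    case (cone f g h a b c)
    then obtain m n where mn: "a \<in> thick {-m..m}" "b \<in> thick {-n..n}" by blast
    let ?k = "max (m + 1) n"
    have t: "tri f g h" "src f = a" "tgt f = b" "tgt g = c"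
      using cone tri_iff[of a b c f g h] by blast+
    have "Sus T a \<in> thick {-?k..?k}"
      by (rule thick_mono[OF thick_sus[OF mn(1)]]) auto
    moreover have "b \<in> thick {-?k..?k}"
      by (rule thick_mono[OF mn(2)]) auto
    moreover have "c \<in> ext b (Sus T a)"
      using extI[OF tri_rotD[OF t(1)]] t triD[OF t(1)] by simp
    ultimately show ?case
      using thick_ext by blast
  next
    case (summand a b)
    then show ?case
      using thick_retract direct_summand_retract by blast
  qed
  then show ?thesis
    using that by blast
qed

section \<open>Orthogonality and truncation\<close>

lemma van_ext_obj_left: "x \<in> ext a b \<Longrightarrow> van a y \<Longrightarrow> van b y \<Longrightarrow> van x y"
  using van_ext_left unfolding ext_def by blast

lemma van_ext_obj_right: "x \<in> ext a b \<Longrightarrow> van y a \<Longrightarrow> van y b \<Longrightarrow> van y x"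
  using van_ext_right unfolding ext_def by blast

lemma van_thick_left:
  assumes "x \<in> thick J" "\<And>j. j \<in> J \<Longrightarrow> van (\<sigma> j) y"
  shows "van x y"
  using assms(1)
  by (induction rule: thick_induct)
    (auto intro: van_zero_left van_retract_left van_ext_obj_left assms(2))

lemma van_thick_right:
  assumes "x \<in> thick J" "\<And>j. j \<in> J \<Longrightarrow> van y (\<sigma> j)"
  shows "van y x"
  using assms(1)
  by (induction rule: thick_induct)
    (auto intro: van_zero_right van_retract_right van_ext_obj_right assms(2))

lemma van_thick:
  assumes "x \<in> thick I" "y \<in> thick J" "\<And>i j. i \<in> I \<Longrightarrow> j \<in> J \<Longrightarrow> j \<noteq> i \<and> j \<noteq> i + w"
  shows "van x y"
  using van_thick_left[OF assms(1)] van_thick_right[OF assms(2)] \<sigma>_van assms(3) by metis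

text \<open>Orthogonality is tested on generators; by \<open>van_thick_right\<close> it then holds
  against all of \<open>thick J\<close>.\<close>

definition left_perp :: "int set \<Rightarrow> 'o set" where
  "left_perp J = {x \<in> Obj T. \<forall>j \<in> J. van x (\<sigma> j)}"

definition right_perp :: "int set \<Rightarrow> 'o set" where
  "right_perp J = {x \<in> Obj T. \<forall>j \<in> J. van (\<sigma> j) x}"

lemma van_sus_left: "x \<in> Obj T \<Longrightarrow> van (Sus T x) (\<sigma> i) \<longleftrightarrow> van x (\<sigma> (i - 1))"
  using van_iso[OF isomorphic_refl \<sigma>_sus[of "i - 1"], of "Sus T x"] van_sus[of x "\<sigma> (i - 1)"] by simp

lemma van_sus_right: "x \<in> Obj T \<Longrightarrow> van (\<sigma> i) (Sus T x) \<longleftrightarrow> van (\<sigma> (i - 1)) x"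
  using van_iso[OF \<sigma>_sus[of "i - 1"] isomorphic_refl, of "Sus T x"] van_sus[of "\<sigma> (i - 1)" x] by simp

lemma van_sus_\<sigma>: "x \<in> Obj T \<Longrightarrow> van (Sus T (\<sigma> i)) x \<longleftrightarrow> van (\<sigma> (i + 1)) x"
  using van_iso[OF \<sigma>_sus isomorphic_refl, of x i] by simp

lemma van_\<sigma>_sus: "x \<in> Obj T \<Longrightarrow> van x (Sus T (\<sigma> i)) \<longleftrightarrow> van x (\<sigma> (i + 1))"
  using van_iso[OF isomorphic_refl \<sigma>_sus, of x i] by simp

lemma not_van_self: "\<not> van (\<sigma> i) (\<sigma> i)"
  using van_self[of "\<sigma> i"] \<sigma>_nonzero by auto

lemma zero_if_left_perp:
  assumes "x \<in> Obj T" "\<And>i. van x (\<sigma> i)"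
  shows "x \<in> zero_objects T"
proof -
  obtain n where "x \<in> thick {-n..n}"
    using obj_thick[OF assms(1)] .
  then show ?thesis
    using van_thick_right assms van_self by blast
qed

lemma zero_if_right_perp:
  assumes "x \<in> Obj T" "\<And>i. van (\<sigma> i) x"
  shows "x \<in> zero_objects T"
proof -
  obtain n where "x \<in> thick {-n..n}"
    using obj_thick[OF assms(1)] .
  then show ?thesis
    using van_thick_left assms van_self by blast
qed

text \<open>Makes \<open>thick A\<close> and \<open>thick (- A)\<close> the halves of a torsion
  pair. The canonical structures are the cases where \<open>A\<close> is a half-line.\<close>

definition truncates :: "int set \<Rightarrow> bool" where
  "truncates A \<longleftrightarrow> (\<forall>x \<in> Obj T. \<exists>m \<in> thick A. \<exists>n \<in> thick (- A). x \<in> ext m n) \<and>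
     (\<forall>i \<in> A. \<forall>j \<in> - A. van (\<sigma> i) (\<sigma> j))"

text \<open>An object orthogonal to the generators of one half has zero truncation map to or from
  that half, so it is a retract of its other part. Membership in \<open>thick A\<close> becomes a
  condition on maps to or from the \<sigma> j, the form in which the bounds on M and N are
  obtained.\<close>

lemma thick_perp:
  assumes "truncates A"
  shows "thick A = left_perp (- A)" "thick (- A) = right_perp A"
proof -
  have v: "van (\<sigma> i) (\<sigma> j)" if "i \<in> A" "j \<in> - A" for i j
    using assms that by (auto simp: truncates_def)
  have t: "\<exists>m n f g h. m \<in> thick A \<and> n \<in> thick (- A) \<and> tri f g h \<and> src f = m \<and> tgt f = x \<and> tgt g = n"
    if "x \<in> Obj T" for x
    using assms that unfolding truncates_def ext_def by blast
  show "thick A = left_perp (- A)"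
  proof
    show "thick A \<subseteq> left_perp (- A)"
      using van_thick_left v thick_obj by (fastforce simp: left_perp_def)
    show "left_perp (- A) \<subseteq> thick A"
    proof
      fix x assume x: "x \<in> left_perp (- A)"
      then obtain m n f g h where *: "m \<in> thick A" "n \<in> thick (- A)" "tri f g h" "src f = m" "tgt f = x" "tgt g = n"
        using t[of x] by (auto simp: left_perp_def)
      have "van x n"
        using x van_thick_right[OF *(2)] by (auto simp: left_perp_def)
      then have "g = Zero T (tgt f) (tgt g)"
        using * triD[OF *(3)] by (intro vanD) auto
      then show "x \<in> thick A"
        using retract_van3[OF *(3)] * thick_retract by blast
    qed
  qed
  show "thick (- A) = right_perp A"
  proof
    show "thick (- A) \<subseteq> right_perp A"
      using van_thick_right v thick_obj by (fastforce simp: right_perp_def)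
    show "right_perp A \<subseteq> thick (- A)"
    proof
      fix x assume x: "x \<in> right_perp A"
      then obtain m n f g h where *: "m \<in> thick A" "n \<in> thick (- A)" "tri f g h" "src f = m" "tgt f = x" "tgt g = n"
        using t[of x] by (auto simp: right_perp_def)
      have "van m x"
        using x van_thick_left[OF *(1)] by (auto simp: right_perp_def)
      then have "f = Zero T (src f) (tgt f)"
        using * triD[OF *(3)] by (intro vanD) auto
      then show "x \<in> thick (- A)"
        using retract_van1[OF *(3)] * thick_retract by blast
    qed
  qed
qed

end

context triangulated_category
begin

text \<open>Both other morphisms vanish, yet the identity of the cone factors through the last
  one.\<close>

lemma tri_iso_zero:
  assumes t: "tri k a b" and k: "iso k"
  shows "tgt a \<in> zero_objects T"
proof -
  note [simp] = triD[OF t]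
  have a: "a = Zero T (tgt k) (tgt a)"
    using iso_right_cancel[OF k tri_comp(1)[OF t]] by simp
  have "neg T (SusM T k) \<cdot> b = Zero T (tgt a) (Sus T (tgt k))"
    using tri_comp(1)[OF tri_rotD[OF tri_rotD[OF t]]] tri_comp(2)[OF tri_rotD[OF t]] by simp
  then have b: "b = Zero T (tgt a) (Sus T (src k))"
    using iso_left_cancel[OF iso_neg[OF sus_iso[OF k]], of b] by simp
  have "Id T (tgt a) \<cdot> a = Zero T (tgt k) (tgt a)"
    using a by simp
  then obtain \<psi> where "arr \<psi>" "src \<psi> = Sus T (src k)" "tgt \<psi> = tgt a" "\<psi> \<cdot> b = Id T (tgt a)"
    using extend2[OF t, of "Id T (tgt a)" "tgt a"] by auto
  then show ?thesis
    using b by (simp add: zero_objects_iff)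
qed

end

context spherical_sequence
begin

section \<open>Truncation and extremal degrees for \<open>w \<ge> 1\<close>\<close>

lemma \<sigma>_sus_division:
  assumes "w \<noteq> 0" "arr k" "src k = \<sigma> (i + 1)" "tgt k = Sus T (\<sigma> i)" "k \<noteq> Zero T (\<sigma> (i + 1)) (Sus T (\<sigma> i))"
  shows "iso k"
proof -
  obtain \<theta> where \<theta>: "iso \<theta>" "arr \<theta>" "src \<theta> = Sus T (\<sigma> i)" "tgt \<theta> = \<sigma> (i + 1)"
    using \<sigma>_sus by (rule isomorphicE)
  have "iso (\<theta> \<cdot> k)"
  proof (rule ccontr)
    assume "\<not> iso (\<theta> \<cdot> k)"
    then have "\<theta> \<cdot> k = Zero T (\<sigma> (i + 1)) (\<sigma> (i + 1))"
      using \<theta> assms by (intro \<sigma>_division) (auto simp: hom_iff)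
    then show False
      using iso_left_cancel[OF \<theta>(1), of k] \<theta> assms by auto
  qed
  then have "iso (inv \<theta> \<cdot> (\<theta> \<cdot> k))"
    using \<theta>(1) by (rule iso_comp[OF _ iso_inv]) (use \<theta> assms in simp)
  then show ?thesis
    using \<theta> assms by simp
qed

text \<open>Moves a low factor \<sigma> i past an object with factors in degrees \<ge> c. Let
  \<sigma> j be the first factor of that object. If the connecting map \<sigma> j \<rightarrow>
  \<Sigma> \<sigma> i vanishes, \<sigma> j lifts to \<open>y\<close> and can be taken first, leaving
  \<sigma> i in front of fewer factors. Otherwise it is invertible and the two factors
  cancel.\<close>

lemma filt_swap:
  assumes w: "w \<ge> 1" and i: "i < c"
  shows "m \<in> filt {c..} \<Longrightarrow> y \<in> ext (\<sigma> i) m \<Longrightarrow> \<exists>m' \<in> filt {c..}. \<exists>e \<in> filt {..<c}. y \<in> ext m' e"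
proof (induction arbitrary: y rule: filt.induct)
  case (zero z)
  have y: "y \<in> Obj T"
    using zero ext_obj by blast
  have "y \<in> filt {..<c}"
    using filt_iso[OF filt_gen isomorphic_sym[OF ext_zero_right_iso[OF zero(2,1)]]] i by simp
  with zero y show ?case
    by (blast intro: filt.zero ext_zero_left_id)
next
  case (step j m2 m)
  obtain f g h where t: "tri f g h" "src f = \<sigma> i" "tgt f = y" "tgt g = m"
    using step.prems by (rule extE)
  obtain f' g' h' where t': "tri f' g' h'" "src f' = \<sigma> j" "tgt f' = m" "tgt g' = m2"
    using step.hyps(3) by (rule extE)
  note [simp] = triD[OF t(1)] t(2-4) triD[OF t'(1)] t'(2-4)
  show ?case
  proof (cases "h \<cdot> f' = Zero T (\<sigma> j) (Sus T (\<sigma> i))")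
    case True
    obtain l where l: "arr l" "src l = \<sigma> j" "tgt l = y" "g \<cdot> l = f'"
      using lift2[OF t(1), of f' "\<sigma> j"] True by auto
    obtain p q where pq: "tri l p q"
      using tri_cone_ex[OF l(1)] by blast
    have c: "tri (g \<cdot> l) g' h'"
      using t'(1) l(4) by simp
    have gl: "src g = tgt l"
      using l by simp
    obtain u v where uv: "tri u v (SusM T p \<cdot> neg T (SusM T f))" "arr u" "src u = tgt p" "tgt u = tgt g'"
      "arr v" "src v = tgt g'" "tgt v = tgt h"
      using tri_octahedral[OF pq tri_rotD[OF t(1)] c gl] by blast
    note [simp] = l(1-3) triD(2-6)[OF pq]
    \<comment> \<open>The cone of \<open>l\<close> is thereby an extension of \<sigma> i and
      \<open>m2\<close>, the situation of the induction hypothesis.\<close>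
    have "tri (p \<cdot> f) u v"
      by (subst tri_rot) (use uv in simp_all)
    from extI[OF this] have "tgt p \<in> ext (\<sigma> i) m2"
      using uv by simp
    then obtain m'' e where m'': "m'' \<in> filt {c..}" "e \<in> filt {..<c}" "tgt p \<in> ext m'' e"
      using step.IH by blast
    have "y \<in> ext (\<sigma> j) (tgt p)"
      using extI[OF pq] by simp
    then obtain z where "z \<in> ext (\<sigma> j) m''" "y \<in> ext z e"
      using m''(3) by (rule ext_assoc_left)
    with m'' step.hyps(1) show ?thesis
      by (blast intro: filt.step)
  next
    case False
    have "\<not> van (\<sigma> j) (Sus T (\<sigma> i))"
      using False by (auto simp: van_def hom_iff)
    then have "i + 1 = j \<or> i + 1 = j + w"
      using \<sigma>_van[of "i + 1" j] van_\<sigma>_sus[of "\<sigma> j" i] by auto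
    \<comment> \<open>The alternative \<open>i + 1 = j + w\<close> would give
      \<open>j \<le> i\<close>, against \<open>i < c\<close> and \<open>c \<le> j\<close>.\<close>
    then have j: "j = i + 1"
      using w i step.hyps(1) by auto
    have k: "iso (h \<cdot> f')"
      using \<sigma>_sus_division[of "h \<cdot> f'" i] False w j by auto
    obtain h1 h2 where h: "tri (h \<cdot> f') h1 h2"
      by (rule tri_cone_ex[of "h \<cdot> f'"]) auto
    have hf: "src h = tgt f'"
      by simp
    obtain u v where uv: "tri u v (SusM T g' \<cdot> neg T (SusM T g))" "arr u" "src u = tgt g'" "tgt u = tgt h1"
      "arr v" "src v = tgt h1" "tgt v = tgt (neg T (SusM T f))"
      using tri_octahedral[OF t'(1) tri_rotD[OF tri_rotD[OF t(1)]] h hf] by blast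
    \<comment> \<open>The cone of the isomorphism \<open>h \<cdot> f'\<close> is zero, so the
      octahedron identifies \<Sigma> y with \<Sigma> m2.\<close>
    have "Sus T y \<in> ext (tgt h1) (Sus T m2)"
      using extI[OF tri_rotD[OF uv(1)]] uv by simp
    then have "isomorphic T (Sus T y) (Sus T m2)"
      using tri_iso_zero[OF h k] by (rule ext_zero_left)
    moreover have y: "y \<in> Obj T" "m2 \<in> Obj T"
      using ext_obj step by blast+
    ultimately have "y \<in> filt {c..}"
      using filt_iso[OF step.hyps(2)] isomorphic_sus isomorphic_sym by blast
    then show ?thesis
      using zero_ex ext_zero_right[OF y(1)] filt.zero by metis
  qed
qed

lemma filt_truncation:
  assumes w: "w \<ge> 1"
  shows "x \<in> filt J \<Longrightarrow> \<exists>m \<in> filt {c..}. \<exists>n \<in> filt {..<c}. x \<in> ext m n"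
proof (induction rule: filt.induct)
  case (zero z)
  then show ?case
    using ext_zero_right[of z z] by (auto intro: filt.zero)
next
  case (step i y x)
  then obtain m n where mn: "m \<in> filt {c..}" "n \<in> filt {..<c}" "y \<in> ext m n"
    by blast
  obtain z where z: "z \<in> ext (\<sigma> i) m" "x \<in> ext z n"
    using step.hyps(3) mn(3) by (rule ext_assoc_left)
  show ?case
  proof (cases "i \<ge> c")
    case True
    then show ?thesis
      using z mn by (blast intro: filt.step atLeast_iff[THEN iffD2])
  next
    case False
    then obtain m' e where m': "m' \<in> filt {c..}" "e \<in> filt {..<c}" "z \<in> ext m' e"
      using filt_swap[OF w _ mn(1) z(1)] by auto
    obtain y' where "y' \<in> ext e n" "x \<in> ext m' y'"
      using m'(3) z(2) by (rule ext_assoc_right)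
    with m' mn show ?thesis
      by (blast intro: filt_ext)
  qed
qed

text \<open>For \<open>w \<ge> 1\<close> truncation is functorial, so an idempotent on an object induces one on its
  truncation.\<close>

lemma retract_truncation:
  assumes x: "retract x x'" and e: "x' \<in> ext m' n'" and v: "van m' n'" "van (Sus T m') n'"
  obtains m n where "x \<in> ext m n" "retract m m'" "retract n n'"
proof -
  obtain i p where i: "arr i" "src i = x" "tgt i = x'" and p: "arr p" "src p = x'" "tgt p = x"
    and pi: "p \<cdot> i = Id T x"
    using x by (rule retractE)
  obtain a b d where t: "tri a b d" "src a = m'" "tgt a = x'" "tgt b = n'"
    using e by (rule extE)
  note [simp] = triD[OF t(1)] t(2-4) i p
  have m': "m' \<in> Obj T" and x': "x' \<in> Obj T" and xo: "x \<in> Obj T"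
    using ext_obj e retract_obj x by blast+
  have pi': "p \<cdot> (i \<cdot> k) = k" if "arr k" "tgt k = x" for k
    using assoc_eq[OF pi, of k] that by simp
  have "b \<cdot> ((i \<cdot> p) \<cdot> a) = Zero T m' n'"
    using v by (intro vanD) auto
  \<comment> \<open>\<epsilon> is what the idempotent i p of \<open>x'\<close> induces on the
    truncation \<open>m'\<close>.\<close>
  then obtain \<epsilon> where \<epsilon>: "arr \<epsilon>" "src \<epsilon> = m'" "tgt \<epsilon> = m'" "a \<cdot> \<epsilon> = i \<cdot> (p \<cdot> a)"
    using lift1[OF t(1), of "(i \<cdot> p) \<cdot> a" m'] by auto
  note [simp] = \<epsilon>(1-3)
  have a\<epsilon>: "a \<cdot> (\<epsilon> \<cdot> k) = i \<cdot> (p \<cdot> (a \<cdot> k))" if "arr k" "tgt k = m'" for k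
    using assoc_eq[OF \<epsilon>(4), of k] that by simp
  have aa: "a \<cdot> (\<epsilon> \<cdot> \<epsilon>) = a \<cdot> \<epsilon>"
    by (simp add: a\<epsilon> \<epsilon>(4) pi')
  \<comment> \<open>Composition with \<open>a\<close> is injective on endomorphisms of
    \<open>m'\<close> because Hom(\<Sigma> m', n') = 0; hence \<epsilon> inherits
    idempotency.\<close>
  have "a \<cdot> (\<epsilon> \<cdot> \<epsilon> \<oplus> neg T \<epsilon>) = a \<cdot> (\<epsilon> \<cdot> \<epsilon>) \<oplus> neg T (a \<cdot> \<epsilon>)"
    by (subst comp_add) simp_all
  also have "\<dots> = Zero T m' x'"
    unfolding aa by simp
  finally have "\<epsilon> \<cdot> \<epsilon> \<oplus> neg T \<epsilon> = Zero T m' (src a)"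
    using v(2) by (intro mono_van[OF t(1)]) auto
  then have "\<epsilon> \<cdot> \<epsilon> = \<epsilon>"
    by (rule diff_zeroD) auto
  moreover have "\<epsilon> \<in> Hom T m' m'"
    by (simp add: hom_iff)
  ultimately obtain m \<iota> \<pi> where "summand_via T m m' \<iota> \<pi>" and \<iota>\<pi>: "\<epsilon> = \<iota> \<cdot> \<pi>"
    using idempotents_split m' unfolding idempotent_complete_def by blast
  then have \<iota>: "arr \<iota>" "src \<iota> = m" "tgt \<iota> = m'" and \<pi>: "arr \<pi>" "src \<pi> = m'" "tgt \<pi> = m"
    and \<pi>\<iota>: "\<pi> \<cdot> \<iota> = Id T m"
    by (auto simp: summand_via_def is_biproduct_def hom_iff)
  note [simp] = \<iota> \<pi>
  have mo: "m \<in> Obj T"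
    using src_obj[OF \<iota>(1)] by simp
  let ?\<alpha> = "p \<cdot> (a \<cdot> \<iota>)"
  have "arr ?\<alpha>"
    by simp
  then obtain g h where t': "tri ?\<alpha> g h"
    using tri_cone_ex by blast
  have [simp]: "src ?\<alpha> = m" "tgt ?\<alpha> = x"
    by simp_all
  have "i \<cdot> ?\<alpha> = a \<cdot> (\<epsilon> \<cdot> \<iota>)"
    by (simp add: a\<epsilon>)
  also have "\<epsilon> \<cdot> \<iota> = \<iota>"
    unfolding \<iota>\<pi> by (simp add: \<pi>\<iota>)
  finally have sq1: "i \<cdot> ?\<alpha> = a \<cdot> \<iota>" .
  have "?\<alpha> \<cdot> \<pi> = p \<cdot> (a \<cdot> \<epsilon>)"
    unfolding \<iota>\<pi> by simp
  also have "\<dots> = p \<cdot> a"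
    unfolding \<epsilon>(4) by (simp add: pi')
  finally have sq2: "p \<cdot> a = ?\<alpha> \<cdot> \<pi>" by simp
  \<comment> \<open>The summand of \<open>m'\<close> cut out by \<epsilon> maps to \<open>x\<close>
    compatibly with inclusions and projections, so the cone is a retract of
    \<open>n'\<close>.\<close>
  have "retract (tgt g) (tgt b)"
    by (rule retract_tri3[OF t' t(1), of \<iota> \<pi> i p]) (use sq1 sq2 pi \<pi>\<iota> in \<open>simp_all del: assoc comp_arr(2,3)\<close>)
  moreover have "retract m m'"
    by (rule retractI[OF \<iota> \<pi> \<pi>\<iota>])
  moreover have "x \<in> ext m (tgt g)"
    using extI[OF t'] by simp
  ultimately show ?thesis
    using that by simp
qed

lemma truncates_atLeast:
  assumes w: "w \<ge> 1"
  shows "truncates {c..}"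
  unfolding truncates_def
proof (intro conjI ballI)
  fix x assume "x \<in> Obj T"
  then obtain n where "x \<in> thick {-n..n}"
    by (rule obj_thick)
  then obtain x' where x': "x' \<in> filt {-n..n}" "retract x x'"
    by (rule thickE)
  obtain m n where mn: "m \<in> filt {c..}" "n \<in> filt {..<c}" "x' \<in> ext m n"
    using filt_truncation[OF w x'(1), of c] by blast
  have "van m n"
    using w by (intro van_thick[OF filt_thick[OF mn(1)] filt_thick[OF mn(2)]]) auto
  moreover have "van (Sus T m) n"
    using w by (intro van_thick[OF thick_sus[OF filt_thick[OF mn(1)]] filt_thick[OF mn(2)]]) auto
  ultimately obtain m' n' where "x \<in> ext m' n'" "retract m' m" "retract n' n"
    using retract_truncation[OF x'(2) mn(3)] by blast
  moreover have "- {c..} = {..<c}"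
    by auto
  ultimately show "\<exists>m \<in> thick {c..}. \<exists>n \<in> thick (- {c..}). x \<in> ext m n"
    using mn thickI by metis
next
  fix i j assume "i \<in> {c..}" "j \<in> - {c..}"
  then show "van (\<sigma> i) (\<sigma> j)"
    using w by (intro \<sigma>_van) auto
qed

lemma perp_atLeast:
  assumes w: "w \<ge> 1"
  shows "left_perp {..<c} = thick {c..}" "right_perp {c..} = thick {..<c}"
    "left_perp {..c} = thick {c<..}" "right_perp {c<..} = thick {..c}"
proof -
  have *: "- {c..} = {..<c}" for c :: int
    by auto
  show 1: "left_perp {..<c} = thick {c..}" "right_perp {c..} = thick {..<c}" for c
    using thick_perp[OF truncates_atLeast[OF w, of c]] unfolding * by auto
  have **: "{..<c + 1} = {..c}" "{c + 1..} = {c<..}"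
    by auto
  show "left_perp {..c} = thick {c<..}" "right_perp {c<..} = thick {..c}"
    using 1[of "c + 1"] unfolding ** .
qed


text \<open>Annihilating a nonzero map excludes invertibility. Combined with
  \<open>\<sigma>_division\<close> or \<open>\<sigma>_local\<close>, this makes such an endomorphism
  zero or of square zero.\<close>

lemma nonunit:
  assumes "arr e" "src e = \<sigma> a" "tgt e = \<sigma> a" "arr u" "tgt u = \<sigma> a" "src u = m"
    "u \<noteq> Zero T m (\<sigma> a)" "e \<cdot> u = Zero T m (\<sigma> a)"
  shows "\<not> iso e"
  using iso_left_cancel[of e u m "\<sigma> a"] assms by auto

lemma nonunit':
  assumes "arr e" "src e = \<sigma> a" "tgt e = \<sigma> a" "arr u" "src u = \<sigma> a" "tgt u = m"
    "u \<noteq> Zero T (\<sigma> a) m" "u \<cdot> e = Zero T (\<sigma> a) m"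
  shows "\<not> iso e"
  using iso_right_cancel[of e u "\<sigma> a" m] assms by auto

text \<open>In the long exact sequence of the triangle, with m = \<open>src u\<close>, Hom(\<Sigma>
  m, \<sigma> i) vanishes since \<Sigma> raises the lowest degree, and Hom(\<sigma> a, \<sigma> i)
  \<rightarrow> Hom(m, \<sigma> i) is injective: for \<open>i < a\<close> the source is zero, and
  for \<open>i = a\<close> a map killing the nonzero \<open>u\<close> is a non-unit, hence
  zero.\<close>

lemma cone_left_perp:
  assumes w: "w \<ge> 1" and t: "tri u v t" "tgt u = \<sigma> a" and m: "src u \<in> left_perp {..<a}"
    and u: "u \<noteq> Zero T (src u) (\<sigma> a)"
  shows "tgt v \<in> left_perp {..a}"
proof -
  note [simp] = triD[OF t(1)] t(2)
  have "van (tgt v) (\<sigma> i)" if i: "i \<le> a" for i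
  proof (rule vanI)
    fix \<phi> assume \<phi>: "arr \<phi>" "src \<phi> = tgt v" "tgt \<phi> = \<sigma> i"
    have "\<phi> \<cdot> v = Zero T (\<sigma> a) (\<sigma> i)"
    proof (cases "i = a")
      case False
      then show ?thesis
        using \<sigma>_van[of i a] i w \<phi> by (intro vanD) auto
    next
      case True
      have "(\<phi> \<cdot> v) \<cdot> u = \<phi> \<cdot> Zero T (src u) (tgt v)"
        using \<phi> tri_comp(1)[OF t(1)] by simp
      also have "\<dots> = Zero T (src u) (\<sigma> a)"
        using \<phi> True by simp
      finally have "\<not> iso (\<phi> \<cdot> v)"
        using nonunit[of "\<phi> \<cdot> v" a u] \<phi> u True by simp
      then show ?thesis
        using \<sigma>_division[of "\<phi> \<cdot> v" a] \<phi> True w by (simp add: hom_iff)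
    qed
    then obtain \<psi> where \<psi>: "arr \<psi>" "src \<psi> = Sus T (src u)" "tgt \<psi> = \<sigma> i" "\<psi> \<cdot> t = \<phi>"
      using extend2[OF t(1) \<phi>] by auto
    have "van (Sus T (src u)) (\<sigma> i)"
      using m i by (auto simp: left_perp_def van_sus_left)
    then have "\<psi> = Zero T (Sus T (src u)) (\<sigma> i)"
      using \<psi> by (intro vanD)
    then show "\<phi> = Zero T (tgt v) (\<sigma> i)"
      using \<psi>(4) by simp
  qed
  then show ?thesis
    by (simp add: left_perp_def)
qed

lemma fibre_right_perp:
  assumes w: "w \<ge> 1" and t: "tri s v t" "src v = \<sigma> a" and n: "tgt v \<in> right_perp {a<..}"
    and v: "v \<noteq> Zero T (\<sigma> a) (tgt v)"
  shows "src s \<in> right_perp {a..}"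
proof -
  have s: "tgt s = \<sigma> a"
    using triD[OF t(1)] t(2) by simp
  note [simp] = triD(1,2,3,5,6)[OF t(1)] t(2) s
  have "van (\<sigma> i) (src s)" if i: "i \<ge> a" for i
  proof (rule vanI)
    fix \<phi> assume \<phi>: "arr \<phi>" "src \<phi> = \<sigma> i" "tgt \<phi> = src s"
    have "s \<cdot> \<phi> = Zero T (\<sigma> i) (\<sigma> a)"
    proof (cases "i = a")
      case False
      then show ?thesis
        using \<sigma>_van[of a i] i w \<phi> by (intro vanD) auto
    next
      case True
      have "v \<cdot> (s \<cdot> \<phi>) = Zero T (src s) (tgt v) \<cdot> \<phi>"
        using \<phi> assoc_eq[OF tri_comp(1)[OF t(1)], of \<phi>] by simp
      also have "\<dots> = Zero T (\<sigma> a) (tgt v)"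
        using \<phi> True by simp
      finally have "\<not> iso (s \<cdot> \<phi>)"
        using nonunit'[of "s \<cdot> \<phi>" a v] \<phi> v True by simp
      then show ?thesis
        using \<sigma>_division[of "s \<cdot> \<phi>" a] \<phi> True w by (simp add: hom_iff)
    qed
    moreover have "van (Sus T (\<sigma> i)) (tgt v)"
      using n i by (auto simp: right_perp_def van_sus_\<sigma>)
    ultimately show "\<phi> = Zero T (\<sigma> i) (src s)"
      using mono_van[OF t(1) _ \<phi>] by simp
  qed
  then show ?thesis
    by (simp add: right_perp_def)
qed

text \<open>Any nonzero maps m \<rightarrow> \<sigma> a \<rightarrow> n compose to a nonzero map:
  otherwise the second factors through the cone of the first, which lives in degrees above
  \<open>a\<close> and has no maps to \<open>n\<close>.\<close>

lemma hom_lowest_pos: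
  assumes w: "w \<ge> 1" and m: "m \<in> left_perp {..<a}" "\<not> van m (\<sigma> a)"
    and n: "n \<in> right_perp {a<..}" "\<not> van (\<sigma> a) n"
  shows "\<not> van m n"
proof
  assume v: "van m n"
  obtain u where u: "arr u" "src u = m" "tgt u = \<sigma> a" "u \<noteq> Zero T m (\<sigma> a)"
    using m(2) by (rule not_vanE)
  obtain f where f: "arr f" "src f = \<sigma> a" "tgt f = n" "f \<noteq> Zero T (\<sigma> a) n"
    using n(2) by (rule not_vanE)
  obtain g h where t: "tri u g h"
    using tri_cone_ex[OF u(1)] by blast
  have "f \<cdot> u = Zero T m n"
    using v u f by (intro vanD) auto
  then obtain \<psi> where \<psi>: "arr \<psi>" "src \<psi> = tgt g" "tgt \<psi> = n" "\<psi> \<cdot> g = f"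
    using extend1[OF t, of f n] u f by auto
  have um: "src u \<in> left_perp {..<a}" "u \<noteq> Zero T (src u) (\<sigma> a)"
    unfolding u(2) using m(1) u(4) by auto
  have "tgt g \<in> thick {a<..}"
    using cone_left_perp[OF w t u(3) um] unfolding perp_atLeast(3)[OF w] .
  then have "van (tgt g) n"
    by (rule van_thick_left) (use n in \<open>auto simp: right_perp_def\<close>)
  then have "\<psi> = Zero T (tgt g) n"
    using \<psi> by (intro vanD)
  then show False
    using \<psi>(4) f triD[OF t] u n by (auto simp: right_perp_def)
qed

text \<open>A map x \<rightarrow> y is built around a nonzero \<sigma> a \<rightarrow> \<sigma> (a +
  w): it lifts along y \<rightarrow> \<sigma> (a + w) and then extends along \<sigma> a
  \<rightarrow> x, the obstructions vanishing for reasons of degree. This is why the offset between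
  the two extremal degrees is \<open>w\<close>.\<close>

lemma hom_highest_pos:
  assumes w: "w \<ge> 1" and x: "x \<in> right_perp {a<..}" "\<not> van (\<sigma> a) x"
    and y: "y \<in> left_perp {..<a + w}" "\<not> van y (\<sigma> (a + w))"
  shows "\<not> van x y"
proof
  assume v: "van x y"
  have o: "x \<in> Obj T" "y \<in> Obj T"
    using x y by (auto simp: left_perp_def right_perp_def)
  obtain X where X: "arr X" "src X = \<sigma> a" "tgt X = \<sigma> (a + w)" "X \<noteq> Zero T (\<sigma> a) (\<sigma> (a + w))"
    using \<sigma>_top[of a] by (auto simp: hom_iff)
  obtain g where g: "arr g" "src g = y" "tgt g = \<sigma> (a + w)" "g \<noteq> Zero T y (\<sigma> (a + w))"
    using y(2) by (rule not_vanE)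
  obtain f where f: "arr f" "src f = \<sigma> a" "tgt f = x" "f \<noteq> Zero T (\<sigma> a) x"
    using x(2) by (rule not_vanE)
  obtain c d where t: "tri g c d"
    using tri_cone_ex[OF g(1)] by blast
  have gy: "src g \<in> left_perp {..<a + w}" "g \<noteq> Zero T (src g) (\<sigma> (a + w))"
    unfolding g(2) using y(1) g(4) by auto
  have c: "tgt c \<in> thick {a + w<..}"
    using cone_left_perp[OF w t g(3) gy] unfolding perp_atLeast(3)[OF w] .
  have "van (\<sigma> a) (tgt c)"
    using w by (intro van_thick_right[OF c] \<sigma>_van) auto
  then have "c \<cdot> X = Zero T (\<sigma> a) (tgt c)"
    using X g triD[OF t] by (intro vanD) auto
  then obtain \<phi> where \<phi>: "arr \<phi>" "src \<phi> = \<sigma> a" "tgt \<phi> = y" "g \<cdot> \<phi> = X"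
    using lift1[OF t, of X "\<sigma> a"] X g by auto
  obtain s k where t': "tri s f k"
    using tri_fibre_ex[OF f(1)] by blast
  have s: "arr s" "tgt s = \<sigma> a"
    using triD[OF t'] f by auto
  have fx: "tgt f \<in> right_perp {a<..}" "f \<noteq> Zero T (\<sigma> a) (tgt f)"
    unfolding f(3) using x(1) f(4) by auto
  have "src s \<in> thick {..<a}"
    using fibre_right_perp[OF w t' f(2) fx] unfolding perp_atLeast(2)[OF w] .
  moreover have "y \<in> thick {a + w..}"
    using y perp_atLeast[OF w] by simp
  ultimately have "van (src s) y"
    using w by (elim van_thick) auto
  then have "\<phi> \<cdot> s = Zero T (src s) y"
    using \<phi> s by (intro vanD) auto
  then obtain \<psi> where \<psi>: "arr \<psi>" "src \<psi> = tgt f" "tgt \<psi> = y" "\<psi> \<cdot> f = \<phi>"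
    using extend1[OF t', of \<phi> y] \<phi> s by auto
  have "\<psi> = Zero T x y"
    using v \<psi> f by (intro vanD) auto
  then have "\<phi> = Zero T (\<sigma> a) y"
    using \<psi>(4) f o by auto
  then have "X = Zero T (\<sigma> a) (\<sigma> (a + w))"
    using \<phi>(4) g by auto
  then show False
    using X by simp
qed

end

section \<open>Truncation and extremal degrees for \<open>w \<le> 0\<close>\<close>

context preadditive_category
begin

text \<open>The number of generators over an endomorphism ring replaces dimension as induction measure, so
  that no linear algebra is needed.\<close>

inductive_set lspan :: "'o \<Rightarrow> 'o \<Rightarrow> 'm set \<Rightarrow> 'm set" for a b :: 'o and L :: "'m set" where
  zero: "Zero C a b \<in> lspan a b L"
| add: "u \<in> L \<Longrightarrow> e \<in> Hom C b b \<Longrightarrow> f \<in> lspan a b L \<Longrightarrow> e \<cdot> u \<oplus> f \<in> lspan a b L"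

inductive_set rspan :: "'o \<Rightarrow> 'o \<Rightarrow> 'm set \<Rightarrow> 'm set" for a b :: 'o and L :: "'m set" where
  zero: "Zero C a b \<in> rspan a b L"
| add: "u \<in> L \<Longrightarrow> e \<in> Hom C a a \<Longrightarrow> f \<in> rspan a b L \<Longrightarrow> u \<cdot> e \<oplus> f \<in> rspan a b L"

section \<open>Generators of Hom as a module over an endomorphism ring\<close>

definition lgen :: "'o \<Rightarrow> 'o \<Rightarrow> 'm list \<Rightarrow> bool" where
  "lgen a b L \<longleftrightarrow> set L \<subseteq> Hom C a b \<and> Hom C a b \<subseteq> lspan a b (set L)"

definition rgen :: "'o \<Rightarrow> 'o \<Rightarrow> 'm list \<Rightarrow> bool" where
  "rgen a b L \<longleftrightarrow> set L \<subseteq> Hom C a b \<and> Hom C a b \<subseteq> rspan a b (set L)"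

lemma lspan_hom: "f \<in> lspan a b L \<Longrightarrow> L \<subseteq> Hom C a b \<Longrightarrow> a \<in> Obj C \<Longrightarrow> b \<in> Obj C \<Longrightarrow> f \<in> Hom C a b"
  by (induction rule: lspan.induct) (auto intro: zero_hom add_hom comp_hom)

lemma rspan_hom: "f \<in> rspan a b L \<Longrightarrow> L \<subseteq> Hom C a b \<Longrightarrow> a \<in> Obj C \<Longrightarrow> b \<in> Obj C \<Longrightarrow> f \<in> Hom C a b"
  by (induction rule: rspan.induct) (auto intro: zero_hom add_hom comp_hom)

lemma lspan_mono: "f \<in> lspan a b L \<Longrightarrow> L \<subseteq> L' \<Longrightarrow> f \<in> lspan a b L'"
  by (induction rule: lspan.induct) (auto intro: lspan.intros)

lemma rspan_mono: "f \<in> rspan a b L \<Longrightarrow> L \<subseteq> L' \<Longrightarrow> f \<in> rspan a b L'"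
  by (induction rule: rspan.induct) (auto intro: rspan.intros)

lemma lspan_comp:
  assumes g: "arr g" "src g = c" "tgt g = a" and b: "b \<in> Obj C" and L: "L \<subseteq> Hom C a b"
  shows "f \<in> lspan a b L \<Longrightarrow> f \<cdot> g \<in> lspan c b ((\<lambda>u. u \<cdot> g) ` L)"
proof (induction rule: lspan.induct)
  case zero
  then show ?case
    using g b lspan.zero[of c b] by auto
next
  case (add u e f)
  have a: "a \<in> Obj C"
    using g by auto
  have u: "arr u" "src u = a" "tgt u = b"
    using add L by (auto simp: hom_iff)
  have f: "arr f" "src f = a" "tgt f = b"
    using lspan_hom[OF add.hyps(3) L a b] by (auto simp: hom_iff)
  have "(e \<cdot> u \<oplus> f) \<cdot> g = e \<cdot> (u \<cdot> g) \<oplus> f \<cdot> g"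
    using add.hyps(2) u f g by (subst add_comp) (auto simp: hom_iff)
  then show ?case
    using add by (auto intro: lspan.add)
qed

lemma rspan_comp:
  assumes g: "arr g" "src g = b" "tgt g = c" and a: "a \<in> Obj C" and L: "L \<subseteq> Hom C a b"
  shows "f \<in> rspan a b L \<Longrightarrow> g \<cdot> f \<in> rspan a c ((\<lambda>u. g \<cdot> u) ` L)"
proof (induction rule: rspan.induct)
  case zero
  then show ?case
    using g a rspan.zero[of a c] by auto
next
  case (add u e f)
  have b: "b \<in> Obj C"
    using g by auto
  have u: "arr u" "src u = a" "tgt u = b"
    using add L by (auto simp: hom_iff)
  have f: "arr f" "src f = a" "tgt f = b"
    using rspan_hom[OF add.hyps(3) L a b] by (auto simp: hom_iff)
  have "g \<cdot> (u \<cdot> e \<oplus> f) = (g \<cdot> u) \<cdot> e \<oplus> g \<cdot> f"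
    using add.hyps(2) u f g by (subst comp_add) (auto simp: hom_iff)
  moreover have "(g \<cdot> u) \<cdot> e \<oplus> g \<cdot> f \<in> rspan a c ((\<lambda>u. g \<cdot> u) ` L)"
    using add by (auto intro: rspan.add)
  ultimately show ?case
    by simp
qed

lemma lgen_Nil: "lgen a b [] \<Longrightarrow> van a b"
proof (unfold lgen_def van_def, intro ballI)
  fix f assume "set [] \<subseteq> Hom C a b \<and> Hom C a b \<subseteq> lspan a b (set [])" "f \<in> Hom C a b"
  then have "f \<in> lspan a b {}"
    by auto
  then show "f = Zero C a b"
    by cases auto
qed

lemma rgen_Nil: "rgen a b [] \<Longrightarrow> van a b"
proof (unfold rgen_def van_def, intro ballI)
  fix f assume "set [] \<subseteq> Hom C a b \<and> Hom C a b \<subseteq> rspan a b (set [])" "f \<in> Hom C a b"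
  then have "f \<in> rspan a b {}"
    by auto
  then show "f = Zero C a b"
    by cases auto
qed

lemma lspan_drop_zero:
  assumes "b \<in> Obj C" "L \<subseteq> Hom C a b" "a \<in> Obj C"
  shows "f \<in> lspan a b (insert (Zero C a b) L) \<Longrightarrow> f \<in> lspan a b L"
proof (induction rule: lspan.induct)
  case (add u e f)
  have "f \<in> Hom C a b"
    using lspan_hom[OF add.IH assms(2,3,1)] .
  then have "e \<cdot> Zero C a b \<oplus> f = f"
    using add.hyps(2) assms by (auto simp: hom_iff)
  then show ?case
    using add by (auto intro: lspan.add)
qed (rule lspan.zero)

lemma rspan_drop_zero:
  assumes "b \<in> Obj C" "L \<subseteq> Hom C a b" "a \<in> Obj C"
  shows "f \<in> rspan a b (insert (Zero C a b) L) \<Longrightarrow> f \<in> rspan a b L"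
proof (induction rule: rspan.induct)
  case (add u e f)
  have "f \<in> Hom C a b"
    using rspan_hom[OF add.IH assms(2,3,1)] .
  then have "Zero C a b \<cdot> e \<oplus> f = f"
    using add.hyps(2) assms by (auto simp: hom_iff)
  then show ?case
    using add by (auto intro: rspan.add)
qed (rule rspan.zero)

lemma lgen_drop_zero: "lgen a b (Zero C a b # L) \<Longrightarrow> a \<in> Obj C \<Longrightarrow> b \<in> Obj C \<Longrightarrow> lgen a b L"
  using lspan_drop_zero[of b "set L" a] by (auto simp: lgen_def)

lemma rgen_drop_zero: "rgen a b (Zero C a b # L) \<Longrightarrow> a \<in> Obj C \<Longrightarrow> b \<in> Obj C \<Longrightarrow> rgen a b L"
  using rspan_drop_zero[of b "set L" a] by (auto simp: rgen_def)

lemma lgen_comp: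
  assumes L: "lgen a b L" and g: "arr g" "src g = c" "tgt g = a" and b: "b \<in> Obj C"
    and surj: "\<And>f. f \<in> Hom C c b \<Longrightarrow> \<exists>f' \<in> Hom C a b. f = f' \<cdot> g"
  shows "lgen c b (map (\<lambda>u. u \<cdot> g) L)"
  unfolding lgen_def
proof (intro conjI subsetI)
  fix u assume "u \<in> set (map (\<lambda>u. u \<cdot> g) L)"
  then show "u \<in> Hom C c b"
    using L g by (auto simp: lgen_def hom_iff)
next
  fix f assume "f \<in> Hom C c b"
  then obtain f' where "f' \<in> Hom C a b" "f = f' \<cdot> g"
    using surj by blast
  then show "f \<in> lspan c b (set (map (\<lambda>u. u \<cdot> g) L))"
    using lspan_comp[OF g b, of "set L" f'] L by (auto simp: lgen_def)
qed

lemma rgen_comp: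
  assumes L: "rgen a b L" and g: "arr g" "src g = b" "tgt g = c" and a: "a \<in> Obj C"
    and surj: "\<And>f. f \<in> Hom C a c \<Longrightarrow> \<exists>f' \<in> Hom C a b. f = g \<cdot> f'"
  shows "rgen a c (map (\<lambda>u. g \<cdot> u) L)"
  unfolding rgen_def
proof (intro conjI subsetI)
  fix u assume "u \<in> set (map (\<lambda>u. g \<cdot> u) L)"
  then show "u \<in> Hom C a c"
    using L g by (auto simp: rgen_def hom_iff)
next
  fix f assume "f \<in> Hom C a c"
  then obtain f' where "f' \<in> Hom C a b" "f = g \<cdot> f'"
    using surj by blast
  then show "f \<in> rspan a c (set (map (\<lambda>u. g \<cdot> u) L))"
    using rspan_comp[OF g a, of "set L" f'] L by (auto simp: rgen_def)
qed

lemma lgen_tail: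
  assumes "lgen a b (u # L)" "u \<cdot> g = Zero C c b" "lgen c b (map (\<lambda>u. u \<cdot> g) (u # L))" "c \<in> Obj C" "b \<in> Obj C"
  shows "lgen c b (map (\<lambda>u. u \<cdot> g) L)"
  using assms lgen_drop_zero[of c b] by simp

end

context spherical_sequence
begin

text \<open>Peel off the first factor \<sigma> j of \<open>x\<close>. By
  \<open>\<sigma>_principal\<close> the restrictions of maps x \<rightarrow> \<sigma> q to \<sigma>
  j are multiples of a single one, that of \<phi>0. After subtracting a multiple of \<phi>0, a map
  vanishes on \<sigma> j and comes from the remaining part, which has generators by
  induction.\<close>

lemma lgen_ex:
  assumes "x \<in> Obj T"
  obtains L where "lgen x (\<sigma> q) L"
proof -
  obtain n where "x \<in> thick {-n..n}"
    using obj_thick[OF assms] .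
  then have "\<exists>L. lgen x (\<sigma> q) L"
  proof (induction rule: thick_induct)
    case (zero z)
    then have "lgen z (\<sigma> q) []"
      using van_zero_left[OF zero, of "\<sigma> q"] by (auto simp: lgen_def van_def intro: lspan.zero)
    then show ?case ..
  next
    case (step j y x)
    obtain L where L: "lgen y (\<sigma> q) L"
      using step by blast
    obtain f g h where t: "tri f g h" "src f = \<sigma> j" "tgt f = x" "tgt g = y"
      using step.hyps(3) by (rule extE)
    note [simp] = triD[OF t(1)] t(2-4)
    have x: "x \<in> Obj T"
      using ext_obj step by blast
    let ?W = "(\<lambda>\<phi>. \<phi> \<cdot> f) ` Hom T x (\<sigma> q)"
    have "?W \<subseteq> Hom T (\<sigma> j) (\<sigma> q)"
      by (auto simp: hom_iff)
    moreover have "?W \<noteq> {}"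
      using zero_hom[of x "\<sigma> q"] x by auto
    ultimately obtain u where "u \<in> ?W" and u: "\<And>v. v \<in> ?W \<Longrightarrow> \<exists>e \<in> Hom T (\<sigma> q) (\<sigma> q). v = e \<cdot> u"
      using \<sigma>_principal[of ?W j q] by blast
    then obtain \<phi>0 where \<phi>0: "\<phi>0 \<in> Hom T x (\<sigma> q)" "u = \<phi>0 \<cdot> f"
      by blast
    let ?L = "\<phi>0 # map (\<lambda>u. u \<cdot> g) L"
    have "lgen x (\<sigma> q) ?L"
      unfolding lgen_def
    proof (intro conjI subsetI)
      fix v assume "v \<in> set ?L"
      then show "v \<in> Hom T x (\<sigma> q)"
        using \<phi>0 L by (auto simp: lgen_def hom_iff)
    next
      fix \<phi> assume \<phi>: "\<phi> \<in> Hom T x (\<sigma> q)"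
      then obtain e where e: "e \<in> Hom T (\<sigma> q) (\<sigma> q)" "\<phi> \<cdot> f = e \<cdot> u"
        using u by blast
      note [simp] = \<phi>[unfolded hom_iff] \<phi>0(1)[unfolded hom_iff] e(1)[unfolded hom_iff]
      let ?d = "\<phi> \<oplus> neg T (e \<cdot> \<phi>0)"
      have "?d \<cdot> f = \<phi> \<cdot> f \<oplus> neg T (e \<cdot> \<phi>0) \<cdot> f"
        by (rule add_comp) simp_all
      also have "\<dots> = Zero T (src f) (\<sigma> q)"
        unfolding e(2) \<phi>0(2) by simp
      finally obtain \<psi> where \<psi>: "arr \<psi>" "src \<psi> = y" "tgt \<psi> = \<sigma> q" "\<psi> \<cdot> g = ?d"
        using extend1[OF t(1), of ?d "\<sigma> q"] by auto
      have "\<psi> \<cdot> g \<in> lspan x (\<sigma> q) ((\<lambda>u. u \<cdot> g) ` set L)"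
        by (rule lspan_comp) (use L \<psi> in \<open>auto simp: lgen_def hom_iff subset_iff\<close>)
      then have "\<psi> \<cdot> g \<in> lspan x (\<sigma> q) (set ?L)"
        by (rule lspan_mono) auto
      then have "e \<cdot> \<phi>0 \<oplus> \<psi> \<cdot> g \<in> lspan x (\<sigma> q) (set ?L)"
        using e by (intro lspan.add) auto
      then show "\<phi> \<in> lspan x (\<sigma> q) (set ?L)"
        unfolding \<psi>(4) by simp
    qed
    then show ?case ..
  next
    case (retract x y)
    then obtain L where L: "lgen y (\<sigma> q) L" by blast
    obtain i p where ip: "arr i" "src i = x" "tgt i = y" "arr p" "src p = y" "tgt p = x" "p \<cdot> i = Id T x"
      using retract by (auto elim: retractE)
    have "lgen x (\<sigma> q) (map (\<lambda>u. u \<cdot> i) L)"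
    proof (rule lgen_comp[OF L ip(1-3) \<sigma>_obj])
      fix f assume "f \<in> Hom T x (\<sigma> q)"
      then show "\<exists>f' \<in> Hom T y (\<sigma> q). f = f' \<cdot> i"
        using ip by (intro bexI[of _ "f \<cdot> p"]) (auto simp: hom_iff)
    qed
    then show ?case ..
  qed
  then show ?thesis
    using that by blast
qed

text \<open>Dual to \<open>lgen_ex\<close>; the factor peeled off is the last one, whence
  \<open>filt_rev_induct\<close>, and the retract is taken at the end.\<close>

lemma rgen_ex:
  assumes "x \<in> Obj T"
  obtains L where "rgen (\<sigma> q) x L"
proof -
  obtain n where "x \<in> thick {-n..n}"
    using obj_thick[OF assms] .
  then obtain x' where x': "x' \<in> filt {-n..n}" "retract x x'"
    by (rule thickE)
  have "\<exists>L. rgen (\<sigma> q) x' L"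
    using x'(1)
  proof (induction rule: filt_rev_induct)
    case (zero z)
    then have "rgen (\<sigma> q) z []"
      using van_zero_right[OF zero, of "\<sigma> q"] by (auto simp: rgen_def van_def intro: rspan.zero)
    then show ?case ..
  next
    case (step j y x)
    obtain L where L: "rgen (\<sigma> q) y L"
      using step by blast
    obtain f g h where t: "tri f g h" "src f = y" "tgt f = x" "tgt g = \<sigma> j"
      using step.hyps(2) by (rule extE)
    note [simp] = triD[OF t(1)] t(2-4)
    have x: "x \<in> Obj T"
      using ext_obj step by blast
    let ?W = "(\<lambda>\<phi>. g \<cdot> \<phi>) ` Hom T (\<sigma> q) x"
    have "?W \<subseteq> Hom T (\<sigma> q) (\<sigma> j)"
      by (auto simp: hom_iff)
    moreover have "?W \<noteq> {}"
      using zero_hom[of "\<sigma> q" x] x by auto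
    ultimately obtain u where "u \<in> ?W" and u: "\<And>v. v \<in> ?W \<Longrightarrow> \<exists>e \<in> Hom T (\<sigma> q) (\<sigma> q). v = u \<cdot> e"
      using \<sigma>_principal[of ?W q j] by blast
    then obtain \<phi>0 where \<phi>0: "\<phi>0 \<in> Hom T (\<sigma> q) x" "u = g \<cdot> \<phi>0"
      by blast
    let ?L = "\<phi>0 # map (\<lambda>u. f \<cdot> u) L"
    have "rgen (\<sigma> q) x ?L"
      unfolding rgen_def
    proof (intro conjI subsetI)
      fix v assume "v \<in> set ?L"
      then show "v \<in> Hom T (\<sigma> q) x"
        using \<phi>0 L by (auto simp: rgen_def hom_iff)
    next
      fix \<phi> assume \<phi>: "\<phi> \<in> Hom T (\<sigma> q) x"
      then obtain e where e: "e \<in> Hom T (\<sigma> q) (\<sigma> q)" "g \<cdot> \<phi> = u \<cdot> e"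
        using u by blast
      note [simp] = \<phi>[unfolded hom_iff] \<phi>0(1)[unfolded hom_iff] e(1)[unfolded hom_iff]
      let ?d = "\<phi> \<oplus> neg T (\<phi>0 \<cdot> e)"
      have "g \<cdot> ?d = g \<cdot> \<phi> \<oplus> g \<cdot> neg T (\<phi>0 \<cdot> e)"
        by (rule comp_add) simp_all
      also have "\<dots> = Zero T (\<sigma> q) (tgt g)"
        unfolding e(2) \<phi>0(2) by simp
      finally obtain \<psi> where \<psi>: "arr \<psi>" "src \<psi> = \<sigma> q" "tgt \<psi> = y" "f \<cdot> \<psi> = ?d"
        using lift1[OF t(1), of ?d "\<sigma> q"] by auto
      have "f \<cdot> \<psi> \<in> rspan (\<sigma> q) x ((\<lambda>u. f \<cdot> u) ` set L)"
        by (rule rspan_comp) (use L \<psi> in \<open>auto simp: rgen_def hom_iff subset_iff\<close>)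
      then have "f \<cdot> \<psi> \<in> rspan (\<sigma> q) x (set ?L)"
        by (rule rspan_mono) auto
      then have "\<phi>0 \<cdot> e \<oplus> f \<cdot> \<psi> \<in> rspan (\<sigma> q) x (set ?L)"
        using e by (intro rspan.add) auto
      then show "\<phi> \<in> rspan (\<sigma> q) x (set ?L)"
        unfolding \<psi>(4) by simp
    qed
    then show ?case ..
  qed
  then obtain L where L: "rgen (\<sigma> q) x' L" by blast
  obtain i p where ip: "arr i" "src i = x" "tgt i = x'" "arr p" "src p = x'" "tgt p = x" "p \<cdot> i = Id T x"
    using x'(2) by (rule retractE)
  have "rgen (\<sigma> q) x (map (\<lambda>u. p \<cdot> u) L)"
  proof (rule rgen_comp[OF L ip(4-6) \<sigma>_obj])
    fix f assume "f \<in> Hom T (\<sigma> q) x"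
    then show "\<exists>f' \<in> Hom T (\<sigma> q) x'. f = p \<cdot> f'"
      using ip by (intro bexI[of _ "i \<cdot> f"]) (auto simp: hom_iff simp flip: assoc)
  qed
  then show ?thesis
    by (rule that)
qed

text \<open>The obstruction lies in Hom(\<sigma> q, \<Sigma> \<sigma> i), which is zero because
  \<open>i + 1 > q\<close> and \<open>q \<ge> q + w\<close>. So for \<open>w \<le> 0\<close> the
  fibre of a map to \<sigma> q has no new maps to \<sigma> i in degrees
  \<open>i \<ge> q\<close>.\<close>

lemma fibre_surj:
  assumes w: "w \<le> 0" and t: "tri j u d" "tgt u = \<sigma> q" and i: "i \<ge> q"
    and \<phi>: "arr \<phi>" "src \<phi> = src j" "tgt \<phi> = \<sigma> i"
  obtains \<psi> where "arr \<psi>" "src \<psi> = tgt j" "tgt \<psi> = \<sigma> i" "\<psi> \<cdot> j = \<phi>"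
proof (rule extend_van[OF t(1) _ \<phi>])
  show "van (tgt u) (Sus T (\<sigma> i))"
    using w i t(2) by (simp add: van_\<sigma>_sus \<sigma>_van)
qed

lemma cone_surj:
  assumes w: "w \<le> 0" and t: "tri f g h" "src f = \<sigma> q" and i: "i \<le> q"
    and \<phi>: "arr \<phi>" "src \<phi> = \<sigma> i" "tgt \<phi> = tgt g"
  obtains \<psi> where "arr \<psi>" "src \<psi> = \<sigma> i" "tgt \<psi> = tgt f" "g \<cdot> \<psi> = \<phi>"
proof (rule lift_van[OF t(1) _ \<phi>])
  show "van (\<sigma> i) (Sus T (src f))"
    using w i t(2) by (simp add: van_\<sigma>_sus \<sigma>_van)
qed

lemma fibre_left_perp:
  assumes w: "w \<le> 0" and t: "tri j u d" "tgt u = \<sigma> q" and p: "tgt j \<in> left_perp {q<..}"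
  shows "src j \<in> left_perp {q<..}"
proof -
  note [simp] = triD[OF t(1)] t(2)
  have "van (src j) (\<sigma> i)" if i: "i > q" for i
  proof (rule vanI)
    fix \<phi> assume "arr \<phi>" "src \<phi> = src j" "tgt \<phi> = \<sigma> i"
    then obtain \<psi> where \<psi>: "arr \<psi>" "src \<psi> = tgt j" "tgt \<psi> = \<sigma> i" "\<psi> \<cdot> j = \<phi>"
      using fibre_surj[OF w t, of i] i by auto
    then have "\<psi> = Zero T (tgt j) (\<sigma> i)"
      using p i by (intro vanD) (auto simp: left_perp_def)
    then show "\<phi> = Zero T (src j) (\<sigma> i)"
      using \<psi>(4) by simp
  qed
  then show ?thesis
    by (simp add: left_perp_def)
qed

lemma cone_right_perp:
  assumes w: "w \<le> 0" and t: "tri f g h" "src f = \<sigma> q" and p: "tgt f \<in> right_perp {..<q}"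
  shows "tgt g \<in> right_perp {..<q}"
proof -
  note [simp] = triD[OF t(1)] t(2)
  have "van (\<sigma> i) (tgt g)" if i: "i < q" for i
  proof (rule vanI)
    fix \<phi> assume "arr \<phi>" "src \<phi> = \<sigma> i" "tgt \<phi> = tgt g"
    then obtain \<psi> where \<psi>: "arr \<psi>" "src \<psi> = \<sigma> i" "tgt \<psi> = tgt f" "g \<cdot> \<psi> = \<phi>"
      using cone_surj[OF w t, of i] i by auto
    then have "\<psi> = Zero T (\<sigma> i) (tgt f)"
      using p i by (intro vanD) (auto simp: right_perp_def)
    then show "\<phi> = Zero T (\<sigma> i) (tgt g)"
      using \<psi>(4) by simp
  qed
  then show ?thesis
    by (simp add: right_perp_def)
qed

text \<open>All maps from the fibre to \<sigma> q are restrictions, and the restriction of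
  \<open>u\<close> itself vanishes: one generator fewer.\<close>

lemma lgen_fibre:
  assumes w: "w \<le> 0" and t: "tri j u d" "tgt u = \<sigma> q" and L: "lgen (tgt j) (\<sigma> q) (u # L)"
  shows "lgen (src j) (\<sigma> q) (map (\<lambda>v. v \<cdot> j) L)"
proof (rule lgen_tail[OF L])
  note [simp] = triD[OF t(1)] t(2)
  show "u \<cdot> j = Zero T (src j) (\<sigma> q)"
    using tri_comp(1)[OF t(1)] by simp
  show "lgen (src j) (\<sigma> q) (map (\<lambda>u. u \<cdot> j) (u # L))"
  proof (rule lgen_comp[OF L])
    fix f assume "f \<in> Hom T (src j) (\<sigma> q)"
    then have f: "arr f" "src f = src j" "tgt f = \<sigma> q"
      by (auto simp: hom_iff)
    show "\<exists>f' \<in> Hom T (tgt j) (\<sigma> q). f = f' \<cdot> j"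
      by (rule fibre_surj[OF w t order_refl f]) (auto simp: hom_iff)
  qed auto
qed (use triD[OF t(1)] in auto)

lemma rgen_cone:
  assumes w: "w \<le> 0" and t: "tri f g h" "src f = \<sigma> q" and L: "rgen (\<sigma> q) (tgt f) (f # L)"
  shows "rgen (\<sigma> q) (tgt g) (map (\<lambda>v. g \<cdot> v) L)"
proof -
  note [simp] = triD[OF t(1)] t(2)
  have "rgen (\<sigma> q) (tgt g) (map (\<lambda>v. g \<cdot> v) (f # L))"
  proof (rule rgen_comp[OF L])
    fix v assume "v \<in> Hom T (\<sigma> q) (tgt g)"
    then have v: "arr v" "src v = \<sigma> q" "tgt v = tgt g"
      by (auto simp: hom_iff)
    show "\<exists>f' \<in> Hom T (\<sigma> q) (tgt f). v = g \<cdot> f'"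
      by (rule cone_surj[OF w t order_refl v]) (auto simp: hom_iff)
  qed auto
  then show ?thesis
    using tri_comp(1)[OF t(1)] rgen_drop_zero[of "\<sigma> q" "tgt g"] by simp
qed

text \<open>Taking fibres of generators one by one empties Hom(-, \<sigma> q); the removed copies of
  \<sigma> q accumulate in \<open>z\<close> by associativity of extensions.\<close>

lemma kill_top:
  assumes w: "w \<le> 0" and y: "y \<in> left_perp {q<..}"
  obtains x z where "x \<in> left_perp {q..}" "z \<in> thick {q}" "y \<in> ext x z"
proof -
  have yo: "y \<in> Obj T"
    using y by (simp add: left_perp_def)
  obtain L where "lgen y (\<sigma> q) L"
    using lgen_ex[OF yo] .
  then have "\<exists>x z. x \<in> left_perp {q..} \<and> z \<in> thick {q} \<and> y \<in> ext x z"
    using y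
  proof (induction L arbitrary: y rule: length_induct)
    case (1 L)
    have yo: "y \<in> Obj T"
      using 1 by (simp add: left_perp_def)
    show ?case
    proof (cases L)
      case Nil
      then have "van y (\<sigma> i)" if "i \<ge> q" for i
        using 1(2,3) lgen_Nil[of y "\<sigma> q"] that by (cases "i = q") (auto simp: left_perp_def)
      then have "y \<in> left_perp {q..}"
        using yo by (auto simp: left_perp_def)
      moreover obtain z where "z \<in> zero_objects T"
        by (rule zero_ex)
      ultimately show ?thesis
        using thick_zero ext_zero_right[OF yo] by blast
    next
      case (Cons u L')
      have u: "arr u" "src u = y" "tgt u = \<sigma> q"
        using 1(2) Cons by (auto simp: lgen_def hom_iff)
      obtain j d where t: "tri j u d"
        using tri_fibre_ex[OF u(1)] .
      have j: "tgt j = y"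
        using triD[OF t] u by simp
      have "lgen (src j) (\<sigma> q) (map (\<lambda>v. v \<cdot> j) L')"
        using lgen_fibre[OF w t u(3)] 1(2) Cons j by simp
      moreover have "src j \<in> left_perp {q<..}"
        using fibre_left_perp[OF w t u(3)] 1(3) j by simp
      ultimately obtain x z where xz: "x \<in> left_perp {q..}" "z \<in> thick {q}" "src j \<in> ext x z"
        using 1(1)[rule_format, of "map (\<lambda>v. v \<cdot> j) L'" "src j"] Cons by auto
      have "y \<in> ext (src j) (\<sigma> q)"
        using extI[OF t] j u by simp
      with xz(3) obtain z' where "z' \<in> ext z (\<sigma> q)" "y \<in> ext x z'"
        by (rule ext_assoc_right)
      with xz show ?thesis
        using thick_ext[OF xz(2) thick_gen] by blast
    qed
  qed
  then show ?thesis
    using that by blast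
qed

lemma kill_above:
  assumes w: "w \<le> 0"
  shows "y \<in> left_perp {c + int n<..} \<Longrightarrow>
    \<exists>x z. x \<in> left_perp {c<..} \<and> z \<in> thick {c<..c + int n} \<and> y \<in> ext x z"
proof (induction n arbitrary: y)
  case 0
  then have "y \<in> Obj T"
    by (simp add: left_perp_def)
  moreover obtain z where "z \<in> zero_objects T"
    by (rule zero_ex)
  ultimately show ?case
    using 0 thick_zero ext_zero_right by fastforce
next
  case (Suc n)
  obtain x z where x: "x \<in> left_perp {c + int (Suc n)..}" "z \<in> thick {c + int (Suc n)}" "y \<in> ext x z"
    using kill_top[OF w Suc.prems] .
  have "{c + int (Suc n)..} = {c + int n<..}"
    by auto
  then obtain x' z' where x': "x' \<in> left_perp {c<..}" "z' \<in> thick {c<..c + int n}" "x \<in> ext x' z'"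
    using Suc.IH[of x] x(1) by auto
  obtain z'' where z'': "z'' \<in> ext z' z" "y \<in> ext x' z''"
    using x'(3) x(3) by (rule ext_assoc_right)
  have "z' \<in> thick {c<..c + int (Suc n)}" "z \<in> thick {c<..c + int (Suc n)}"
    by (rule thick_mono[OF x'(2)], force, rule thick_mono[OF x(2)], force)
  then show ?case
    using thick_ext z'' x'(1) by blast
qed

text \<open>Killing maps to \<sigma> i for \<open>i > c\<close> gives the triangle, but its left
  term is known only by orthogonality. To see that it is built from degrees up to \<open>c\<close>,
  the killing is continued below all of its degrees: what is left then has no maps to it, so it is a
  retract of the part removed.\<close>

lemma truncates_atMost:
  assumes w: "w \<le> 0"
  shows "truncates {..c}"
  unfolding truncates_def
proof (intro conjI ballI)
  fix x assume "x \<in> Obj T"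
  have bound: "\<exists>k. \<forall>k' \<ge> k. x \<in> thick {-k'..k'} \<and> x \<in> left_perp {k'<..}" if x: "x \<in> Obj T" for x
  proof -
    obtain k where k: "x \<in> thick {-k..k}"
      using obj_thick[OF x] .
    have "x \<in> left_perp {k'<..}" if "k' \<ge> k" for k'
    proof -
      have "van x (\<sigma> i)" if "i > k'" for i
        using w that \<open>k' \<ge> k\<close> by (intro van_thick[OF k thick_gen[of i "{i}"]]) auto
      then show ?thesis
        using x by (simp add: left_perp_def)
    qed
    moreover have "x \<in> thick {-k'..k'}" if "k' \<ge> k" for k'
      using thick_mono[OF k, of "{-k'..k'}"] that by simp
    ultimately show ?thesis
      by blast
  qed
  obtain k where "\<forall>k' \<ge> k. x \<in> left_perp {k'<..}"
    using bound[OF \<open>x \<in> Obj T\<close>] by blast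
  \<comment> \<open>\<open>nat\<close> truncates to 0 if \<open>k < c\<close>; in both cases the
    bound is \<open>max k c\<close>, which is at least \<open>k\<close>.\<close>
  then have "x \<in> left_perp {c + int (nat (k - c))<..}"
    by simp
  then obtain x' z where x': "x' \<in> left_perp {c<..}" "z \<in> thick {c<..c + int (nat (k - c))}" "x \<in> ext x' z"
    using kill_above[OF w] by blast
  have x'o: "x' \<in> Obj T"
    using x' by (simp add: left_perp_def)
  obtain l where l: "x' \<in> thick {-l..l}" "-l \<le> c"
  proof -
    obtain k where "\<forall>k' \<ge> k. x' \<in> thick {-k'..k'}"
      using bound[OF x'o] by blast
    then show ?thesis
      using that[of "max k (-c)"] by simp
  qed
  \<comment> \<open>One below the lowest degree -l, so that the degrees above \<open>c'\<close>
    include every factor of \<open>x'\<close>.\<close>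
  define c' where "c' = -l - 1"
  have "c' + int (nat (c - c')) = c"
    using l by (simp add: c'_def)
  then obtain x'' z' where x'': "x'' \<in> left_perp {c'<..}" "z' \<in> thick {c'<..c}" "x' \<in> ext x'' z'"
    using kill_above[OF w, of x' c' "nat (c - c')"] x'(1) by auto
  have "van x'' x'"
    by (rule van_thick_right[OF l(1)]) (use x''(1) in \<open>auto simp: left_perp_def c'_def\<close>)
  moreover obtain f g h where t: "tri f g h" "src f = x''" "tgt f = x'" "tgt g = z'"
    using x''(3) by (rule extE)
  ultimately have "f = Zero T (src f) (tgt f)"
    using triD[OF t(1)] by (intro vanD) auto
  then have "retract x' z'"
    using retract_van1[OF t(1)] t by simp
  moreover have "z' \<in> thick {..c}"
    by (rule thick_mono[OF x''(2)]) auto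
  ultimately have "x' \<in> thick {..c}"
    using thick_retract by blast
  moreover have "z \<in> thick (- {..c})"
    by (rule thick_mono[OF x'(2)]) auto
  ultimately show "\<exists>m \<in> thick {..c}. \<exists>n \<in> thick (- {..c}). x \<in> ext m n"
    using x'(3) by blast
next
  fix i j assume "i \<in> {..c}" "j \<in> - {..c}"
  then show "van (\<sigma> i) (\<sigma> j)"
    using w by (intro \<sigma>_van) auto
qed

lemma perp_atMost:
  assumes w: "w \<le> 0"
  shows "left_perp {c<..} = thick {..c}" "right_perp {..c} = thick {c<..}"
    "left_perp {c..} = thick {..<c}" "right_perp {..<c} = thick {c..}"
proof -
  have *: "- {..c} = {c<..}" for c :: int
    by auto
  show 1: "left_perp {c<..} = thick {..c}" "right_perp {..c} = thick {c<..}" for c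
    using thick_perp[OF truncates_atMost[OF w, of c]] unfolding * by auto
  have **: "{c - 1<..} = {c..}" "{..c - 1} = {..<c}"
    by auto
  show "left_perp {c..} = thick {..<c}" "right_perp {..<c} = thick {c..}"
    using 1[of "c - 1"] unfolding ** .
qed


text \<open>Repeatedly replacing an object by the fibre of a generator of \<open>Hom(-, \<sigma> q)\<close> stops one step
  before this module vanishes.\<close>

lemma reduce_left:
  assumes w: "w \<le> 0" and y: "y \<in> left_perp {q<..}" "\<not> van y (\<sigma> q)" and Q: "Q y"
    and step: "\<And>j u d. tri j u d \<Longrightarrow> tgt u = \<sigma> q \<Longrightarrow> tgt j \<in> left_perp {q<..} \<Longrightarrow> Q (tgt j) \<Longrightarrow> Q (src j)"
  obtains j u d where "tri j u d" "tgt u = \<sigma> q" "Q (tgt j)" "tgt j \<in> left_perp {q<..}"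
    "u \<noteq> Zero T (tgt j) (\<sigma> q)" "van (src j) (\<sigma> q)" "src j \<in> left_perp {q<..}"
proof -
  have yo: "y \<in> Obj T"
    using y by (simp add: left_perp_def)
  obtain L where "lgen y (\<sigma> q) L"
    using lgen_ex[OF yo] .
  then have "\<exists>j u d. tri j u d \<and> tgt u = \<sigma> q \<and> Q (tgt j) \<and> tgt j \<in> left_perp {q<..} \<and>
    u \<noteq> Zero T (tgt j) (\<sigma> q) \<and> van (src j) (\<sigma> q) \<and> src j \<in> left_perp {q<..}"
    using y Q
  proof (induction L arbitrary: y rule: length_induct)
    case (1 L)
    have yo: "y \<in> Obj T"
      using 1(3) by (simp add: left_perp_def)
    show ?case
    proof (cases L)
      case Nil
      then show ?thesis
        using 1 lgen_Nil by blast
    next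
      case (Cons u L')
      have u: "arr u" "src u = y" "tgt u = \<sigma> q"
        using 1(2) Cons by (auto simp: lgen_def hom_iff)
      show ?thesis
      \<comment> \<open>A zero generator is discarded, because the final triangle must come with a
        nonzero \<open>u\<close>.\<close>
      proof (cases "u = Zero T y (\<sigma> q)")
        case True
        then have "lgen y (\<sigma> q) L'"
          using 1(2) Cons yo lgen_drop_zero by auto
        then show ?thesis
          using 1(1)[rule_format, of L' y] 1(3-5) Cons by simp
      next
        case False
        obtain j d where t: "tri j u d"
          using tri_fibre_ex[OF u(1)] .
        have j: "tgt j = y"
          using triD[OF t] u by simp
        have p: "src j \<in> left_perp {q<..}"
          using fibre_left_perp[OF w t u(3)] 1(3) j by simp
        show ?thesis
        proof (cases "van (src j) (\<sigma> q)")
          case True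
          then show ?thesis
            using t u(3) j False p 1(3,5) by blast
        next
          case nv: False
          have "lgen (src j) (\<sigma> q) (map (\<lambda>v. v \<cdot> j) L')"
            using lgen_fibre[OF w t u(3)] 1(2) Cons j by simp
          moreover have "Q (src j)"
            using step[OF t u(3)] j 1(3,5) by simp
          ultimately show ?thesis
            using 1(1)[rule_format, of "map (\<lambda>v. v \<cdot> j) L'" "src j"] Cons nv p by simp
        qed
      qed
    qed
  qed
  then show ?thesis
    using that by blast
qed

text \<open>Dual to \<open>reduce_left\<close>. \<open>Q\<close> is an orthogonality property which
  the caller shows to survive the passage to the cone; it still holds for the object at which the
  reduction stops.\<close>

lemma reduce_right:
  assumes w: "w \<le> 0" and y: "y \<in> right_perp {..<q}" "\<not> van (\<sigma> q) y" and Q: "Q y"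
    and step: "\<And>f g h. tri f g h \<Longrightarrow> src f = \<sigma> q \<Longrightarrow> tgt f \<in> right_perp {..<q} \<Longrightarrow> Q (tgt f) \<Longrightarrow> Q (tgt g)"
  obtains f g h where "tri f g h" "src f = \<sigma> q" "Q (tgt f)" "tgt f \<in> right_perp {..<q}"
    "f \<noteq> Zero T (\<sigma> q) (tgt f)" "van (\<sigma> q) (tgt g)" "tgt g \<in> right_perp {..<q}"
proof -
  have yo: "y \<in> Obj T"
    using y by (simp add: right_perp_def)
  obtain L where "rgen (\<sigma> q) y L"
    using rgen_ex[OF yo] .
  then have "\<exists>f g h. tri f g h \<and> src f = \<sigma> q \<and> Q (tgt f) \<and> tgt f \<in> right_perp {..<q} \<and>
    f \<noteq> Zero T (\<sigma> q) (tgt f) \<and> van (\<sigma> q) (tgt g) \<and> tgt g \<in> right_perp {..<q}"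
    using y Q
  proof (induction L arbitrary: y rule: length_induct)
    case (1 L)
    have yo: "y \<in> Obj T"
      using 1(3) by (simp add: right_perp_def)
    show ?case
    proof (cases L)
      case Nil
      then show ?thesis
        using 1 rgen_Nil by blast
    next
      case (Cons f L')
      have f: "arr f" "src f = \<sigma> q" "tgt f = y"
        using 1(2) Cons by (auto simp: rgen_def hom_iff)
      show ?thesis
      proof (cases "f = Zero T (\<sigma> q) y")
        case True
        then have "rgen (\<sigma> q) y L'"
          using 1(2) Cons yo rgen_drop_zero by auto
        then show ?thesis
          using 1(1)[rule_format, of L' y] 1(3-5) Cons by simp
      next
        case False
        obtain g h where t: "tri f g h"
          using tri_cone_ex[OF f(1)] .
        have p: "tgt g \<in> right_perp {..<q}"
          using cone_right_perp[OF w t f(2)] 1(3) f by simp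
        show ?thesis
        proof (cases "van (\<sigma> q) (tgt g)")
          case True
          then show ?thesis
            using t f False p 1(3,5) by blast
        next
          case nv: False
          have "rgen (\<sigma> q) (tgt g) (map (\<lambda>v. g \<cdot> v) L')"
            using rgen_cone[OF w t f(2)] 1(2) Cons f by simp
          moreover have "Q (tgt g)"
            using step[OF t f(2)] f 1(3,5) by simp
          ultimately show ?thesis
            using 1(1)[rule_format, of "map (\<lambda>v. g \<cdot> v) L'" "tgt g"] Cons nv p by simp
        qed
      qed
    qed
  qed
  then show ?thesis
    using that by blast
qed

text \<open>A test for the vanishing of obstructions. Peel off the first factor \<sigma> j of
  \<open>x\<close>: the map vanishes on it, by degree if \<open>j > a\<close> and by assumption if
  \<open>j = a\<close>, so it comes from the rest \<open>x2\<close>. The assumption passes to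
  \<open>x2\<close> because maps \<sigma> a \<rightarrow> x2 lift to \<open>x\<close>, as
  Hom(\<sigma> a, \<Sigma> \<sigma> j) = 0 for \<open>j \<ge> a\<close>.\<close>

lemma detect_left:
  assumes w: "w \<le> 0" and y: "\<And>i. i > a \<Longrightarrow> van (\<sigma> i) y" and x: "x \<in> thick {a..}"
    and \<psi>: "arr \<psi>" "src \<psi> = x" "tgt \<psi> = y"
    and 0: "\<And>f. arr f \<Longrightarrow> src f = \<sigma> a \<Longrightarrow> tgt f = x \<Longrightarrow> \<psi> \<cdot> f = Zero T (\<sigma> a) y"
  shows "\<psi> = Zero T x y"
  using x \<psi> 0
proof (induction arbitrary: \<psi> rule: thick_induct)
  case (zero z)
  then show ?case
    using van_zero_left[of z y] by (auto intro: vanD)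
next
  case (step j x2 x)
  obtain f g h where t: "tri f g h" "src f = \<sigma> j" "tgt f = x" "tgt g = x2"
    using step.hyps(3) by (rule extE)
  note [simp] = triD[OF t(1)] t(2-4) step.prems(1-3)
  have o: "x2 \<in> Obj T" "y \<in> Obj T"
    using ext_obj step.hyps(3) tgt_obj[OF step.prems(1)] by auto
  have "\<psi> \<cdot> f = Zero T (src f) y"
  proof (cases "j = a")
    case True
    then show ?thesis
      using step.prems(4)[of f] by simp
  next
    case False
    then have "van (\<sigma> j) y"
      using step.hyps(1) y by auto
    then show ?thesis
      by (intro vanD) auto
  qed
  then obtain \<psi>2 where \<psi>2: "arr \<psi>2" "src \<psi>2 = x2" "tgt \<psi>2 = y" "\<psi>2 \<cdot> g = \<psi>"
    using extend1[OF t(1), of \<psi> y] by auto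
  have "\<psi>2 = Zero T x2 y"
  proof (rule step.IH[OF \<psi>2(1-3)])
    fix k assume k: "arr k" "src k = \<sigma> a" "tgt k = x2"
    have "van (\<sigma> a) (Sus T (src f))"
      using step.hyps(1) w by (simp add: van_\<sigma>_sus \<sigma>_van)
    then obtain l where l: "arr l" "src l = \<sigma> a" "tgt l = x" "g \<cdot> l = k"
      using lift_van[OF t(1), of "\<sigma> a" k] k by auto
    have "\<psi>2 \<cdot> k = \<psi> \<cdot> l"
      using assoc_eq[OF \<psi>2(4), of l] l \<psi>2(1-3) by simp
    then show "\<psi>2 \<cdot> k = Zero T (\<sigma> a) y"
      using step.prems(4)[OF l(1-3)] by simp
  qed
  then show ?case
    using \<psi>2(4) o by simp
next
  case (retract x x')
  obtain i p where ip: "arr i" "src i = x" "tgt i = x'" "arr p" "src p = x'" "tgt p = x" "p \<cdot> i = Id T x"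
    using retract.hyps by (rule retractE)
  note [simp] = ip(1-6) retract.prems(1-3)
  have "\<psi> \<cdot> p = Zero T x' y"
  proof (rule retract.IH)
    fix f assume f: "arr f" "src f = \<sigma> a" "tgt f = x'"
    then show "(\<psi> \<cdot> p) \<cdot> f = Zero T (\<sigma> a) y"
      using retract.prems(4)[of "p \<cdot> f"] by simp
  qed simp_all
  then have "(\<psi> \<cdot> p) \<cdot> i = Zero T x y"
    using tgt_obj[OF retract.prems(1)] by simp
  then show ?case
    using ip(7) by simp
qed

text \<open>The proof is not the mirror image of \<open>detect_left\<close>, as the first factor is
  peeled off here too: the component in the rest \<open>y2\<close> vanishes by induction, so the map
  comes from x \<rightarrow> \<sigma> j.\<close>

lemma detect_right:
  assumes w: "w \<le> 0" and x: "\<And>i. i < b \<Longrightarrow> van x (\<sigma> i)" and y: "y \<in> thick {..b}"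
    and \<psi>: "arr \<psi>" "src \<psi> = x" "tgt \<psi> = y"
    and 0: "\<And>r. arr r \<Longrightarrow> src r = y \<Longrightarrow> tgt r = \<sigma> b \<Longrightarrow> r \<cdot> \<psi> = Zero T x (\<sigma> b)"
  shows "\<psi> = Zero T x y"
  using y \<psi> 0
proof (induction arbitrary: \<psi> rule: thick_induct)
  case (zero z)
  then show ?case
    using van_zero_right[of z x] by (auto intro: vanD)
next
  case (step j y2 y)
  obtain f g h where t: "tri f g h" "src f = \<sigma> j" "tgt f = y" "tgt g = y2"
    using step.hyps(3) by (rule extE)
  note [simp] = triD[OF t(1)] t(2-4) step.prems(1-3)
  have o: "y2 \<in> Obj T" "x \<in> Obj T" "y \<in> Obj T"
    using ext_obj step.hyps(3) src_obj[OF step.prems(1)] by auto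
  have "g \<cdot> \<psi> = Zero T x y2"
  proof (rule step.IH)
    fix r assume r: "arr r" "src r = y2" "tgt r = \<sigma> b"
    then show "r \<cdot> (g \<cdot> \<psi>) = Zero T x (\<sigma> b)"
      using step.prems(4)[of "r \<cdot> g"] by simp
  qed simp_all
  then obtain \<psi>1 where \<psi>1: "arr \<psi>1" "src \<psi>1 = x" "tgt \<psi>1 = \<sigma> j" "f \<cdot> \<psi>1 = \<psi>"
    using lift1[OF t(1), of \<psi> x] by auto
  have "\<psi>1 = Zero T x (\<sigma> j)"
  proof (cases "j = b")
    case True
    \<comment> \<open>A first factor \<sigma> b splits off, because no degree of \<open>y2\<close>
      exceeds \<open>b\<close>; the retraction \<open>r\<close> is then a test map for
      \<psi>.\<close>
    have "van y2 (Sus T (\<sigma> b))"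
      using step.hyps(2) o unfolding perp_atMost(1)[OF w, of b, symmetric]
      by (simp add: van_\<sigma>_sus left_perp_def)
    then obtain r where r: "arr r" "src r = y" "tgt r = \<sigma> b" "r \<cdot> f = Id T (\<sigma> b)"
      using extend_van[OF t(1), of "\<sigma> b" "Id T (\<sigma> b)"] True by auto
    have "\<psi>1 = (r \<cdot> f) \<cdot> \<psi>1"
      unfolding r(4) using \<psi>1(1-3) True by simp
    also have "\<dots> = r \<cdot> \<psi>"
      unfolding \<psi>1(4)[symmetric] using \<psi>1(1-3) r(1-3) by simp
    also have "\<dots> = Zero T x (\<sigma> j)"
      using step.prems(4)[OF r(1-3)] True by simp
    finally show ?thesis .
  next
    case False
    then have "van x (\<sigma> j)"
      using step.hyps(1) x by auto
    then show ?thesis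
      using \<psi>1(1-3) by (rule vanD)
  qed
  then show ?case
    using \<psi>1(4) o by simp
next
  case (retract y y')
  obtain i p where ip: "arr i" "src i = y" "tgt i = y'" "arr p" "src p = y'" "tgt p = y" "p \<cdot> i = Id T y"
    using retract.hyps by (rule retractE)
  note [simp] = ip(1-6) retract.prems(1-3)
  have "i \<cdot> \<psi> = Zero T x y'"
  proof (rule retract.IH)
    fix r assume r: "arr r" "src r = y'" "tgt r = \<sigma> b"
    then show "r \<cdot> (i \<cdot> \<psi>) = Zero T x (\<sigma> b)"
      using retract.prems(4)[of "r \<cdot> i"] by simp
  qed simp_all
  then have "p \<cdot> (i \<cdot> \<psi>) = Zero T x y"
    using src_obj[OF retract.prems(1)] by simp
  then show ?case
    using assoc_eq[OF ip(7), of \<psi>] by simp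
qed

lemma sus_left_perp:
  assumes "van x (\<sigma> b)" "x \<in> left_perp {b<..}"
  shows "Sus T x \<in> left_perp {b<..}"
proof -
  have "van x (\<sigma> (i - 1))" if "i > b" for i
    using assms that by (cases "i = b + 1") (auto simp: left_perp_def)
  then show ?thesis
    using assms by (auto simp: left_perp_def van_sus_left)
qed

text \<open>Keeping Hom(m, n) = 0, both objects are reduced until the fibre of \<open>u\<close> has
  no maps to \<sigma> a and the cone of \<open>f\<close> has none from it. Since f u = 0,
  \<open>f\<close> factors through the suspended fibre, and that factorization in turn lifts along
  \<open>f\<close>, as nothing maps from degrees \<le> a to degrees > a.\<close>

lemma hom_top_nonpos:
  assumes w: "w \<le> 0" and m: "m \<in> left_perp {a<..}" "\<not> van m (\<sigma> a)"
    and n: "n \<in> right_perp {..<a}" "\<not> van (\<sigma> a) n"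
  shows "\<not> van m n"
proof
  assume "van m n"
  have no: "n \<in> Obj T"
    using n by (simp add: right_perp_def)
  obtain j u d where t: "tri j u d" "tgt u = \<sigma> a" and v: "van (tgt j) n" and m': "tgt j \<in> left_perp {a<..}"
    and u: "u \<noteq> Zero T (tgt j) (\<sigma> a)" and m1: "van (src j) (\<sigma> a)" "src j \<in> left_perp {a<..}"
  proof (rule reduce_left[OF w m, of "\<lambda>m. van m n"])
    show "van m n" by fact
    fix j u d assume t: "tri j u d" "tgt u = \<sigma> a" "tgt j \<in> left_perp {a<..}" "van (tgt j) n"
    note [simp] = triD[OF t(1)] t(2)
    have v: "van (tgt u) (Sus T n)"
      using n no by (simp add: van_sus_right right_perp_def)
    show "van (src j) n"
    proof (rule vanI)
      fix \<phi> assume "arr \<phi>" "src \<phi> = src j" "tgt \<phi> = n"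
      then obtain \<psi> where \<psi>: "arr \<psi>" "src \<psi> = tgt j" "tgt \<psi> = n" "\<psi> \<cdot> j = \<phi>"
        using extend_van[OF t(1) v] by auto
      have "\<psi> = Zero T (tgt j) n"
        using t(4) \<psi>(1-3) by (rule vanD)
      then show "\<phi> = Zero T (src j) n"
        using \<psi>(4) no by simp
    qed
  qed blast
  note [simp] = triD[OF t(1)] t(2)
  have m'o: "tgt j \<in> Obj T"
    by simp
  have Y: "Sus T (src j) \<in> thick {..a}"
    unfolding perp_atMost(1)[OF w, symmetric] using m1 by (intro sus_left_perp)
  obtain f g h where t': "tri f g h" "src f = \<sigma> a" and v': "van (tgt j) (tgt f)"
    and f: "f \<noteq> Zero T (\<sigma> a) (tgt f)" and n2: "van (\<sigma> a) (tgt g)" "tgt g \<in> right_perp {..<a}"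
  proof (rule reduce_right[OF w n, of "\<lambda>n. van (tgt j) n"])
    show "van (tgt j) n" by fact
    fix f g h assume t: "tri f g h" "src f = \<sigma> a" "tgt f \<in> right_perp {..<a}" "van (tgt j) (tgt f)"
    have 1: "arr f" "arr g" "arr h" "src g = tgt f"
      using triD[OF t(1)] by auto
    have v: "van (tgt j) (Sus T (src f))"
      using m' t(2) by (simp add: van_\<sigma>_sus left_perp_def)
    show "van (tgt j) (tgt g)"
    proof (rule vanI)
      fix \<phi> assume "arr \<phi>" "src \<phi> = tgt j" "tgt \<phi> = tgt g"
      then obtain \<psi> where \<psi>: "arr \<psi>" "src \<psi> = tgt j" "tgt \<psi> = tgt f" "g \<cdot> \<psi> = \<phi>"
        using lift_van[OF t(1) v] by auto
      have "\<psi> = Zero T (tgt j) (tgt f)"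
        using t(4) \<psi>(1-3) by (rule vanD)
      then show "\<phi> = Zero T (tgt j) (tgt g)"
        using \<psi>(4) 1 m'o by simp
    qed
  qed blast
  note [simp] = triD[OF t'(1)] t'(2)
  have "tgt g \<in> thick {a<..}"
    unfolding perp_atMost(2)[OF w, symmetric] right_perp_def
    using n2 by (auto simp: right_perp_def order_le_less)
  then have Yg: "van (Sus T (src j)) (tgt g)"
    using w by (intro van_thick[OF Y]) auto
  have "f \<cdot> u = Zero T (tgt j) (tgt f)"
    using v' by (intro vanD) auto
  then obtain \<phi> where \<phi>: "arr \<phi>" "src \<phi> = Sus T (src j)" "tgt \<phi> = tgt f" "\<phi> \<cdot> d = f"
    using extend2[OF t(1), of f "tgt f"] by auto
  have "g \<cdot> \<phi> = Zero T (Sus T (src j)) (tgt g)"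
    using Yg \<phi>(1-3) by (intro vanD) auto
  then obtain r where r: "arr r" "src r = Sus T (src j)" "tgt r = \<sigma> a" "f \<cdot> r = \<phi>"
    using lift1[OF t'(1), of \<phi> "Sus T (src j)"] \<phi>(1-3) by auto
  \<comment> \<open>f = f e, and e u = 0 makes \<open>?e\<close> a non-unit; then f = f e e =
    0.\<close>
  let ?e = "r \<cdot> d"
  have e: "arr ?e" "src ?e = \<sigma> a" "tgt ?e = \<sigma> a"
    using r(1-3) by simp_all
  have fe: "f \<cdot> ?e = f"
    using assoc_eq[OF r(4), of d] r(1-3) \<phi>(4) by simp
  have "?e \<cdot> u = r \<cdot> (d \<cdot> u)"
    using r(1-3) by simp
  also have "\<dots> = Zero T (tgt j) (\<sigma> a)"
    using r(1-3) tri_comp(2)[OF t(1)] by simp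
  finally have "\<not> iso ?e"
    using nonunit[OF e, of u "tgt j"] u by simp
  then have "?e \<cdot> ?e = Zero T (\<sigma> a) (\<sigma> a)"
    using e by (intro \<sigma>_local) (simp_all add: hom_iff)
  then have "f \<cdot> (?e \<cdot> ?e) = Zero T (\<sigma> a) (tgt f)"
    by simp
  moreover have "f \<cdot> (?e \<cdot> ?e) = f"
    using assoc_eq[OF fe _ _ _ e(1)] e fe by simp
  ultimately show False
    using f by simp
qed

text \<open>A nonzero \<theta> from \<sigma> a to \<open>y\<close> is extended along \<sigma> a
  \<rightarrow> x, after \<open>x\<close> has been reduced so that the cone lives in degrees > a.
  The obstruction, a map from this cone to \<Sigma> y, is tested by \<open>detect_left\<close> in
  degree \<open>a + 1\<close>, where it amounts to \<theta> e for endomorphisms e with f e =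
  0.\<close>

lemma hom_bottom_nonpos:
  assumes w: "w \<le> 0" and x: "x \<in> right_perp {..<a}" "\<not> van (\<sigma> a) x"
    and y: "y \<in> right_perp {a<..}" "\<not> van (\<sigma> a) y"
  shows "\<not> van x y"
proof
  assume "van x y"
  have yo: "y \<in> Obj T"
    using y by (simp add: right_perp_def)
  obtain f g h where t: "tri f g h" "src f = \<sigma> a" and v: "van (tgt f) y"
    and f: "f \<noteq> Zero T (\<sigma> a) (tgt f)" and x2: "van (\<sigma> a) (tgt g)" "tgt g \<in> right_perp {..<a}"
  proof (rule reduce_right[OF w x, of "\<lambda>x. van x y"])
    show "van x y" by fact
    fix f g h assume t: "tri f g h" "src f = \<sigma> a" "tgt f \<in> right_perp {..<a}" "van (tgt f) y"
    have v: "van (Sus T (src f)) y"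
      using y t(2) by (simp add: van_sus_\<sigma> right_perp_def)
    have "tgt g \<in> ext (tgt f) (Sus T (src f))"
      using extI[OF tri_rotD[OF t(1)]] triD[OF t(1)] by simp
    then show "van (tgt g) y"
      using t(4) v by (rule van_ext_obj_left)
  qed blast
  note [simp] = triD[OF t(1)] t(2)
  \<comment> \<open>\<theta> is chosen in the socle, so that every non-unit is killed by it; if some
    \<theta> e with a non-unit e is nonzero, it replaces \<theta>, since non-units multiply to
    zero.\<close>
  obtain \<theta> where \<theta>: "arr \<theta>" "src \<theta> = \<sigma> a" "tgt \<theta> = y" "\<theta> \<noteq> Zero T (\<sigma> a) y"
    and rad: "\<And>e. arr e \<Longrightarrow> src e = \<sigma> a \<Longrightarrow> tgt e = \<sigma> a \<Longrightarrow> \<not> iso e \<Longrightarrow> \<theta> \<cdot> e = Zero T (\<sigma> a) y"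
  proof -
    obtain \<theta> where \<theta>: "arr \<theta>" "src \<theta> = \<sigma> a" "tgt \<theta> = y" "\<theta> \<noteq> Zero T (\<sigma> a) y"
      using y(2) by (rule not_vanE)
    show ?thesis
    proof (cases "\<exists>e. arr e \<and> src e = \<sigma> a \<and> tgt e = \<sigma> a \<and> \<not> iso e \<and> \<theta> \<cdot> e \<noteq> Zero T (\<sigma> a) y")
      case True
      then obtain e where e: "arr e" "src e = \<sigma> a" "tgt e = \<sigma> a" "\<not> iso e" "\<theta> \<cdot> e \<noteq> Zero T (\<sigma> a) y"
        by blast
      show ?thesis
      proof (rule that[of "\<theta> \<cdot> e"])
        fix e' assume e': "arr e'" "src e' = \<sigma> a" "tgt e' = \<sigma> a" "\<not> iso e'"
        then have "e \<cdot> e' = Zero T (\<sigma> a) (\<sigma> a)"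
          using e by (intro \<sigma>_local) (simp_all add: hom_iff)
        then show "(\<theta> \<cdot> e) \<cdot> e' = Zero T (\<sigma> a) y"
          using e' e(1-3) \<theta>(1-3) by simp
      qed (use e \<theta> in simp_all)
    next
      case False
      then show ?thesis
        using that \<theta> by blast
    qed
  qed
  let ?\<kappa> = "SusM T \<theta> \<cdot> h"
  have "{a + 1..} = {a<..}"
    by auto
  moreover have "tgt g \<in> thick {a<..}"
    unfolding perp_atMost(2)[OF w, symmetric] right_perp_def
    using x2 by (auto simp: right_perp_def order_le_less)
  ultimately have x2t: "tgt g \<in> thick {a + 1..}"
    by simp
  have "?\<kappa> = Zero T (tgt g) (Sus T y)"
  proof (rule detect_left[OF w _ x2t])
    show "van (\<sigma> i) (Sus T y)" if "i > a + 1" for i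
      using that y yo by (simp add: van_sus_right right_perp_def)
    fix k assume k: "arr k" "src k = \<sigma> (a + 1)" "tgt k = tgt g"
    obtain \<alpha> where \<alpha>: "iso \<alpha>" "arr \<alpha>" "src \<alpha> = Sus T (\<sigma> a)" "tgt \<alpha> = \<sigma> (a + 1)"
      using \<sigma>_sus by (rule isomorphicE)
    \<comment> \<open>A map from \<sigma> (a + 1) to the cone, followed by \<open>h\<close>, is an
      endomorphism of \<sigma> a up to \<alpha> and suspension.\<close>
    obtain e where e: "arr e" "src e = \<sigma> a" "tgt e = \<sigma> a" "SusM T e = h \<cdot> (k \<cdot> \<alpha>)"
      using k \<alpha> by (auto intro: sus_full[of "h \<cdot> (k \<cdot> \<alpha>)" "\<sigma> a" "\<sigma> a"])
    have sfh: "SusM T f \<cdot> h = Zero T (tgt g) (Sus T (tgt f))"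
      by (rule neg_eq_zeroD) (use tri_comp(2)[OF tri_rotD[OF t(1)]] in simp_all)
    have "SusM T (f \<cdot> e) = SusM T f \<cdot> (h \<cdot> (k \<cdot> \<alpha>))"
      using e by simp
    also have "\<dots> = Zero T (Sus T (\<sigma> a)) (Sus T (tgt f))"
      using assoc_eq[OF sfh, of "k \<cdot> \<alpha>"] k \<alpha> by simp
    finally have "f \<cdot> e = Zero T (\<sigma> a) (tgt f)"
      by (rule sus_zeroD) (use e(1-3) in simp_all)
    then have "\<not> iso e"
      using nonunit'[of e a f "tgt f"] e(1-3) f by simp
    then have \<theta>e: "\<theta> \<cdot> e = Zero T (\<sigma> a) y"
      using rad e(1-3) by simp
    have "(?\<kappa> \<cdot> k) \<cdot> \<alpha> = SusM T \<theta> \<cdot> SusM T e"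
      unfolding e(4) using k \<alpha> \<theta>(1-3) by simp
    also have "\<dots> = SusM T (\<theta> \<cdot> e)"
      using e(1-3) \<theta>(1-3) by simp
    also have "\<dots> = Zero T (Sus T (\<sigma> a)) (Sus T y)"
      unfolding \<theta>e using yo by simp
    finally have "?\<kappa> \<cdot> k = Zero T (tgt \<alpha>) (Sus T y)"
      by (rule iso_right_cancel[OF \<alpha>(1)]) (use k \<alpha> \<theta>(1-3) in simp_all)
    then show "?\<kappa> \<cdot> k = Zero T (\<sigma> (a + 1)) (Sus T y)"
      using \<alpha> by simp
  qed (use \<theta>(1-3) in simp_all)
  then obtain \<psi> where \<psi>: "arr \<psi>" "src \<psi> = Sus T (tgt f)" "tgt \<psi> = Sus T y" "\<psi> \<cdot> SusM T f = SusM T \<theta>"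
    using extend3[OF t(1), of "SusM T \<theta>" "Sus T y"] \<theta>(1-3) by auto
  have "van (Sus T (tgt f)) (Sus T y)"
    using v yo by (simp add: van_sus)
  then have "\<psi> = Zero T (Sus T (tgt f)) (Sus T y)"
    using \<psi>(1-3) by (rule vanD)
  then have "SusM T \<theta> = Zero T (Sus T (\<sigma> a)) (Sus T y)"
    using \<psi>(4) yo by simp
  then show False
    using sus_zeroD[of \<theta> "\<sigma> a" y] \<theta> by simp
qed

text \<open>A fragment of Serre duality between Hom(y, \<sigma> b) and Hom(\<sigma> (b - w), y): in
  the top degree, nonvanishing is transferred. The nonzero X from \<sigma> (b - w) to \<sigma> b
  lifts along \<open>u\<close>, because the obstruction is detected by composites r d X in which r d
  is a non-unit, and non-units annihilate X.\<close>

lemma top_dual_nonpos: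
  assumes w: "w \<le> 0" and y: "y \<in> left_perp {b<..}" "\<not> van y (\<sigma> b)"
  shows "\<not> van (\<sigma> (b - w)) y"
proof
  let ?a = "b - w"
  assume "van (\<sigma> ?a) y"
  obtain j u d where t: "tri j u d" "tgt u = \<sigma> b" and v: "van (\<sigma> ?a) (tgt j)"
    and u: "u \<noteq> Zero T (tgt j) (\<sigma> b)" and y1: "van (src j) (\<sigma> b)" "src j \<in> left_perp {b<..}"
  proof (rule reduce_left[OF w y, of "\<lambda>y. van (\<sigma> ?a) y"])
    show "van (\<sigma> ?a) y" by fact
    fix j u d assume t: "tri j u d" "tgt u = \<sigma> b" "tgt j \<in> left_perp {b<..}" "van (\<sigma> ?a) (tgt j)"
    note [simp] = triD[OF t(1)] t(2)
    have 1: "van (Sus T (\<sigma> ?a)) (tgt u)"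
      using w by (simp add: van_sus_\<sigma> \<sigma>_van)
    show "van (\<sigma> ?a) (src j)"
    proof (rule vanI)
      fix \<phi> assume \<phi>: "arr \<phi>" "src \<phi> = \<sigma> ?a" "tgt \<phi> = src j"
      have "j \<cdot> \<phi> = Zero T (\<sigma> ?a) (tgt j)"
        using t(4) \<phi> by (intro vanD) auto
      then show "\<phi> = Zero T (\<sigma> ?a) (src j)"
        by (rule mono_van[OF t(1) 1 \<phi>])
    qed
  qed blast
  note [simp] = triD[OF t(1)] t(2)
  have Y: "Sus T (src j) \<in> thick {..b}"
    unfolding perp_atMost(1)[OF w, symmetric] using y1 by (intro sus_left_perp)
  obtain X where X: "arr X" "src X = \<sigma> ?a" "tgt X = \<sigma> b" "X \<noteq> Zero T (\<sigma> ?a) (\<sigma> b)" "w = 0 \<longrightarrow> \<not> iso X"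
    using \<sigma>_top[of ?a] by (auto simp: hom_iff)
  have "d \<cdot> X = Zero T (\<sigma> ?a) (Sus T (src j))"
  proof (rule detect_right[OF w _ Y])
    show "van (\<sigma> ?a) (\<sigma> i)" if "i < b" for i
      using that w by (intro \<sigma>_van) auto
    fix r assume r: "arr r" "src r = Sus T (src j)" "tgt r = \<sigma> b"
    have "(r \<cdot> d) \<cdot> u = Zero T (tgt j) (\<sigma> b)"
      using r tri_comp(2)[OF t(1)] by simp
    then have e: "\<not> iso (r \<cdot> d)"
      using nonunit[of "r \<cdot> d" b u "tgt j"] u r by simp
    have "(r \<cdot> d) \<cdot> X = Zero T (\<sigma> ?a) (\<sigma> b)"
    proof (cases "w = 0")
      case True
      then have "(r \<cdot> d) \<cdot> X = Zero T (\<sigma> b) (\<sigma> b)"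
        using e X r by (intro \<sigma>_local) (simp_all add: hom_iff)
      then show ?thesis
        using True by simp
    next
      case False
      then have "r \<cdot> d = Zero T (\<sigma> b) (\<sigma> b)"
        using e r by (intro \<sigma>_division) (simp_all add: hom_iff)
      then show ?thesis
        using X by simp
    qed
    then show "r \<cdot> (d \<cdot> X) = Zero T (\<sigma> ?a) (\<sigma> b)"
      using r X by simp
  qed (use X in simp_all)
  then obtain \<phi> where \<phi>: "arr \<phi>" "src \<phi> = \<sigma> ?a" "tgt \<phi> = tgt j" "u \<cdot> \<phi> = X"
    using lift2[OF t(1), of X "\<sigma> ?a"] X by auto
  have "\<phi> = Zero T (\<sigma> ?a) (tgt j)"
    using v \<phi>(1-3) by (rule vanD)
  then show False
    using \<phi>(4) X by simp
qed

end

section \<open>Torsion pairs\<close>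

lemma int_least:
  fixes P :: "int \<Rightarrow> bool"
  assumes "P i" and "\<And>i. P i \<Longrightarrow> k \<le> i"
  obtains a where "P a" "\<And>i. P i \<Longrightarrow> a \<le> i"
proof -
  have "\<exists>a. P a \<and> (\<forall>i. P i \<longrightarrow> a \<le> i)"
    using assms(1)
  proof (induction "nat (i - k)" arbitrary: i rule: less_induct)
    case less
    show ?case
    proof (cases "\<exists>j < i. P j")
      case True
      then obtain j where "j < i" "P j" by blast
      then show ?thesis
        using less.hyps[of j] assms(2)[of j] by auto
    next
      case False
      then show ?thesis
        using less.prems by (meson linorder_not_less)
    qed
  qed
  then show ?thesis
    using that by blast
qed

lemma int_greatest:
  fixes P :: "int \<Rightarrow> bool"
  assumes "P i" and "\<And>i. P i \<Longrightarrow> i \<le> k"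
  obtains a where "P a" "\<And>i. P i \<Longrightarrow> i \<le> a"
proof -
  obtain a where a: "P (- a)" "\<And>i. P (- i) \<Longrightarrow> a \<le> i"
  proof (rule int_least[of "\<lambda>i. P (- i)" "- i" "- k"])
    show "P (- (- i))"
      using assms(1) by simp
    show "- k \<le> i" if "P (- i)" for i
      using assms(2)[OF that] by simp
  qed blast
  show ?thesis
  proof (rule that[OF a(1)])
    fix i assume "P i"
    then show "i \<le> - a"
      using a(2)[of "- i"] by simp
  qed
qed

lemma int_cut:
  fixes P Q :: "int \<Rightarrow> bool"
  assumes "P i" "Q j" "\<And>i j. P i \<Longrightarrow> Q j \<Longrightarrow> j < i"
  obtains c where "\<And>i. P i \<Longrightarrow> c \<le> i" "\<And>j. Q j \<Longrightarrow> j < c"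
proof -
  obtain c where "P c" "\<And>i. P i \<Longrightarrow> c \<le> i"
    using int_least[of P i j] assms by (metis order_less_imp_le)
  with assms(3) that show ?thesis
    by blast
qed

context triangulated_category
begin

lemma van_direct_sum:
  assumes "direct_sum T a b c"
  shows "van a y \<Longrightarrow> van b y \<Longrightarrow> van c y" "van y a \<Longrightarrow> van y b \<Longrightarrow> van y c"
proof -
  obtain i p j q where ip: "arr i" "src i = a" "tgt i = c" "arr p" "src p = c" "tgt p = a"
    "arr j" "src j = b" "tgt j = c" "arr q" "src q = c" "tgt q = b" "i \<cdot> p \<oplus> j \<cdot> q = Id T c"
    using assms by (auto simp: direct_sum_def is_biproduct_def hom_iff)
  note [simp] = ip(1-12)
  have o: "a \<in> Obj T" "b \<in> Obj T" "c \<in> Obj T"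
    using src_obj[OF ip(1)] src_obj[OF ip(7)] src_obj[OF ip(4)] by simp_all
  note [simp] = o
  show "van c y" if v: "van a y" "van b y"
  proof (rule vanI)
    fix f assume f: "arr f" "src f = c" "tgt f = y"
    have y: "y \<in> Obj T"
      using f by auto
    have "f \<cdot> i = Zero T a y" "f \<cdot> j = Zero T b y"
      using v f by (auto intro: vanD)
    then have "(f \<cdot> i) \<cdot> p \<oplus> (f \<cdot> j) \<cdot> q = Zero T c y"
      using y by simp
    moreover have "f \<cdot> (i \<cdot> p \<oplus> j \<cdot> q) = (f \<cdot> i) \<cdot> p \<oplus> (f \<cdot> j) \<cdot> q"
      using f by simp
    ultimately show "f = Zero T c y"
      unfolding ip(13) using f by simp
  qed
  show "van y c" if v: "van y a" "van y b"
  proof (rule vanI)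
    fix f assume f: "arr f" "src f = y" "tgt f = c"
    have y: "y \<in> Obj T"
      using f by auto
    have "p \<cdot> f = Zero T y a" "q \<cdot> f = Zero T y b"
      using v f by (auto intro: vanD)
    then have "i \<cdot> (p \<cdot> f) \<oplus> j \<cdot> (q \<cdot> f) = Zero T y c"
      using y by simp
    moreover have "(i \<cdot> p \<oplus> j \<cdot> q) \<cdot> f = i \<cdot> (p \<cdot> f) \<oplus> j \<cdot> (q \<cdot> f)"
      using f by (subst add_comp) simp_all
    ultimately show "f = Zero T y c"
      unfolding ip(13) using f by simp
  qed
qed

text \<open>Splitting the idempotent i p gives a summand that need not be \<open>x\<close> itself,
  but its complement serves for \<open>x\<close> too: i p = i' p' transfers the orthogonality
  relations.\<close>

lemma retract_direct_summand:
  assumes "idempotent_complete T" "retract x m"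
  shows "direct_summand T x m"
proof -
  obtain i p where i: "arr i" "src i = x" "tgt i = m" and p: "arr p" "src p = m" "tgt p = x"
    and pi: "p \<cdot> i = Id T x"
    using assms(2) by (rule retractE)
  note [simp] = i p
  have o: "x \<in> Obj T" "m \<in> Obj T"
    using retract_obj assms(2) by blast+
  have "(i \<cdot> p) \<cdot> (i \<cdot> p) = i \<cdot> p"
    using assoc_eq[OF pi, of p] by simp
  moreover have "i \<cdot> p \<in> Hom T m m"
    by (simp add: hom_iff)
  ultimately obtain b i' p' where "summand_via T b m i' p'" and e: "i \<cdot> p = i' \<cdot> p'"
    using assms(1) o unfolding idempotent_complete_def by blast
  then obtain c j q where i': "arr i'" "src i' = b" "tgt i' = m" and p': "arr p'" "src p' = m" "tgt p' = b"
    and j: "arr j" "src j = c" "tgt j = m" and q: "arr q" "src q = m" "tgt q = c"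
    and bp: "q \<cdot> j = Id T c" "q \<cdot> i' = Zero T b c" "p' \<cdot> j = Zero T c b"
      "i' \<cdot> p' \<oplus> j \<cdot> q = Id T m"
    by (auto simp: summand_via_def is_biproduct_def hom_iff)
  note [simp] = i' p' j q
  have co: "c \<in> Obj T"
    using src_obj[OF j(1)] by simp
  have "q \<cdot> i = q \<cdot> (i \<cdot> (p \<cdot> i))"
    unfolding pi by simp
  also have "\<dots> = (q \<cdot> i') \<cdot> (p' \<cdot> i)"
    using assoc_eq[OF e, of i] by simp
  also have "\<dots> = Zero T x c"
    unfolding bp(2) using co by simp
  finally have 1: "q \<cdot> i = Zero T x c" .
  have "p \<cdot> j = ((p \<cdot> i) \<cdot> p) \<cdot> j"
    unfolding pi by simp
  also have "\<dots> = (p \<cdot> i') \<cdot> (p' \<cdot> j)"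
    using assoc_eq[OF e, of j] by simp
  also have "\<dots> = Zero T c x"
    unfolding bp(3) using co by simp
  finally have 2: "p \<cdot> j = Zero T c x" .
  have "is_biproduct T x c m i p j q"
    unfolding is_biproduct_def using pi bp(1) 1 2 e bp(4) by (simp add: hom_iff)
  then show ?thesis
    unfolding direct_summand_def summand_via_def by blast
qed

lemma torsion_pairD:
  assumes "torsion_pair T M N"
  shows "m \<in> M \<Longrightarrow> m \<in> Obj T" "n \<in> N \<Longrightarrow> n \<in> Obj T" "m \<in> M \<Longrightarrow> n \<in> N \<Longrightarrow> van m n"
proof -
  have "M \<subseteq> Obj T" "N \<subseteq> Obj T" and v: "\<forall>m \<in> M. \<forall>n \<in> N. Hom T m n = {Zero T m n}"
    using assms unfolding torsion_pair_def by blast+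
  then show "m \<in> M \<Longrightarrow> m \<in> Obj T" "n \<in> N \<Longrightarrow> n \<in> Obj T"
    by blast+
  show "van m n" if "m \<in> M" "n \<in> N"
    using v[rule_format, OF that] unfolding van_def by simp
qed

lemma torsion_pair_tri:
  assumes "torsion_pair T M N" "x \<in> Obj T"
  obtains f g h where "tri f g h" "src f \<in> M" "tgt f = x" "tgt g \<in> N"
proof -
  have "\<forall>s \<in> Obj T. \<exists>m \<in> M. \<exists>n \<in> N. \<exists>f g h. tri f g h \<and> src f = m \<and> tgt f = s \<and> tgt g = n"
    using assms(1) unfolding torsion_pair_def tri_iff by (elim conjE)
  then show ?thesis
    using assms(2) that by blast
qed

lemma torsion_pair_retract:
  assumes "torsion_pair T M N" "idempotent_complete T"
  shows "m \<in> M \<Longrightarrow> retract x m \<Longrightarrow> x \<in> M" "n \<in> N \<Longrightarrow> retract x n \<Longrightarrow> x \<in> N"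
  using assms retract_direct_summand unfolding torsion_pair_def by blast+

text \<open>An object of M' has no nonzero maps to its truncation in N \<subseteq> N', so it is a
  retract of its truncation in M; dually for N'. Hence bounding both halves of a structure is enough
  to identify it.\<close>

lemma torsion_pair_eqI:
  assumes tp: "torsion_pair T M N" and tp': "torsion_pair T M' N'" and ic: "idempotent_complete T"
    and sub: "M \<subseteq> M'" "N \<subseteq> N'"
  shows "M = M' \<and> N = N'"
proof -
  have "x \<in> M" if x: "x \<in> M'" for x
  proof -
    obtain f g h where t: "tri f g h" "src f \<in> M" "tgt f = x" "tgt g \<in> N"
      using torsion_pair_tri[OF tp] torsion_pairD(1)[OF tp' x] .
    have "van x (tgt g)"
      using torsion_pairD(3)[OF tp' x] t sub by blast
    then have "g = Zero T (tgt f) (tgt g)"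
      using t triD[OF t(1)] by (intro vanD) auto
    then show ?thesis
      using retract_van3[OF t(1)] t torsion_pair_retract[OF tp ic] by blast
  qed
  moreover have "x \<in> N" if x: "x \<in> N'" for x
  proof -
    obtain f g h where t: "tri f g h" "src f \<in> M" "tgt f = x" "tgt g \<in> N"
      using torsion_pair_tri[OF tp] torsion_pairD(2)[OF tp' x] .
    have "van (src f) x"
      using torsion_pairD(3)[OF tp' _ x] t sub by blast
    then have "f = Zero T (src f) (tgt f)"
      using t triD[OF t(1)] by (intro vanD) auto
    then show ?thesis
      using retract_van1[OF t(1)] t torsion_pair_retract[OF tp ic] by blast
  qed
  ultimately show ?thesis
    using sub by blast
qed

lemma torsion_pair_trivial:
  assumes tp: "torsion_pair T M N" and ic: "idempotent_complete T"
    and z: "M \<subseteq> zero_objects T \<or> N \<subseteq> zero_objects T"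
  shows "trivial_pair T M N"
proof -
  obtain x where x: "x \<in> zero_objects T"
    by (rule zero_ex)
  obtain f g h where t: "tri f g h" "src f \<in> M" "tgt f = x" "tgt g \<in> N"
    using torsion_pair_tri[OF tp, of x] x by auto
  have zM: "zero_objects T \<subseteq> M"
    using torsion_pair_retract(1)[OF tp ic t(2)] torsion_pairD(1)[OF tp t(2)] zero_retract by blast
  have zN: "zero_objects T \<subseteq> N"
    using torsion_pair_retract(2)[OF tp ic t(4)] torsion_pairD(2)[OF tp t(4)] zero_retract by blast
  show ?thesis
    using z
  proof
    assume M: "M \<subseteq> zero_objects T"
    have "y \<in> N" if y: "y \<in> Obj T" for y
    proof -
      obtain f g h where t: "tri f g h" "src f \<in> M" "tgt f = y" "tgt g \<in> N"
        using torsion_pair_tri[OF tp y] .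
      have "f = Zero T (src f) (tgt f)"
        using van_zero_left t M triD[OF t(1)] by (intro vanD[of "src f" "tgt f"]) auto
      then show ?thesis
        using retract_van1[OF t(1)] t torsion_pair_retract[OF tp ic] by blast
    qed
    then show ?thesis
      using M zM torsion_pairD(2)[OF tp] by (auto simp: trivial_pair_def)
  next
    assume N: "N \<subseteq> zero_objects T"
    have "y \<in> M" if y: "y \<in> Obj T" for y
    proof -
      obtain f g h where t: "tri f g h" "src f \<in> M" "tgt f = y" "tgt g \<in> N"
        using torsion_pair_tri[OF tp y] .
      have "g = Zero T (tgt f) (tgt g)"
        using van_zero_right t N triD[OF t(1)] by (intro vanD[of "tgt f" "tgt g"]) auto
      then show ?thesis
        using retract_van3[OF t(1)] t torsion_pair_retract[OF tp ic] by blast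
    qed
    then show ?thesis
      using N zN torsion_pairD(1)[OF tp] by (auto simp: trivial_pair_def)
  qed
qed

section \<open>Iterated shifts of subcategories\<close>

lemma shift_one:
  assumes "shift T 1 M \<subseteq> M" "M \<subseteq> Obj T" "m \<in> M"
  shows "(Sus T ^^ k) m \<in> M"
proof (induction k)
  case (Suc k)
  then have "(Sus T ^^ k) m \<in> Obj T"
    using assms(2) by blast
  then have "Sus T ((Sus T ^^ k) m) \<in> shift T 1 M"
    using Suc isomorphic_refl[of "Sus T ((Sus T ^^ k) m)"] by (auto simp: shift_def)
  then show ?case
    using assms(1) by auto
qed (use assms in simp)

lemma sus_pow_obj [simp]: "x \<in> Obj T \<Longrightarrow> (Sus T ^^ k) x \<in> Obj T"
  by (induction k) auto

lemma sus_pow_surj: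
  assumes "x \<in> Obj T"
  shows "\<exists>m \<in> Obj T. isomorphic T ((Sus T ^^ k) m) x"
proof (induction k)
  case 0
  then show ?case
    using assms isomorphic_refl by auto
next
  case (Suc k)
  then obtain m where m: "m \<in> Obj T" "isomorphic T ((Sus T ^^ k) m) x"
    by blast
  obtain m' \<theta> where m': "m' \<in> Obj T" "iso \<theta>" "arr \<theta>" "src \<theta> = Sus T m'" "tgt \<theta> = m"
    using m(1) by (rule sus_surj)
  have *: "isomorphic T ((Sus T ^^ k) a) ((Sus T ^^ k) b)" if "isomorphic T a b" for a b
    using that isomorphic_obj by (induction k) (auto simp: isomorphic_sus)
  have "isomorphic T ((Sus T ^^ k) (Sus T m')) ((Sus T ^^ k) m)"
    using m' by (intro * isomorphicI)
  then show ?case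
    using m m'(1) isomorphic_trans by (auto simp flip: funpow_swap1 simp: funpow_Suc_right simp del: funpow.simps)
qed

text \<open>Desuspensions exist only up to isomorphism, so closure under them is used in the form
  that every object of \<open>M\<close> is isomorphic to a \<open>k\<close>-fold suspension of an
  object of \<open>M\<close>.\<close>

lemma shift_minus_one:
  assumes "shift T (- 1) M \<subseteq> M" "M \<subseteq> Obj T" "m \<in> M"
  obtains x where "x \<in> M" "isomorphic T ((Sus T ^^ k) x) m"
proof -
  have "\<exists>x \<in> M. isomorphic T ((Sus T ^^ k) x) m"
  proof (induction k)
    case 0
    then show ?case
      using assms isomorphic_refl by auto
  next
    case (Suc k)
    then obtain x where x: "x \<in> M" "isomorphic T ((Sus T ^^ k) x) m"
      by blast
    have xo: "x \<in> Obj T"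
      using x assms(2) by blast
    obtain y \<theta> where y: "y \<in> Obj T" "iso \<theta>" "arr \<theta>" "src \<theta> = Sus T y" "tgt \<theta> = x"
      using xo by (rule sus_surj)
    have i: "isomorphic T (Sus T y) x"
      using y by (intro isomorphicI[of \<theta>])
    then have "y \<in> shift T (- 1) M"
      using x(1) y(1) by (auto simp: shift_def)
    moreover have "isomorphic T ((Sus T ^^ k) a) ((Sus T ^^ k) b)" if "isomorphic T a b" for a b
      using that isomorphic_obj by (induction k) (auto simp: isomorphic_sus)
    then have "isomorphic T ((Sus T ^^ k) (Sus T y)) m"
      using i x(2) isomorphic_trans by blast
    ultimately show ?case
      using assms(1) by (auto simp: funpow_Suc_right simp del: funpow.simps)
  qed
  then show ?thesis
    using that by blast
qed

end

context spherical_sequence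
begin

lemma thick_sus_pow: "x \<in> thick J \<Longrightarrow> (Sus T ^^ k) x \<in> thick ((\<lambda>j. j + int k) ` J)"
proof (induction k)
  case (Suc k)
  then have "Sus T ((Sus T ^^ k) x) \<in> thick ((\<lambda>j. j + 1) ` (\<lambda>j. j + int k) ` J)"
    by (intro thick_sus) simp
  then show ?case
    by (simp add: image_image algebra_simps)
qed simp

lemma thick_desus_pow: "(Sus T ^^ k) x \<in> thick J \<Longrightarrow> x \<in> Obj T \<Longrightarrow> x \<in> thick ((\<lambda>j. j - int k) ` J)"
proof (induction k arbitrary: J)
  case (Suc k)
  then have "(Sus T ^^ k) x \<in> thick ((\<lambda>j. j - 1) ` J)"
    using thick_desus[of "(Sus T ^^ k) x" J] by simp
  then show ?case
    using Suc.IH Suc.prems(2) by (force simp: image_image algebra_simps)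
qed simp

text \<open>Both signs of \<open>i\<close> are treated at once: of \<open>nat i\<close> and
  \<open>nat (- i)\<close> at most one is nonzero, and their difference is \<open>i\<close>.\<close>

lemma shift_thick: "shift T i (thick A) = thick ((\<lambda>j. j + i) ` A)"
proof (intro equalityI subsetI)
  fix x assume "x \<in> shift T i (thick A)"
  then obtain m where x: "x \<in> Obj T" and m: "m \<in> thick A"
    and iso: "isomorphic T ((Sus T ^^ nat (- i)) x) ((Sus T ^^ nat i) m)"
    by (auto simp: shift_def)
  have "(Sus T ^^ nat (- i)) x \<in> thick ((\<lambda>j. j + int (nat i)) ` A)"
    using thick_retract[OF thick_sus_pow[OF m]] isomorphic_retract(1)[OF iso] by blast
  then have "x \<in> thick ((\<lambda>j. j - int (nat (- i))) ` (\<lambda>j. j + int (nat i)) ` A)"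
    using x by (rule thick_desus_pow)
  moreover have "j + int (nat i) - int (nat (- i)) = j + i" for j
    by auto
  ultimately show "x \<in> thick ((\<lambda>j. j + i) ` A)"
    by (simp only: image_image)
next
  fix x assume x: "x \<in> thick ((\<lambda>j. j + i) ` A)"
  then have xo: "x \<in> Obj T"
    by (rule thick_obj)
  obtain m where m: "m \<in> Obj T" "isomorphic T ((Sus T ^^ nat i) m) ((Sus T ^^ nat (- i)) x)"
    using sus_pow_surj[of "(Sus T ^^ nat (- i)) x" "nat i"] xo by auto
  have "(Sus T ^^ nat i) m \<in> thick ((\<lambda>j. j + int (nat (- i))) ` (\<lambda>j. j + i) ` A)"
    using thick_retract[OF thick_sus_pow[OF x]] isomorphic_retract(1)[OF m(2)] by blast
  then have "m \<in> thick ((\<lambda>j. j - int (nat i)) ` (\<lambda>j. j + int (nat (- i))) ` (\<lambda>j. j + i) ` A)"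
    using m(1) by (rule thick_desus_pow)
  moreover have "j + i + int (nat (- i)) - int (nat i) = j" for j
    by auto
  ultimately have "m \<in> thick A"
    by (simp only: image_image image_ident)
  then show "x \<in> shift T i (thick A)"
    using xo isomorphic_sym[OF m(2)] by (auto simp: shift_def)
qed

text \<open>Closure under direct sums is clear for orthogonals, hence for both halves by
  \<open>thick_perp\<close>.\<close>

lemma truncates_torsion_pair:
  assumes A: "truncates A"
  shows "torsion_pair T (thick A) (thick (- A))"
proof -
  note p = thick_perp[OF A]
  have o: "c \<in> Obj T" if "direct_sum T a b c" for a b c
    using that hom_obj by (auto simp: direct_sum_def is_biproduct_def)
  have 1: "c \<in> thick A" if "a \<in> thick A" "b \<in> thick A" "direct_sum T a b c" for a b c
    using that o van_direct_sum(1)[OF that(3)] unfolding p by (auto simp: left_perp_def)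
  have 2: "c \<in> thick (- A)" if "a \<in> thick (- A)" "b \<in> thick (- A)" "direct_sum T a b c" for a b c
    using that o van_direct_sum(2)[OF that(3)] unfolding p by (auto simp: right_perp_def)
  have 3: "van m n" if "m \<in> thick A" "n \<in> thick (- A)" for m n
  proof (rule van_thick_right[OF that(2)])
    show "van m (\<sigma> j)" if "j \<in> - A" for j
      using \<open>m \<in> thick A\<close> that unfolding p(1) left_perp_def by blast
  qed
  have 4: "Hom T m n = {Zero T m n}" if "m \<in> thick A" "n \<in> thick (- A)" for m n
    using 3[OF that] zero_hom[OF thick_obj[OF that(1)] thick_obj[OF that(2)]] unfolding van_def by blast
  have 5: "\<exists>m \<in> thick A. \<exists>n \<in> thick (- A). \<exists>f g h. candidate_triangle T m s n f g h \<and> (f, g, h) \<in> Tri T"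
    if s: "s \<in> Obj T" for s
  proof -
    obtain m n where "m \<in> thick A" "n \<in> thick (- A)" "s \<in> ext m n"
      using A s unfolding truncates_def by blast
    then show ?thesis
      unfolding tri_iff ext_def by blast
  qed
  have 6: "b \<in> thick J" if "a \<in> thick J" "direct_summand T b a" for a b J
    using that thick_retract direct_summand_retract by blast
  have 7: "thick J \<subseteq> Obj T" for J
    using thick_obj by blast
  show ?thesis
    unfolding torsion_pair_def
    by (intro conjI ballI allI impI; (rule 7 | rule 4; assumption | rule 5; assumption |
          rule 1; assumption | rule 2; assumption | rule 6; assumption))
qed

lemma torsion_pair_atLeast: "w \<ge> 1 \<Longrightarrow> torsion_pair T (thick {c..}) (thick {..<c})"
  using truncates_torsion_pair[OF truncates_atLeast, of c] by (simp add: Compl_atLeast)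

lemma torsion_pair_atMost: "w \<le> 0 \<Longrightarrow> torsion_pair T (thick {..c}) (thick {c<..})"
  using truncates_torsion_pair[OF truncates_atMost, of c] by (simp add: Compl_atMost)

lemma nontrivial_thick:
  assumes "i \<in> A" "j \<in> B"
  shows "\<not> trivial_pair T (thick A) (thick B)"
  using assms thick_gen \<sigma>_nonzero unfolding trivial_pair_def by blast

lemma bounded_hom:
  assumes "x \<in> Obj T"
  obtains k where "\<And>i. \<not> van x (\<sigma> i) \<Longrightarrow> - k \<le> i \<and> i \<le> k" "\<And>i. \<not> van (\<sigma> i) x \<Longrightarrow> - k \<le> i \<and> i \<le> k"
proof -
  obtain n where n: "x \<in> thick {-n..n}"
    using obj_thick[OF assms] .
  \<comment> \<open>A factor of degree j has maps to and from degrees at distance 0 or |w|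
    only.\<close>
  let ?k = "n + \<bar>w\<bar>"
  have "van x (\<sigma> i)" if "\<not> (- ?k \<le> i \<and> i \<le> ?k)" for i
    by (rule van_thick_left[OF n], rule \<sigma>_van) (use that in auto)
  moreover have "van (\<sigma> i) x" if "\<not> (- ?k \<le> i \<and> i \<le> ?k)" for i
    by (rule van_thick_right[OF n], rule \<sigma>_van) (use that in auto)
  ultimately show ?thesis
    using that[of ?k] by blast
qed

lemma van_sus_pow:
  assumes x: "x \<in> Obj T"
  shows "van ((Sus T ^^ k) x) (\<sigma> i) \<longleftrightarrow> van x (\<sigma> (i - int k))"
    "van (\<sigma> i) ((Sus T ^^ k) x) \<longleftrightarrow> van (\<sigma> (i - int k)) x"
proof (induction k arbitrary: i)
  case (Suc k)
  have *: "i - 1 - int k = i - int (Suc k)" for i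
    by simp
  have "van ((Sus T ^^ Suc k) x) (\<sigma> i) \<longleftrightarrow> van ((Sus T ^^ k) x) (\<sigma> (i - 1))" for i
    using van_sus_left[of "(Sus T ^^ k) x" i] x by simp
  then show "van ((Sus T ^^ Suc k) x) (\<sigma> i) \<longleftrightarrow> van x (\<sigma> (i - int (Suc k)))" for i
    unfolding Suc.IH(1) * .
  have "van (\<sigma> i) ((Sus T ^^ Suc k) x) \<longleftrightarrow> van (\<sigma> (i - 1)) ((Sus T ^^ k) x)" for i
    using van_sus_right[of "(Sus T ^^ k) x" i] x by simp
  then show "van (\<sigma> i) ((Sus T ^^ Suc k) x) \<longleftrightarrow> van (\<sigma> (i - int (Suc k))) x" for i
    unfolding Suc.IH(2) * .
qed simp_all

lemma van_\<sigma>_iso: "isomorphic T x y \<Longrightarrow> van x (\<sigma> i) \<longleftrightarrow> van y (\<sigma> i)"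
  "isomorphic T x y \<Longrightarrow> van (\<sigma> i) x \<longleftrightarrow> van (\<sigma> i) y"
  using van_iso isomorphic_refl[OF \<sigma>_obj] by blast+


section \<open>Classification of t-structures and co-t-structures\<close>

lemma t_structureD:
  assumes "t_structure T M N"
  shows "torsion_pair T M N" "m \<in> M \<Longrightarrow> (Sus T ^^ k) m \<in> M"
proof -
  show tp: "torsion_pair T M N"
    using assms by (simp add: t_structure_def)
  have "shift T 1 M \<subseteq> M" "M \<subseteq> Obj T"
    using assms by (simp_all add: t_structure_def torsion_pair_def)
  then show "m \<in> M \<Longrightarrow> (Sus T ^^ k) m \<in> M"
    by (rule shift_one)
qed

lemma co_t_structureD:
  assumes "co_t_structure T M N"
  shows "torsion_pair T M N" "m \<in> M \<Longrightarrow> \<exists>x \<in> M. isomorphic T ((Sus T ^^ k) x) m"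
proof -
  show tp: "torsion_pair T M N"
    using assms by (simp add: co_t_structure_def)
  have "shift T (- 1) M \<subseteq> M" "M \<subseteq> Obj T"
    using assms by (simp_all add: co_t_structure_def torsion_pair_def)
  then show "m \<in> M \<Longrightarrow> \<exists>x \<in> M. isomorphic T ((Sus T ^^ k) x) m"
    using shift_minus_one by blast
qed

lemma nontrivialE:
  assumes tp: "torsion_pair T M N" and nt: "\<not> trivial_pair T M N"
  obtains m n where "m \<in> M" "m \<in> Obj T" "m \<notin> zero_objects T" "n \<in> N" "n \<in> Obj T" "n \<notin> zero_objects T"
proof -
  have "\<not> M \<subseteq> zero_objects T" "\<not> N \<subseteq> zero_objects T"
    using torsion_pair_trivial[OF tp idempotents_split] nt by blast+
  then show ?thesis
    using that torsion_pairD(1,2)[OF tp] by blast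
qed

text \<open>The four classification arguments measure objects by their maps to or from the \<open>\<sigma> i\<close>;
  \<open>degrees A\<close> collects what they need of such a measure.\<close>

definition degrees :: "('o \<Rightarrow> int \<Rightarrow> bool) \<Rightarrow> bool" where
  "degrees A \<longleftrightarrow>
     (\<forall>x \<in> Obj T. (\<exists>k. \<forall>i. A x i \<longrightarrow> - k \<le> i \<and> i \<le> k) \<and> (x \<notin> zero_objects T \<longrightarrow> (\<exists>i. A x i)) \<and>
        (\<forall>k i. A ((Sus T ^^ k) x) i \<longleftrightarrow> A x (i - int k))) \<and>
     (\<forall>x y i. isomorphic T x y \<longrightarrow> A x i \<longleftrightarrow> A y i)"

text \<open>Named after the side of \<sigma> i: here \<open>x\<close> maps to \<sigma> i, in
  \<open>degrees_left\<close> it receives maps from it.\<close>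

lemma degrees_right: "degrees (\<lambda>x i. \<not> van x (\<sigma> i))"
  unfolding degrees_def using bounded_hom zero_if_left_perp van_sus_pow(1) van_\<sigma>_iso(1) by metis

lemma degrees_left: "degrees (\<lambda>x i. \<not> van (\<sigma> i) x)"
  unfolding degrees_def using bounded_hom zero_if_right_perp van_sus_pow(2) van_\<sigma>_iso(2) by metis

lemma degrees_nonzero: "degrees A \<Longrightarrow> x \<in> Obj T \<Longrightarrow> x \<notin> zero_objects T \<Longrightarrow> \<exists>i. A x i"
  unfolding degrees_def by blast

lemma degrees_least:
  assumes "degrees A" "x \<in> Obj T" "A x i"
  obtains a where "A x a" "\<And>j. A x j \<Longrightarrow> a \<le> j"
proof -
  obtain k where "\<And>i. A x i \<Longrightarrow> - k \<le> i"
    using assms unfolding degrees_def by blast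
  then show ?thesis
    using int_least[of "A x" i "- k"] assms(3) that by blast
qed

lemma degrees_greatest:
  assumes "degrees A" "x \<in> Obj T" "A x i"
  obtains a where "A x a" "\<And>j. A x j \<Longrightarrow> j \<le> a"
proof -
  obtain k where "\<And>i. A x i \<Longrightarrow> i \<le> k"
    using assms unfolding degrees_def by blast
  then show ?thesis
    using int_greatest[of "A x" i k] assms(3) that by blast
qed

text \<open>If the highest degree b of \<open>n\<close> were at least the lowest degree a of
  \<open>m\<close>, then \<Sigma>^(b - a) m, still in \<open>M\<close>, would have lowest degree
  exactly b, and \<open>key\<close> would give a nonzero map to \<open>n\<close>. So the degrees of
  \<open>M\<close> lie above those of \<open>N\<close>.\<close>

lemma t_structure_cut:
  assumes ts: "t_structure T M N" and nt: "\<not> trivial_pair T M N" and A: "degrees A" and B: "degrees B"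
    and key: "\<And>m n a. m \<in> Obj T \<Longrightarrow> n \<in> Obj T \<Longrightarrow> A m a \<Longrightarrow> (\<And>i. A m i \<Longrightarrow> a \<le> i) \<Longrightarrow>
      B n a \<Longrightarrow> (\<And>i. B n i \<Longrightarrow> i \<le> a) \<Longrightarrow> \<not> van m n"
  obtains c where "\<And>m i. m \<in> M \<Longrightarrow> A m i \<Longrightarrow> c \<le> i" "\<And>n j. n \<in> N \<Longrightarrow> B n j \<Longrightarrow> j < c"
proof -
  note tp = t_structureD(1)[OF ts]
  obtain m0 n0 where mn: "m0 \<in> M" "m0 \<in> Obj T" "m0 \<notin> zero_objects T" "n0 \<in> N" "n0 \<in> Obj T" "n0 \<notin> zero_objects T"
    using tp nt by (rule nontrivialE)
  let ?P = "\<lambda>i. \<exists>m \<in> M. A m i" and ?Q = "\<lambda>j. \<exists>n \<in> N. B n j"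
  have "j < i" if ij: "?P i" "?Q j" for i j
  proof -
    obtain m n where m: "m \<in> M" "A m i" and n: "n \<in> N" "B n j"
      using ij by blast
    have o: "m \<in> Obj T" "n \<in> Obj T"
      using torsion_pairD(1,2)[OF tp] m n by auto
    obtain a where a: "A m a" "\<And>i. A m i \<Longrightarrow> a \<le> i"
      using degrees_least[OF A o(1) m(2)] by blast
    obtain b where b: "B n b" "\<And>i. B n i \<Longrightarrow> i \<le> b"
      using degrees_greatest[OF B o(2) n(2)] by blast
    have "b < a"
    proof (rule ccontr)
      assume ab: "\<not> b < a"
      let ?k = "nat (b - a)"
      have sus: "A ((Sus T ^^ ?k) m) i \<longleftrightarrow> A m (i - (b - a))" for i
        using A o(1) ab unfolding degrees_def by simp
      have "a \<le> i - (b - a)" if "A ((Sus T ^^ ?k) m) i" for i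
        using a(2) that sus by blast
      then have "b \<le> i" if "A ((Sus T ^^ ?k) m) i" for i
        using that by force
      moreover have "A ((Sus T ^^ ?k) m) b"
        using sus a(1) by simp
      ultimately have "\<not> van ((Sus T ^^ ?k) m) n"
        using key[OF sus_pow_obj[OF o(1)] o(2)] b by blast
      then show False
        using torsion_pairD(3)[OF tp t_structureD(2)[OF ts m(1)] n(1)] by blast
    qed
    with a(2)[OF m(2)] b(2)[OF n(2)] show ?thesis by simp
  qed
  moreover obtain i j where "?P i" "?Q j"
    using degrees_nonzero[OF A mn(2,3)] degrees_nonzero[OF B mn(5,6)] mn(1,4) by blast
  ultimately obtain c where "\<And>i. ?P i \<Longrightarrow> c \<le> i" "\<And>j. ?Q j \<Longrightarrow> j < c"
    using int_cut[of ?P i ?Q j] by blast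
  with that show ?thesis by blast
qed

text \<open>Here \<open>M\<close> is closed under desuspension, so highest degrees of
  \<open>M\<close> are moved down to meet lowest degrees of \<open>N\<close>. The offset
  \<open>d\<close> is the distance at which \<open>key\<close> excludes orthogonality: 0 when both
  degrees are measured at the same \<sigma> a, and \<open>w\<close> when a map \<sigma> a
  \<rightarrow> \<sigma> (a + w) connects them.\<close>

lemma co_t_structure_cut:
  assumes ts: "co_t_structure T M N" and nt: "\<not> trivial_pair T M N" and A: "degrees A" and B: "degrees B"
    and key: "\<And>m n a. m \<in> Obj T \<Longrightarrow> n \<in> Obj T \<Longrightarrow> A m a \<Longrightarrow> (\<And>i. A m i \<Longrightarrow> i \<le> a) \<Longrightarrow>
      B n (a + d) \<Longrightarrow> (\<And>i. B n i \<Longrightarrow> a + d \<le> i) \<Longrightarrow> \<not> van m n"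
  obtains c where "\<And>m i. m \<in> M \<Longrightarrow> A m i \<Longrightarrow> i < c" "\<And>n j. n \<in> N \<Longrightarrow> B n j \<Longrightarrow> c + d \<le> j"
proof -
  note tp = co_t_structureD(1)[OF ts]
  obtain m0 n0 where mn: "m0 \<in> M" "m0 \<in> Obj T" "m0 \<notin> zero_objects T" "n0 \<in> N" "n0 \<in> Obj T" "n0 \<notin> zero_objects T"
    using tp nt by (rule nontrivialE)
  let ?P = "\<lambda>j. \<exists>n \<in> N. B n (j + d)" and ?Q = "\<lambda>i. \<exists>m \<in> M. A m i"
  have "j < i" if ij: "?P i" "?Q j" for i j
  proof -
    obtain m n where m: "m \<in> M" "A m j" and n: "n \<in> N" "B n (i + d)"
      using ij by blast
    have o: "m \<in> Obj T" "n \<in> Obj T"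
      using torsion_pairD(1,2)[OF tp] m n by auto
    obtain a where a: "A m a" "\<And>i. A m i \<Longrightarrow> i \<le> a"
      using degrees_greatest[OF A o(1) m(2)] by blast
    obtain b where b: "B n b" "\<And>i. B n i \<Longrightarrow> b \<le> i"
      using degrees_least[OF B o(2) n(2)] by blast
    have "a < b - d"
    proof (rule ccontr)
      assume ab: "\<not> a < b - d"
      let ?k = "nat (a - (b - d))"
      obtain x where x: "x \<in> M" "isomorphic T ((Sus T ^^ ?k) x) m"
        using co_t_structureD(2)[OF ts m(1)] by blast
      have xo: "x \<in> Obj T"
        using torsion_pairD(1)[OF tp x(1)] .
      have "A ((Sus T ^^ ?k) x) (i + int ?k) \<longleftrightarrow> A x i" for i
        using A xo unfolding degrees_def by simp
      moreover have "A ((Sus T ^^ ?k) x) (i + int ?k) \<longleftrightarrow> A m (i + int ?k)" for i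
        using A x(2) unfolding degrees_def by blast
      ultimately have desus: "A x i \<longleftrightarrow> A m (i + (a - (b - d)))" for i
        using ab by simp
      have "i + (a - (b - d)) \<le> a" if "A x i" for i
        using a(2) that desus by blast
      then have "i \<le> b - d" if "A x i" for i
        using that by force
      moreover have "A x (b - d)"
        using desus a(1) by simp
      ultimately have "\<not> van x n"
        using key[OF xo o(2), of "b - d"] b by simp
      then show False
        using torsion_pairD(3)[OF tp x(1) n(1)] by blast
    qed
    with a(2)[OF m(2)] b(2)[OF n(2)] show ?thesis by simp
  qed
  moreover obtain i j where "?P i" "?Q j"
  proof -
    obtain i j where "B n0 i" "A m0 j"
      using degrees_nonzero[OF A mn(2,3)] degrees_nonzero[OF B mn(5,6)] by blast
    then show ?thesis
      using that[of "i - d" j] mn by auto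
  qed
  ultimately obtain c where c: "\<And>j. ?P j \<Longrightarrow> c \<le> j" "\<And>i. ?Q i \<Longrightarrow> i < c"
    using int_cut[of ?P i ?Q j] by blast
  have "c \<le> j - d" if "n \<in> N" "B n j" for n j
    using c(1)[of "j - d"] that by auto
  with that c(2) show ?thesis by force
qed

lemma left_perpI: "x \<in> Obj T \<Longrightarrow> (\<And>i. \<not> van x (\<sigma> i) \<Longrightarrow> i \<notin> J) \<Longrightarrow> x \<in> left_perp J"
  by (auto simp: left_perp_def)

lemma right_perpI: "x \<in> Obj T \<Longrightarrow> (\<And>i. \<not> van (\<sigma> i) x \<Longrightarrow> i \<notin> J) \<Longrightarrow> x \<in> right_perp J"
  by (auto simp: right_perp_def)

lemma t_structure_pos:
  assumes w: "w \<ge> 1" and ts: "t_structure T M N" and nt: "\<not> trivial_pair T M N"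
  shows "\<exists>c. M = thick {c..} \<and> N = thick {..<c}"
proof -
  note tp = t_structureD(1)[OF ts]
  obtain c where c: "\<And>m i. m \<in> M \<Longrightarrow> \<not> van m (\<sigma> i) \<Longrightarrow> c \<le> i" "\<And>n j. n \<in> N \<Longrightarrow> \<not> van (\<sigma> j) n \<Longrightarrow> j < c"
  proof (rule t_structure_cut[OF ts nt degrees_right degrees_left])
    fix m n a assume "m \<in> Obj T" "n \<in> Obj T" "\<not> van m (\<sigma> a)" "\<And>i. \<not> van m (\<sigma> i) \<Longrightarrow> a \<le> i"
      "\<not> van (\<sigma> a) n" "\<And>i. \<not> van (\<sigma> i) n \<Longrightarrow> i \<le> a"
    then show "\<not> van m n"
      by (intro hom_lowest_pos[OF w, of m a n] left_perpI right_perpI) force+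
  qed blast
  have "M \<subseteq> thick {c..}"
    unfolding perp_atLeast(1)[OF w, symmetric] using c(1) torsion_pairD(1)[OF tp] by (force intro: left_perpI)
  moreover have "N \<subseteq> thick {..<c}"
    unfolding perp_atLeast(2)[OF w, symmetric] using c(2) torsion_pairD(2)[OF tp] by (force intro: right_perpI)
  ultimately show ?thesis
    using torsion_pair_eqI[OF tp torsion_pair_atLeast[OF w] idempotents_split] by blast
qed

lemma co_t_structure_nonpos:
  assumes w: "w \<le> 0" and ts: "co_t_structure T M N" and nt: "\<not> trivial_pair T M N"
  shows "\<exists>c. M = thick {..c} \<and> N = thick {c<..}"
proof -
  note tp = co_t_structureD(1)[OF ts]
  obtain c where c: "\<And>m i. m \<in> M \<Longrightarrow> \<not> van m (\<sigma> i) \<Longrightarrow> i < c" "\<And>n j. n \<in> N \<Longrightarrow> \<not> van (\<sigma> j) n \<Longrightarrow> c + 0 \<le> j"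
  proof (rule co_t_structure_cut[OF ts nt degrees_right degrees_left, of 0])
    fix m n a assume "m \<in> Obj T" "n \<in> Obj T" "\<not> van m (\<sigma> a)" "\<And>i. \<not> van m (\<sigma> i) \<Longrightarrow> i \<le> a"
      "\<not> van (\<sigma> (a + 0)) n" "\<And>i. \<not> van (\<sigma> i) n \<Longrightarrow> a + 0 \<le> i"
    then show "\<not> van m n"
      by (intro hom_top_nonpos[OF w, of m a n] left_perpI right_perpI) force+
  qed blast
  have "M \<subseteq> thick {..<c}"
    unfolding perp_atMost(3)[OF w, symmetric] using c(1) torsion_pairD(1)[OF tp] by (force intro: left_perpI)
  moreover have "N \<subseteq> thick {c..}"
    unfolding perp_atMost(4)[OF w, symmetric] using c(2) torsion_pairD(2)[OF tp] by (force intro: right_perpI)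
  \<comment> \<open>\<open>M\<close> lies strictly below the cut \<open>c\<close>, so the canonical
    pair to compare with is the one cut after \<open>c - 1\<close>.\<close>
  moreover have "{..<c} = {..c - 1}" "{c..} = {c - 1<..}"
    by auto
  ultimately show ?thesis
    using torsion_pair_eqI[OF tp torsion_pair_atMost[OF w, of "c - 1"] idempotents_split] by auto
qed

text \<open>Hom(N, \<Sigma> M) = 0 splits the truncation triangle, so the part in \<open>M\<close>
  is a retract of \<open>x\<close>; receiving no nonzero maps from \<open>x\<close>, it receives
  none from itself and is zero.\<close>

lemma split_truncation:
  assumes tp: "torsion_pair T M N" and x: "x \<in> Obj T"
    and v: "\<And>m. m \<in> M \<Longrightarrow> van x m" "\<And>m n. m \<in> M \<Longrightarrow> n \<in> N \<Longrightarrow> van n (Sus T m)"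
  shows "x \<in> N"
proof -
  obtain f g h where t: "tri f g h" "src f \<in> M" "tgt f = x" "tgt g \<in> N"
    using tp x by (rule torsion_pair_tri)
  have "h = Zero T (tgt g) (Sus T (src f))"
    using v(2)[OF t(2,4)] triD[OF t(1)] by (intro vanD) auto
  then have "retract (src f) x"
    using split_retracts(1)[OF t(1)] t(3) by simp
  moreover have "van (src f) (src f)"
    using van_retract_left[OF calculation] v(1)[OF t(2)] by blast
  then have "src f \<in> zero_objects T"
    using triD[OF t(1)] by (intro van_self) auto
  then have "f = Zero T (src f) (tgt f)"
    using van_zero_left triD[OF t(1)] by (intro vanD[of "src f" "tgt f"]) auto
  then show ?thesis
    using retract_van1[OF t(1)] t torsion_pair_retract[OF tp idempotents_split] by blast
qed

lemma co_t_structure_pos: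
  assumes w: "w \<ge> 1" and ts: "co_t_structure T M N"
  shows "trivial_pair T M N"
proof (rule ccontr)
  assume nt: "\<not> trivial_pair T M N"
  note tp = co_t_structureD(1)[OF ts]
  obtain c where c: "\<And>m i. m \<in> M \<Longrightarrow> \<not> van (\<sigma> i) m \<Longrightarrow> i < c" "\<And>n j. n \<in> N \<Longrightarrow> \<not> van n (\<sigma> j) \<Longrightarrow> c + w \<le> j"
  proof (rule co_t_structure_cut[OF ts nt degrees_left degrees_right, of w])
    fix m n a assume "m \<in> Obj T" "n \<in> Obj T" "\<not> van (\<sigma> a) m" "\<And>i. \<not> van (\<sigma> i) m \<Longrightarrow> i \<le> a"
      "\<not> van n (\<sigma> (a + w))" "\<And>i. \<not> van n (\<sigma> i) \<Longrightarrow> a + w \<le> i"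
    then show "\<not> van m n"
      by (intro hom_highest_pos[OF w, of m a n] left_perpI right_perpI) force+
  qed blast
  have M: "m \<in> thick {..<c}" if "m \<in> M" for m
    unfolding perp_atLeast(2)[OF w, symmetric] using c(1) torsion_pairD(1)[OF tp] that
    by (force intro: right_perpI)
  have N: "n \<in> thick {c + w..}" if "n \<in> N" for n
    unfolding perp_atLeast(1)[OF w, symmetric] using c(2) torsion_pairD(2)[OF tp] that
    by (force intro: left_perpI)
  \<comment> \<open>\<sigma> c has no maps to \<open>M\<close>, whose degrees are below
    \<open>c\<close>, so it belongs to \<open>N\<close>; but its identity is a nonzero map to a
    degree below \<open>c + w\<close>, which the bound on \<open>N\<close> forbids.\<close>
  have "\<sigma> c \<in> N"
  proof (rule split_truncation[OF tp \<sigma>_obj])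
    show "van (\<sigma> c) m" if "m \<in> M" for m
      using c(1) that by blast
    show "van n (Sus T m)" if "m \<in> M" "n \<in> N" for m n
      by (rule van_thick[OF N[OF that(2)] thick_sus[OF M[OF that(1)]]]) (use w in auto)
  qed
  then have "\<sigma> c \<in> left_perp {..<c + w}"
    unfolding perp_atLeast(1)[OF w] by (rule N)
  then have "van (\<sigma> c) (\<sigma> c)"
    using w by (auto simp: left_perp_def)
  then show False
    using not_van_self by blast
qed

text \<open>Both halves are first measured by maps from the \<sigma> i. Membership in
  \<open>thick {..<c + w}\<close> is a condition on maps to the \<sigma> i, so the bound for
  \<open>N\<close> has to be converted: by \<open>top_dual_nonpos\<close> a top degree b of the
  latter kind satisfies b - w < c.\<close>

lemma t_structure_nonpos_bounds:
  assumes w: "w \<le> 0" and ts: "t_structure T M N" and nt: "\<not> trivial_pair T M N"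
  obtains c where "M \<subseteq> thick {c..}" "N \<subseteq> thick {..<c + w}"
proof -
  note tp = t_structureD(1)[OF ts]
  obtain c where c: "\<And>m i. m \<in> M \<Longrightarrow> \<not> van (\<sigma> i) m \<Longrightarrow> c \<le> i" "\<And>n j. n \<in> N \<Longrightarrow> \<not> van (\<sigma> j) n \<Longrightarrow> j < c"
  proof (rule t_structure_cut[OF ts nt degrees_left degrees_left])
    fix m n a assume "m \<in> Obj T" "n \<in> Obj T" "\<not> van (\<sigma> a) m" "\<And>i. \<not> van (\<sigma> i) m \<Longrightarrow> a \<le> i"
      "\<not> van (\<sigma> a) n" "\<And>i. \<not> van (\<sigma> i) n \<Longrightarrow> i \<le> a"
    then show "\<not> van m n"
      by (intro hom_bottom_nonpos[OF w, of m a n] right_perpI) force+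
  qed blast
  have "M \<subseteq> thick {c..}"
    unfolding perp_atMost(4)[OF w, symmetric] using c(1) torsion_pairD(1)[OF tp] by (force intro: right_perpI)
  moreover have "n \<in> thick {..<c + w}" if n: "n \<in> N" for n
  proof -
    have o: "n \<in> Obj T"
      using torsion_pairD(2)[OF tp n] .
    have "i < c + w" if i: "\<not> van n (\<sigma> i)" for i
    proof -
      obtain b where b: "\<not> van n (\<sigma> b)" "\<And>i. \<not> van n (\<sigma> i) \<Longrightarrow> i \<le> b"
        using degrees_greatest[OF degrees_right o i] by blast
      have "n \<in> left_perp {b<..}"
        using o b(2) by (force intro: left_perpI)
      then have "\<not> van (\<sigma> (b - w)) n"
        using b(1) by (rule top_dual_nonpos[OF w])
      then show ?thesis
        using c(2)[OF n] b(2)[OF i] by force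
    qed
    then show ?thesis
      unfolding perp_atMost(3)[OF w, symmetric] using o by (force intro: left_perpI)
  qed
  ultimately show ?thesis
    using that by blast
qed

text \<open>For \<open>w = 0\<close> the bounds do not yet contradict each other, but they force every truncation to
  split, which fails for the cone of the nilpotent endomorphism of a suitable \<open>\<sigma> i\<close>.\<close>

lemma t_structure_nonpos:
  assumes w: "w \<le> 0" and ts: "t_structure T M N"
  shows "trivial_pair T M N"
proof (rule ccontr)
  assume nt: "\<not> trivial_pair T M N"
  note tp = t_structureD(1)[OF ts]
  obtain c where "M \<subseteq> thick {c..}" "N \<subseteq> thick {..<c + w}"
    using w ts nt by (rule t_structure_nonpos_bounds)
  then have M: "m \<in> M \<Longrightarrow> m \<in> thick {c..}" and N: "n \<in> N \<Longrightarrow> n \<in> thick {..<c + w}" for m n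
    by blast+
  \<comment> \<open>The degree just below \<open>M\<close>: \<sigma> (c - 1) has no maps to
    \<open>M\<close>, so it will lie in \<open>N\<close>.\<close>
  let ?s = "\<sigma> (c - 1)"
  have sm: "van ?s m" if "m \<in> M" for m
    using M[OF that] unfolding perp_atMost(4)[OF w, symmetric] by (simp add: right_perp_def)
  have nm: "van n (Sus T m)" if "m \<in> M" "n \<in> N" for m n
    by (rule van_thick[OF N[OF that(2)] thick_sus[OF M[OF that(1)]]]) (use w in auto)
  have "?s \<in> N"
    using split_truncation[OF tp \<sigma>_obj sm nm] .
  then have "?s \<in> left_perp {c + w..}"
    unfolding perp_atMost(3)[OF w] by (rule N)
  \<comment> \<open>The identity of \<sigma> (c - 1) must go to a degree below \<open>c + w\<close>,
    which together with \<open>w \<le> 0\<close> leaves \<open>w = 0\<close>.\<close>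
  then have "w = 0"
    using not_van_self[of "c - 1"] w by (force simp: left_perp_def)
  obtain X where X: "arr X" "src X = ?s" "tgt X = ?s" "X \<noteq> Zero T ?s ?s" "\<not> iso X"
    using \<sigma>_top[of "c - 1"] \<open>w = 0\<close> by (auto simp: hom_iff)
  have XX: "X \<cdot> X = Zero T ?s ?s"
    using X by (intro \<sigma>_local) (simp_all add: hom_iff)
  obtain f g where t: "tri X f g"
    using tri_cone_ex[OF X(1)] .
  note [simp] = triD[OF t] X(1-3)
  obtain a b d where t': "tri a b d" "src a \<in> M" "tgt a = tgt f" "tgt b \<in> N"
    using torsion_pair_tri[OF tp, of "tgt f"] by auto
  note [simp] = triD[OF t'(1)] t'(3)
  have "d = Zero T (tgt b) (Sus T (src a))"
    using nm[OF t'(2,4)] by (intro vanD) auto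
  then obtain i where i: "arr i" "src i = tgt b" "tgt i = tgt f" "b \<cdot> i = Id T (tgt b)"
    using lift2[OF t'(1), of "Id T (tgt b)" "tgt b"] by auto
  have "tgt b \<in> left_perp {c + w..}"
    unfolding perp_atMost(3)[OF w] using N[OF t'(4)] .
  then have "van (tgt b) (Sus T ?s)"
    using \<open>w = 0\<close> by (simp add: van_\<sigma>_sus left_perp_def)
  \<comment> \<open>\<Sigma> \<sigma> (c - 1) has degree \<open>c\<close>, to which nothing in
    \<open>N\<close> maps; so the split inclusion \<open>i\<close> of the part in \<open>N\<close>
    comes from \<sigma> (c - 1).\<close>
  then have "g \<cdot> i = Zero T (tgt b) (Sus T (src X))"
    using i by (intro vanD) auto
  then obtain k where k: "arr k" "src k = tgt b" "tgt k = ?s" "f \<cdot> k = i"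
    using lift2[OF t, of i "tgt b"] i by auto
  \<comment> \<open>\<open>f\<close> agrees with its component through \<open>N\<close>: the
    difference factors through \<open>M\<close>, to which \<sigma> (c - 1) has no maps.\<close>
  let ?d = "f \<oplus> neg T (i \<cdot> (b \<cdot> f))"
  have "b \<cdot> ?d = b \<cdot> f \<oplus> neg T ((b \<cdot> i) \<cdot> (b \<cdot> f))"
    using i(1-3) by (subst comp_add) simp_all
  also have "\<dots> = Zero T ?s (tgt b)"
    unfolding i(4) by simp
  finally obtain \<psi> where \<psi>: "arr \<psi>" "src \<psi> = ?s" "tgt \<psi> = src a" "a \<cdot> \<psi> = ?d"
    using lift1[OF t'(1), of ?d ?s] i(1-3) by auto
  have "\<psi> = Zero T ?s (src a)"
    using sm[OF t'(2)] \<psi>(1-3) by (rule vanD)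
  then have "?d = Zero T ?s (tgt f)"
    using \<psi>(4) by simp
  then have ff: "f = i \<cdot> (b \<cdot> f)"
    by (rule diff_zeroD) (use i(1-3) in simp_all)
  \<comment> \<open>\<open>?e\<close> satisfies f e = f and e X = 0. If it is a unit, X = 0; if not,
    f = f e e = 0, so X has a right inverse although it squares to zero.\<close>
  let ?e = "k \<cdot> (b \<cdot> f)"
  have e: "arr ?e" "src ?e = ?s" "tgt ?e = ?s"
    using k by simp_all
  have fe: "f \<cdot> ?e = f"
    using assoc_eq[OF k(4), of "b \<cdot> f"] k(1-3) ff by simp
  have fX: "f \<cdot> X = Zero T ?s (tgt f)"
    using tri_comp(1)[OF t] by simp
  show False
  proof (cases "iso ?e")
    case True
    have "?e \<cdot> X = k \<cdot> (b \<cdot> (f \<cdot> X))"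
      using k(1-3) by simp
    also have "\<dots> = Zero T ?s ?s"
      unfolding fX using k(1-3) by simp
    finally have "X = Zero T ?s (src ?e)"
      by (rule iso_left_cancel[OF True]) (use e in simp_all)
    then show False
      using X(4) e by simp
  next
    case False
    then have "?e \<cdot> ?e = Zero T ?s ?s"
      using e by (intro \<sigma>_local) (simp_all add: hom_iff)
    then have "f \<cdot> (?e \<cdot> ?e) = Zero T ?s (tgt f)"
      by simp
    moreover have "f \<cdot> (?e \<cdot> ?e) = f"
      using assoc_eq[OF fe _ _ _ e(1)] e fe by simp
    ultimately have "f \<cdot> Id T ?s = Zero T ?s (tgt f)"
      by simp
    then obtain y where y: "arr y" "src y = ?s" "tgt y = ?s" "X \<cdot> y = Id T ?s"
      using lift1[OF t, of "Id T ?s" ?s] by auto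
    have "X = (X \<cdot> X) \<cdot> y"
      using y by simp
    then show False
      unfolding XX using y X by simp
  qed
qed

theorem classification:
  "(w \<le> 0 \<longrightarrow>
      (\<forall>M N. t_structure T M N \<longrightarrow> trivial_pair T M N) \<and>
      (\<exists>M\<^sub>0 N\<^sub>0. co_t_structure T M\<^sub>0 N\<^sub>0 \<and> \<not> trivial_pair T M\<^sub>0 N\<^sub>0 \<and>
         {(M, N). co_t_structure T M N \<and> \<not> trivial_pair T M N} =
         {(shift T i M\<^sub>0, shift T i N\<^sub>0) | i. True})) \<and>
   (w \<ge> 1 \<longrightarrow>
      (\<forall>M N. co_t_structure T M N \<longrightarrow> trivial_pair T M N) \<and>
      (\<exists>M\<^sub>0 N\<^sub>0. t_structure T M\<^sub>0 N\<^sub>0 \<and> \<not> trivial_pair T M\<^sub>0 N\<^sub>0 \<and>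
         {(M, N). t_structure T M N \<and> \<not> trivial_pair T M N} =
         {(shift T i M\<^sub>0, shift T i N\<^sub>0) | i. True}))"
proof (intro conjI impI)
  assume w: "w \<le> 0"
  show "\<forall>M N. t_structure T M N \<longrightarrow> trivial_pair T M N"
    using t_structure_nonpos[OF w] by blast
  have co: "co_t_structure T (thick {..c}) (thick {c<..})" for c
  proof -
    have "(\<lambda>j. j + - 1) ` {..c} \<subseteq> {..c}"
      by auto
    then have "shift T (- 1) (thick {..c}) \<subseteq> thick {..c}"
      unfolding shift_thick using thick_mono by blast
    then show ?thesis
      using torsion_pair_atMost[OF w] by (simp add: co_t_structure_def)
  qed
  have nt: "\<not> trivial_pair T (thick {..c}) (thick {c<..})" for c
    by (rule nontrivial_thick[of c _ "c + 1"]) auto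
  have s: "shift T i (thick {..0}) = thick {..i}" "shift T i (thick {0<..}) = thick {i<..}" for i
  proof -
    have "(\<lambda>j. j + i) ` {..0} = {..i}" "(\<lambda>j. j + i) ` {0<..} = {i<..}"
      by (force intro: image_eqI[of _ _ "_ - i"])+
    then show "shift T i (thick {..0}) = thick {..i}" "shift T i (thick {0<..}) = thick {i<..}"
      unfolding shift_thick by simp_all
  qed
  show "\<exists>M\<^sub>0 N\<^sub>0. co_t_structure T M\<^sub>0 N\<^sub>0 \<and> \<not> trivial_pair T M\<^sub>0 N\<^sub>0 \<and>
         {(M, N). co_t_structure T M N \<and> \<not> trivial_pair T M N} =
         {(shift T i M\<^sub>0, shift T i N\<^sub>0) | i. True}"
    by (rule exI[of _ "thick {..0}"], rule exI[of _ "thick {0<..}"], unfold s)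
      (use co nt co_t_structure_nonpos[OF w] in blast)
next
  assume w: "w \<ge> 1"
  show "\<forall>M N. co_t_structure T M N \<longrightarrow> trivial_pair T M N"
    using co_t_structure_pos[OF w] by blast
  have ts: "t_structure T (thick {c..}) (thick {..<c})" for c
  proof -
    have "(\<lambda>j. j + 1) ` {c..} \<subseteq> {c..}"
      by auto
    then have "shift T 1 (thick {c..}) \<subseteq> thick {c..}"
      unfolding shift_thick using thick_mono by blast
    then show ?thesis
      using torsion_pair_atLeast[OF w] by (simp add: t_structure_def)
  qed
  have nt: "\<not> trivial_pair T (thick {c..}) (thick {..<c})" for c
    by (rule nontrivial_thick[of c _ "c - 1"]) auto
  have s: "shift T i (thick {0..}) = thick {i..}" "shift T i (thick {..<0}) = thick {..<i}" for i
  proof -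
    have "(\<lambda>j. j + i) ` {0..} = {i..}" "(\<lambda>j. j + i) ` {..<0} = {..<i}"
      by (force intro: image_eqI[of _ _ "_ - i"])+
    then show "shift T i (thick {0..}) = thick {i..}" "shift T i (thick {..<0}) = thick {..<i}"
      unfolding shift_thick by simp_all
  qed
  show "\<exists>M\<^sub>0 N\<^sub>0. t_structure T M\<^sub>0 N\<^sub>0 \<and> \<not> trivial_pair T M\<^sub>0 N\<^sub>0 \<and>
         {(M, N). t_structure T M N \<and> \<not> trivial_pair T M N} =
         {(shift T i M\<^sub>0, shift T i N\<^sub>0) | i. True}"
    by (rule exI[of _ "thick {0..}"], rule exI[of _ "thick {..<0}"], unfold s)
      (use ts nt t_structure_pos[OF w] in blast)
qed

end

section \<open>The shifts of a spherical object\<close>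

text \<open>Both coefficients can be nonzero only if \<open>n = w = 0\<close>, which is why
  \<open>w = 0\<close> needs a separate description of endomorphisms.\<close>

lemma dual_numbers_partE:
  assumes "p \<in> dual_numbers_part w n"
  obtains c d where "p = [:c, d:]" "c \<noteq> 0 \<longrightarrow> n = 0" "d \<noteq> 0 \<longrightarrow> n = w"
proof -
  have d: "degree p < 2" and c: "\<And>i. coeff p i \<noteq> 0 \<Longrightarrow> int i * w = n"
    using assms by (auto simp: dual_numbers_part_def)
  have "p = [:coeff p 0, coeff p 1:]"
  proof (rule poly_eqI)
    fix i
    show "coeff p i = coeff [:coeff p 0, coeff p 1:] i"
      using d coeff_eq_0[of p i] by (cases i; cases "i - 1") (auto simp: coeff_pCons split: nat.splits)
  qed
  then show ?thesis
    using that c[of 0] c[of 1] by auto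
qed

lemma zero_part: "0 \<in> dual_numbers_part w n"
  by (simp add: dual_numbers_part_def)

lemma one_part: "1 \<in> dual_numbers_part w 0"
  by (auto simp: dual_numbers_part_def coeff_1 split: if_splits)

lemma X_part: "[:0, 1:] \<in> dual_numbers_part w w"
  by (auto simp: dual_numbers_part_def coeff_pCons split: nat.splits)

context linear_triangulated_category
begin

section \<open>Scalars and the shape of single Hom sets\<close>

lemma scale_arr [simp]:
  assumes "arr f"
  shows "arr (scale c f)" "src (scale c f) = src f" "tgt (scale c f) = tgt f"
  using scale_hom[of f "src f" "tgt f" c] assms by (simp_all add: hom_iff)

lemma scale_comps [simp]:
  assumes "arr f" "arr g" "src g = tgt f"
  shows "scale c g \<cdot> f = scale c (g \<cdot> f)" "g \<cdot> scale c f = scale c (g \<cdot> f)"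
  using scale_comp_left[of f "src f" "tgt f" g "tgt g" c] scale_comp_right[of f "src f" "tgt f" g "tgt g" c] assms
  by (simp_all add: hom_iff)

lemma scale_scale' [simp]: "arr f \<Longrightarrow> scale c (scale d f) = scale (c * d) f"
  using scale_scale[of f "src f" "tgt f"] by (simp add: hom_iff)

lemma scale_one' [simp]: "arr f \<Longrightarrow> scale 1 f = f"
  using scale_one[of f "src f" "tgt f"] by (simp add: hom_iff)

lemma scale_sus [simp]: "arr f \<Longrightarrow> SusM T (scale c f) = scale c (SusM T f)"
  using scale_susp[of f "src f" "tgt f"] by (simp add: hom_iff)

lemma scale_sum:
  "arr f \<Longrightarrow> arr g \<Longrightarrow> src g = src f \<Longrightarrow> tgt g = tgt f \<Longrightarrow> scale c (f \<oplus> g) = scale c f \<oplus> scale c g"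
  using scale_add_right[of f "src f" "tgt f" g] by (simp add: hom_iff)

lemma scale_zero [simp]:
  assumes "arr f" "src f = a" "tgt f = b"
  shows "scale 0 f = Zero T a b"
proof -
  have o: "a \<in> Obj T" "b \<in> Obj T"
    using assms by auto
  have "scale 0 f \<oplus> scale 0 f = scale (0 + 0) f"
    by (rule scale_add_left[symmetric]) (use assms in \<open>simp add: hom_iff\<close>)
  also have "\<dots> = scale 0 f \<oplus> Zero T a b"
    using assms by simp
  finally show ?thesis
    by (rule sum_cancel[rotated -1]) (use assms o in simp_all)
qed

lemma scale_of_zero [simp]:
  assumes "a \<in> Obj T" "b \<in> Obj T"
  shows "scale c (Zero T a b) = Zero T a b"
proof -
  have "scale c (Zero T a b) = scale c (scale 0 (Zero T a b))"
    using assms by simp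
  also have "\<dots> = scale 0 (Zero T a b)"
    using assms by (subst scale_scale') simp_all
  finally show ?thesis
    using assms by simp
qed

lemma iso_scale:
  assumes "iso g" "c \<noteq> 0"
  shows "iso (scale c g)"
  by (rule isoI[of _ "scale (1 / c) (inv g)"]) (use assms in \<open>simp_all add: iso_arr\<close>)

text \<open>The generator may be zero, so that degrees without maps are included.
  \<open>line\<close> and \<open>dual\<close> forget the grading: they speak of single Hom sets and
  can be carried along isomorphisms and suspension.\<close>

definition line :: "'o \<Rightarrow> 'o \<Rightarrow> bool" where
  "line a b \<longleftrightarrow> (\<exists>x \<in> Hom T a b. \<forall>f \<in> Hom T a b. \<exists>c. f = scale c x)"

definition dual :: "'o \<Rightarrow> bool" where
  "dual a \<longleftrightarrow> (\<exists>X \<in> Hom T a a. X \<noteq> Zero T a a \<and> X \<cdot> X = Zero T a a \<and>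
     (\<forall>f \<in> Hom T a a. \<exists>c d. f = scale c (Id T a) \<oplus> scale d X))"

lemma line_iso:
  assumes "line a b" "isomorphic T a a'" "isomorphic T b b'"
  shows "line a' b'"
proof -
  obtain \<alpha> where \<alpha>: "iso \<alpha>" "arr \<alpha>" "src \<alpha> = a" "tgt \<alpha> = a'"
    using assms(2) by (rule isomorphicE)
  obtain \<beta> where \<beta>: "iso \<beta>" "arr \<beta>" "src \<beta> = b" "tgt \<beta> = b'"
    using assms(3) by (rule isomorphicE)
  obtain x where x: "arr x" "src x = a" "tgt x = b" and L: "\<And>f. f \<in> Hom T a b \<Longrightarrow> \<exists>c. f = scale c x"
    using assms(1) by (auto simp: line_def hom_iff)
  note [simp] = \<alpha> \<beta> x
  show ?thesis
    unfolding line_def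
  proof (intro bexI ballI)
    show "\<beta> \<cdot> (x \<cdot> inv \<alpha>) \<in> Hom T a' b'"
      by (simp add: hom_iff)
    fix f assume "f \<in> Hom T a' b'"
    then have f: "arr f" "src f = a'" "tgt f = b'"
      by (auto simp: hom_iff)
    obtain c where c: "inv \<beta> \<cdot> (f \<cdot> \<alpha>) = scale c x"
      using L[of "inv \<beta> \<cdot> (f \<cdot> \<alpha>)"] f by (auto simp: hom_iff)
    have "f = \<beta> \<cdot> ((inv \<beta> \<cdot> (f \<cdot> \<alpha>)) \<cdot> inv \<alpha>)"
      using f by simp
    also have "\<dots> = scale c (\<beta> \<cdot> (x \<cdot> inv \<alpha>))"
      unfolding c by simp
    finally show "\<exists>c. f = scale c (\<beta> \<cdot> (x \<cdot> inv \<alpha>))" ..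
  qed
qed

lemma dual_iso:
  assumes "dual a" "isomorphic T a a'"
  shows "dual a'"
proof -
  obtain \<alpha> where \<alpha>: "iso \<alpha>" "arr \<alpha>" "src \<alpha> = a" "tgt \<alpha> = a'"
    using assms(2) by (rule isomorphicE)
  obtain x where x: "arr x" "src x = a" "tgt x = a" and x0: "x \<noteq> Zero T a a" and xx: "x \<cdot> x = Zero T a a"
    and L: "\<And>f. f \<in> Hom T a a \<Longrightarrow> \<exists>c d. f = scale c (Id T a) \<oplus> scale d x"
    using assms(1) by (auto simp: dual_def hom_iff)
  note [simp] = \<alpha> x
  have [simp]: "a \<in> Obj T" "a' \<in> Obj T"
    using isomorphic_obj assms(2) by blast+
  let ?X = "\<alpha> \<cdot> (x \<cdot> inv \<alpha>)"
  show ?thesis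
    unfolding dual_def
  proof (intro bexI ballI conjI)
    show "?X \<in> Hom T a' a'"
      by (simp add: hom_iff)
    show "?X \<noteq> Zero T a' a'"
    proof
      assume "?X = Zero T a' a'"
      then have "inv \<alpha> \<cdot> (?X \<cdot> \<alpha>) = Zero T a a"
        by simp
      then show False
        using x0 by simp
    qed
    show "?X \<cdot> ?X = Zero T a' a'"
      using assoc_eq[OF xx, of "inv \<alpha>"] by simp
    fix f assume "f \<in> Hom T a' a'"
    then have f: "arr f" "src f = a'" "tgt f = a'"
      by (auto simp: hom_iff)
    obtain c d where c: "inv \<alpha> \<cdot> (f \<cdot> \<alpha>) = scale c (Id T a) \<oplus> scale d x"
      using L[of "inv \<alpha> \<cdot> (f \<cdot> \<alpha>)"] f by (auto simp: hom_iff)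
    have "f = \<alpha> \<cdot> ((inv \<alpha> \<cdot> (f \<cdot> \<alpha>)) \<cdot> inv \<alpha>)"
      using f by simp
    also have "\<dots> = scale c (Id T a') \<oplus> scale d ?X"
      unfolding c by (subst add_comp) simp_all
    finally show "\<exists>c d. f = scale c (Id T a') \<oplus> scale d ?X" by blast
  qed
qed

lemma line_sus:
  assumes [simp]: "a \<in> Obj T" "b \<in> Obj T"
  shows "line (Sus T a) (Sus T b) \<longleftrightarrow> line a b"
proof
  assume "line (Sus T a) (Sus T b)"
  then obtain x where x: "arr x" "src x = Sus T a" "tgt x = Sus T b"
    and L: "\<And>f. f \<in> Hom T (Sus T a) (Sus T b) \<Longrightarrow> \<exists>c. f = scale c x"
    by (auto simp: line_def hom_iff)
  obtain y where y: "arr y" "src y = a" "tgt y = b" "SusM T y = x"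
    using x by (rule sus_full) simp_all
  show "line a b"
    unfolding line_def
  proof (intro bexI ballI)
    show "y \<in> Hom T a b"
      using y by (simp add: hom_iff)
    fix f assume "f \<in> Hom T a b"
    then have f: "arr f" "src f = a" "tgt f = b"
      by (auto simp: hom_iff)
    then obtain c where c: "SusM T f = scale c x"
      using L[of "SusM T f"] by (auto simp: hom_iff)
    have "f = scale c y"
      by (rule sus_faithful) (use f y c in simp_all)
    then show "\<exists>c. f = scale c y" ..
  qed
next
  assume "line a b"
  then obtain x where x: "arr x" "src x = a" "tgt x = b" and L: "\<And>f. f \<in> Hom T a b \<Longrightarrow> \<exists>c. f = scale c x"
    by (auto simp: line_def hom_iff)
  show "line (Sus T a) (Sus T b)"
    unfolding line_def
  proof (intro bexI ballI)
    show "SusM T x \<in> Hom T (Sus T a) (Sus T b)"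
      using x by (simp add: hom_iff)
    fix f assume "f \<in> Hom T (Sus T a) (Sus T b)"
    then have f: "arr f" "src f = Sus T a" "tgt f = Sus T b"
      by (auto simp: hom_iff)
    obtain g where g: "arr g" "src g = a" "tgt g = b" "SusM T g = f"
      using f by (rule sus_full) simp_all
    then obtain c where "g = scale c x"
      using L[of g] by (auto simp: hom_iff)
    then have "f = scale c (SusM T x)"
      using g(4) x by auto
    then show "\<exists>c. f = scale c (SusM T x)" ..
  qed
qed

lemma dual_sus:
  assumes [simp]: "a \<in> Obj T"
  shows "dual (Sus T a) \<longleftrightarrow> dual a"
proof
  assume "dual (Sus T a)"
  then obtain x where x: "arr x" "src x = Sus T a" "tgt x = Sus T a"
    and x0: "x \<noteq> Zero T (Sus T a) (Sus T a)" and xx: "x \<cdot> x = Zero T (Sus T a) (Sus T a)"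
    and L: "\<And>f. f \<in> Hom T (Sus T a) (Sus T a) \<Longrightarrow> \<exists>c d. f = scale c (Id T (Sus T a)) \<oplus> scale d x"
    by (auto simp: dual_def hom_iff)
  obtain y where y: "arr y" "src y = a" "tgt y = a" "SusM T y = x"
    using x by (rule sus_full) simp_all
  show "dual a"
    unfolding dual_def
  proof (intro bexI ballI conjI)
    show "y \<in> Hom T a a"
      using y by (simp add: hom_iff)
    show "y \<noteq> Zero T a a"
      using x0 y(4) by auto
    show "y \<cdot> y = Zero T a a"
      by (rule sus_zeroD) (use y xx in simp_all)
    fix f assume "f \<in> Hom T a a"
    then have f: "arr f" "src f = a" "tgt f = a"
      by (auto simp: hom_iff)
    then obtain c d where c: "SusM T f = scale c (Id T (Sus T a)) \<oplus> scale d x"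
      using L[of "SusM T f"] by (auto simp: hom_iff)
    have "f = scale c (Id T a) \<oplus> scale d y"
      by (rule sus_faithful) (use f y c in simp_all)
    then show "\<exists>c d. f = scale c (Id T a) \<oplus> scale d y" by blast
  qed
next
  assume "dual a"
  then obtain x where x: "arr x" "src x = a" "tgt x = a"
    and x0: "x \<noteq> Zero T a a" and xx: "x \<cdot> x = Zero T a a"
    and L: "\<And>f. f \<in> Hom T a a \<Longrightarrow> \<exists>c d. f = scale c (Id T a) \<oplus> scale d x"
    by (auto simp: dual_def hom_iff)
  show "dual (Sus T a)"
    unfolding dual_def
  proof (intro bexI ballI conjI)
    show "SusM T x \<in> Hom T (Sus T a) (Sus T a)"
      using x by (simp add: hom_iff)
    show "SusM T x \<noteq> Zero T (Sus T a) (Sus T a)"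
      using x0 x sus_zeroD by blast
    have "SusM T x \<cdot> SusM T x = SusM T (x \<cdot> x)"
      using x by simp
    then show "SusM T x \<cdot> SusM T x = Zero T (Sus T a) (Sus T a)"
      unfolding xx by simp
    fix f assume "f \<in> Hom T (Sus T a) (Sus T a)"
    then have f: "arr f" "src f = Sus T a" "tgt f = Sus T a"
      by (auto simp: hom_iff)
    obtain g where g: "arr g" "src g = a" "tgt g = a" "SusM T g = f"
      using f by (rule sus_full) simp_all
    then obtain c d where "g = scale c (Id T a) \<oplus> scale d x"
      using L[of g] by (auto simp: hom_iff)
    then have "f = scale c (Id T (Sus T a)) \<oplus> scale d (SusM T x)"
      using g(4) x by auto
    then show "\<exists>c d. f = scale c (Id T (Sus T a)) \<oplus> scale d (SusM T x)" by blast
  qed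
qed

text \<open>Every nonzero element of \<open>W\<close> generates the others by scalars, and a scalar
  acts as a multiple of the identity on either side. If \<open>W\<close> contains only the zero map,
  that map will do.\<close>

lemma principal_line:
  assumes W: "W \<subseteq> Hom T a b" "W \<noteq> {}" and x: "x \<in> Hom T a b" "\<And>f. f \<in> W \<Longrightarrow> \<exists>c. f = scale c x"
  shows "\<exists>u \<in> W. \<forall>f \<in> W. (\<exists>e \<in> Hom T b b. f = e \<cdot> u) \<and> (\<exists>e \<in> Hom T a a. f = u \<cdot> e)"
proof -
  have o: "a \<in> Obj T" "b \<in> Obj T"
    using hom_obj x by blast+
  have "\<exists>u \<in> W. \<forall>f \<in> W. \<exists>c. f = scale c u"
  proof (cases "\<exists>u \<in> W. u \<noteq> Zero T a b")
    case True
    then obtain u c0 where u: "u \<in> W" "u \<noteq> Zero T a b" "u = scale c0 x"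
      using x(2) by blast
    then have "c0 \<noteq> 0"
      using x(1) by (auto simp: hom_iff)
    have "\<exists>d. f = scale d u" if f: "f \<in> W" for f
    proof -
      obtain c where "f = scale c x"
        using x(2) f by blast
      then have "f = scale (c / c0) u"
        unfolding u(3) using x(1) \<open>c0 \<noteq> 0\<close> by (simp add: hom_iff)
      then show ?thesis ..
    qed
    with u show ?thesis by blast
  next
    case False
    then have z: "f = Zero T a b" if "f \<in> W" for f
      using that by blast
    obtain u where u: "u \<in> W"
      using W by blast
    have "f = scale 1 u" if "f \<in> W" for f
      unfolding z[OF that] z[OF u] using o by simp
    with u show ?thesis by blast
  qed
  then obtain u where u: "u \<in> W" "\<And>f. f \<in> W \<Longrightarrow> \<exists>c. f = scale c u"
    by blast
  have ua: "arr u" "src u = a" "tgt u = b"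
    using u W by (auto simp: hom_iff)
  have "(\<exists>e \<in> Hom T b b. f = e \<cdot> u) \<and> (\<exists>e \<in> Hom T a a. f = u \<cdot> e)" if f: "f \<in> W" for f
  proof -
    obtain c where c: "f = scale c u"
      using u(2) f by blast
    have "f = scale c (Id T b) \<cdot> u" "f = u \<cdot> scale c (Id T a)"
      unfolding c using ua o by simp_all
    moreover have "scale c (Id T b) \<in> Hom T b b" "scale c (Id T a) \<in> Hom T a a"
      using o by (simp_all add: hom_iff)
    ultimately show ?thesis
      by blast
  qed
  with u(1) show ?thesis
    by blast
qed

text \<open>A unit in \<open>W\<close> generates everything; otherwise \<open>W\<close> consists of
  multiples of \<open>X\<close>.\<close>

lemma principal_local:
  assumes W: "W \<subseteq> Hom T a a" "W \<noteq> {}" and X: "X \<in> Hom T a a"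
    "\<And>f. f \<in> Hom T a a \<Longrightarrow> \<not> iso f \<Longrightarrow> \<exists>d. f = scale d X"
  shows "\<exists>u \<in> W. \<forall>f \<in> W. (\<exists>e \<in> Hom T a a. f = e \<cdot> u) \<and> (\<exists>e \<in> Hom T a a. f = u \<cdot> e)"
proof (cases "\<exists>u \<in> W. iso u")
  case True
  then obtain u where u: "u \<in> W" "iso u" by blast
  have ua: "arr u" "src u = a" "tgt u = a"
    using u W by (auto simp: hom_iff)
  have "(\<exists>e \<in> Hom T a a. f = e \<cdot> u) \<and> (\<exists>e \<in> Hom T a a. f = u \<cdot> e)" if f: "f \<in> W" for f
  proof -
    have fa: "arr f" "src f = a" "tgt f = a"
      using f W by (auto simp: hom_iff)
    have "f = (f \<cdot> inv u) \<cdot> u" "f = u \<cdot> (inv u \<cdot> f)" "f \<cdot> inv u \<in> Hom T a a" "inv u \<cdot> f \<in> Hom T a a"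
      using fa ua u(2) by (simp_all add: hom_iff)
    then show ?thesis
      by blast
  qed
  then show ?thesis
    using u(1) by blast
next
  case False
  then show ?thesis
    using W X by (intro principal_line[where x = X]) auto
qed

text \<open>A choice of quasi-inverse on objects; this is enough since the \<sigma> i are needed
  only up to isomorphism.\<close>

definition desus :: "'o \<Rightarrow> 'o" where
  "desus x = (SOME y. y \<in> Obj T \<and> isomorphic T (Sus T y) x)"

definition shifts :: "'o \<Rightarrow> int \<Rightarrow> 'o" where
  "shifts s i = (if i \<ge> 0 then (Sus T ^^ nat i) s else (desus ^^ nat (- i)) s)"

lemma desus:
  assumes "x \<in> Obj T"
  shows "desus x \<in> Obj T" "isomorphic T (Sus T (desus x)) x"
proof -
  have "\<exists>y. y \<in> Obj T \<and> isomorphic T (Sus T y) x"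
    using suspension.essentially_surjective[OF assms] by blast
  from someI_ex[OF this] show "desus x \<in> Obj T" "isomorphic T (Sus T (desus x)) x"
    by (simp_all add: desus_def)
qed

lemma desus_pow_obj: "x \<in> Obj T \<Longrightarrow> (desus ^^ k) x \<in> Obj T"
  by (induction k) (auto simp: desus)

lemma shifts_obj: "s \<in> Obj T \<Longrightarrow> shifts s i \<in> Obj T"
  by (simp add: shifts_def desus_pow_obj)

lemma shifts_sus:
  assumes s: "s \<in> Obj T"
  shows "isomorphic T (Sus T (shifts s i)) (shifts s (i + 1))"
proof (cases "i \<ge> 0")
  case True
  then have "Sus T (shifts s i) = shifts s (i + 1)"
    by (simp add: shifts_def nat_add_distrib)
  then show ?thesis
    using isomorphic_refl shifts_obj[OF s] by simp
next
  case False
  then have "nat (- i) = Suc (nat (- (i + 1)))"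
    by simp
  then have "shifts s i = desus ((desus ^^ nat (- (i + 1))) s)"
    using False by (simp add: shifts_def)
  also have "(desus ^^ nat (- (i + 1))) s = shifts s (i + 1)"
    using False by (cases "i = - 1") (auto simp: shifts_def)
  finally show ?thesis
    using desus(2)[OF shifts_obj[OF s]] by simp
qed

text \<open>The last premise is in the normal form of \<open>graded_hom\<close> for degree
  \<open>j - i\<close>, where at least one of the two powers is zero. A common shift of both indices
  does not affect \<open>P\<close>, which allows the passage from there to \<open>i\<close> and
  \<open>j\<close>, upwards or downwards.\<close>

lemma shift_invariant:
  fixes P :: "'o \<Rightarrow> 'o \<Rightarrow> bool"
  assumes s: "s \<in> Obj T"
    and iso: "\<And>a b a' b'. P a b \<Longrightarrow> isomorphic T a a' \<Longrightarrow> isomorphic T b b' \<Longrightarrow> P a' b'"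
    and sus: "\<And>a b. a \<in> Obj T \<Longrightarrow> b \<in> Obj T \<Longrightarrow> P (Sus T a) (Sus T b) \<longleftrightarrow> P a b"
    and P: "P ((Sus T ^^ nat (- (j - i))) s) ((Sus T ^^ nat (j - i)) s)"
  shows "P (shifts s i) (shifts s j)"
proof -
  have step: "P (shifts s (i + 1)) (shifts s (j + 1)) \<longleftrightarrow> P (shifts s i) (shifts s j)" for i j
    using iso[OF _ shifts_sus[OF s, of i] shifts_sus[OF s, of j]]
      iso[OF _ isomorphic_sym[OF shifts_sus[OF s, of i]] isomorphic_sym[OF shifts_sus[OF s, of j]]]
      sus[OF shifts_obj[OF s, of i] shifts_obj[OF s, of j]] by blast
  have nat: "P (shifts s (i + int k)) (shifts s (j + int k)) \<longleftrightarrow> P (shifts s i) (shifts s j)" for i j k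
  proof (induction k)
    case (Suc k)
    have *: "i + int (Suc k) = i + int k + 1" "j + int (Suc k) = j + int k + 1"
      by simp_all
    show ?case
      unfolding * step using Suc .
  qed simp
  define i0 j0 where "i0 = int (nat (- (j - i)))" and "j0 = int (nat (j - i))"
  have 0: "P (shifts s i0) (shifts s j0)"
    using P by (simp only: shifts_def i0_def j0_def of_nat_0_le_iff if_True nat_int)
  have d: "i - i0 = j - j0"
    by (simp add: i0_def j0_def)
  show ?thesis
  proof (cases "i0 \<le> i")
    case True
    then have "i0 + int (nat (i - i0)) = i" "j0 + int (nat (i - i0)) = j"
      using d by auto
    then show ?thesis
      using nat[of i0 "nat (i - i0)" j0] 0 by simp
  next
    case False
    then have "i + int (nat (i0 - i)) = i0" "j + int (nat (i0 - i)) = j0"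
      using d by auto
    then show ?thesis
      using nat[of i "nat (i0 - i)" j] 0 by simp
  qed
qed

text \<open>For \<open>c \<noteq> 0\<close> the map is \<open>c\<close> times 1 + (d / c) X, which
  is invertible as X squares to zero.\<close>

lemma dual_nonunit:
  assumes o: "a \<in> Obj T" and X: "X \<in> Hom T a a" "X \<cdot> X = Zero T a a"
    and f: "f = scale c (Id T a) \<oplus> scale d X" and n: "\<not> iso f"
  shows "f = scale d X"
proof (cases "c = 0")
  case True
  then show ?thesis
    using o X(1) unfolding f by (simp add: hom_iff)
next
  case False
  note [simp] = X(1)[unfolded hom_iff] o
  have "iso (Id T a \<oplus> scale (d / c) X)"
    by (rule iso_one_plus_nilpotent) (use X(2) in simp_all)
  then have "iso (scale c (Id T a \<oplus> scale (d / c) X))"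
    using False by (rule iso_scale)
  then have "iso f"
    unfolding f using False by (simp add: scale_sum)
  with n show ?thesis ..
qed

lemma spherical_hom:
  assumes sph: "spherical_object T scale w s"
  shows "n \<noteq> 0 \<Longrightarrow> n \<noteq> w \<Longrightarrow> van ((Sus T ^^ nat (- n)) s) ((Sus T ^^ nat n) s)"
    and "n = 0 \<or> n = w \<Longrightarrow> \<not> van ((Sus T ^^ nat (- n)) s) ((Sus T ^^ nat n) s)"
    and "w \<noteq> 0 \<Longrightarrow> line ((Sus T ^^ nat (- n)) s) ((Sus T ^^ nat n) s)"
    and "w = 0 \<Longrightarrow> dual s"
proof -
  have s: "s \<in> Obj T"
    using sph by (simp add: spherical_object_def)
  have "\<exists>\<phi> :: int \<Rightarrow> 'k poly \<Rightarrow> 'm.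
      (\<forall>n. bij_betw (\<phi> n) (dual_numbers_part w n) (graded_hom T s s n)) \<and>
      (\<forall>n. \<forall>p \<in> dual_numbers_part w n. \<forall>q \<in> dual_numbers_part w n. \<phi> n (p + q) = \<phi> n p \<oplus> \<phi> n q) \<and>
      (\<forall>n c. \<forall>p \<in> dual_numbers_part w n. \<phi> n (smult c p) = scale c (\<phi> n p)) \<and>
      (\<forall>m n. \<forall>p \<in> dual_numbers_part w m. \<forall>q \<in> dual_numbers_part w n.
         \<phi> (m + n) ((q * p) mod monom 1 2) = graded_comp T s s n m (\<phi> n q) (\<phi> m p)) \<and>
      \<phi> 0 1 = Id T s"
    using sph unfolding spherical_object_def by (rule conjunct2)
  then obtain \<phi> :: "int \<Rightarrow> 'k poly \<Rightarrow> 'm" where \<phi>: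
    "(\<forall>n. bij_betw (\<phi> n) (dual_numbers_part w n) (graded_hom T s s n)) \<and>
      (\<forall>n. \<forall>p \<in> dual_numbers_part w n. \<forall>q \<in> dual_numbers_part w n. \<phi> n (p + q) = \<phi> n p \<oplus> \<phi> n q) \<and>
      (\<forall>n c. \<forall>p \<in> dual_numbers_part w n. \<phi> n (smult c p) = scale c (\<phi> n p)) \<and>
      (\<forall>m n. \<forall>p \<in> dual_numbers_part w m. \<forall>q \<in> dual_numbers_part w n.
         \<phi> (m + n) ((q * p) mod monom 1 2) = graded_comp T s s n m (\<phi> n q) (\<phi> m p)) \<and>
      \<phi> 0 1 = Id T s"
    by (rule exE)
  have bij: "\<And>n. bij_betw (\<phi> n) (dual_numbers_part w n) (graded_hom T s s n)"
    and add: "\<And>n p q. p \<in> dual_numbers_part w n \<Longrightarrow> q \<in> dual_numbers_part w n \<Longrightarrow>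
        \<phi> n (p + q) = \<phi> n p \<oplus> \<phi> n q"
    and scl: "\<And>n c p. p \<in> dual_numbers_part w n \<Longrightarrow> \<phi> n (smult c p) = scale c (\<phi> n p)"
    and mult: "\<And>m n p q. p \<in> dual_numbers_part w m \<Longrightarrow> q \<in> dual_numbers_part w n \<Longrightarrow>
        \<phi> (m + n) ((q * p) mod monom 1 2) = graded_comp T s s n m (\<phi> n q) (\<phi> m p)"
    and one: "\<phi> 0 1 = Id T s"
    using \<phi> by blast+
  let ?A = "\<lambda>n. (Sus T ^^ nat (- n)) s" and ?B = "\<lambda>n. (Sus T ^^ nat n) s"
  have H: "graded_hom T s s n = Hom T (?A n) (?B n)" for n
    by (simp add: graded_hom_def)
  have o: "?A n \<in> Obj T" "?B n \<in> Obj T" for n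
    using s by simp_all
  have mem: "\<phi> n p \<in> Hom T (?A n) (?B n)" if "p \<in> dual_numbers_part w n" for n p
    using bij_betwE[OF bij] that unfolding H by blast
  have surj: "\<exists>p \<in> dual_numbers_part w n. f = \<phi> n p" if "f \<in> Hom T (?A n) (?B n)" for f n
    using bij_betw_imp_surj_on[OF bij, of n] that unfolding H by blast
  have inj: "p = q" if "\<phi> n p = \<phi> n q" "p \<in> dual_numbers_part w n" "q \<in> dual_numbers_part w n" for n p q
    using bij_betw_imp_inj_on[OF bij, of n] that by (auto dest: inj_onD)
  have zero: "\<phi> n 0 = Zero T (?A n) (?B n)" for n
  proof -
    have "\<phi> n (smult 0 0) = scale 0 (\<phi> n 0)"
      by (rule scl) (rule zero_part)
    then show ?thesis
      using mem[OF zero_part, of n] by (simp add: hom_iff)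
  qed
  show "van (?A n) (?B n)" if "n \<noteq> 0" "n \<noteq> w"
    unfolding van_def
  proof
    fix f assume "f \<in> Hom T (?A n) (?B n)"
    then obtain p where p: "p \<in> dual_numbers_part w n" "f = \<phi> n p"
      using surj by blast
    have "p = 0"
      using p(1) that by (elim dual_numbers_partE) auto
    then show "f = Zero T (?A n) (?B n)"
      using p(2) zero by simp
  qed
  show "\<not> van (?A n) (?B n)" if "n = 0 \<or> n = w"
  proof -
    have "\<exists>p :: 'k poly. p \<in> dual_numbers_part w n \<and> p \<noteq> 0"
    proof (cases "n = 0")
      case True
      then show ?thesis
        using one_part[of w] by (intro exI[of _ 1]) simp
    next
      case False
      then show ?thesis
        using that X_part[of w] by (intro exI[of _ "[:0, 1:]"]) simp
    qed
    then obtain p :: "'k poly" where p: "p \<in> dual_numbers_part w n" "p \<noteq> 0"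
      by blast
    then have "\<phi> n p \<noteq> Zero T (?A n) (?B n)"
      using inj[of n p 0] zero_part zero by metis
    then show ?thesis
      using mem[OF p(1)] by (auto simp: van_def)
  qed
  show "line (?A n) (?B n)" if w: "w \<noteq> 0"
  proof -
    have "\<exists>x \<in> (dual_numbers_part w n :: 'k poly set). \<forall>p \<in> dual_numbers_part w n. \<exists>c. p = smult c x"
    proof -
      \<comment> \<open>The generators are 1 in degree 0, X in degree \<open>w\<close> and 0
        elsewhere.\<close>
      consider "n = 0" | "n = w" "n \<noteq> 0" | "n \<noteq> 0" "n \<noteq> w" by blast
      then show ?thesis
      proof cases
        case 1
        have "\<exists>c. p = smult c 1" if p: "p \<in> dual_numbers_part w n" for p :: "'k poly"
        proof -
          obtain c d where cd: "p = [:c, d:]" "c \<noteq> 0 \<longrightarrow> n = 0" "d \<noteq> 0 \<longrightarrow> n = w"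
            using p by (rule dual_numbers_partE)
          then have "p = smult c 1"
            using 1 w by (cases "d = 0") (auto simp: one_pCons)
          then show ?thesis ..
        qed
        then show ?thesis
          using one_part 1 by blast
      next
        case 2
        have "\<exists>c. p = smult c [:0, 1:]" if p: "p \<in> dual_numbers_part w n" for p :: "'k poly"
        proof -
          obtain c d where cd: "p = [:c, d:]" "c \<noteq> 0 \<longrightarrow> n = 0" "d \<noteq> 0 \<longrightarrow> n = w"
            using p by (rule dual_numbers_partE)
          then have "p = smult d [:0, 1:]"
            using 2 by (cases "c = 0") auto
          then show ?thesis ..
        qed
        then show ?thesis
          using X_part 2 by blast
      next
        case 3
        have "p = smult 0 0" if p: "p \<in> dual_numbers_part w n" for p :: "'k poly"
          using p 3 by (elim dual_numbers_partE) auto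
        then show ?thesis
          using zero_part by blast
      qed
    qed
    then obtain x :: "'k poly" where x: "x \<in> dual_numbers_part w n" "\<And>p. p \<in> dual_numbers_part w n \<Longrightarrow> \<exists>c. p = smult c x"
      by blast
    have "\<exists>c. f = scale c (\<phi> n x)" if f: "f \<in> Hom T (?A n) (?B n)" for f
    proof -
      obtain p where p: "p \<in> dual_numbers_part w n" "f = \<phi> n p"
        using surj f by blast
      then obtain c where "p = smult c x"
        using x(2) by blast
      then show ?thesis
        using p(2) scl[OF x(1)] by blast
    qed
    then show ?thesis
      unfolding line_def using mem[OF x(1)] by blast
  qed
  show "dual s" if w: "w = 0"
  proof -
    let ?X = "\<phi> 0 [:0, 1:]"
    have Xp: "[:0, 1 :: 'k:] \<in> dual_numbers_part w 0"
      using X_part[of w] w by simp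
    have X: "?X \<in> Hom T s s"
      using mem[OF Xp] by simp
    have "\<phi> (0 + 0) (([:0, 1:] * [:0, 1:]) mod monom 1 2) = graded_comp T s s 0 0 ?X ?X"
      using Xp Xp by (rule mult)
    moreover have "[:0, 1:] * [:0, 1:] = (monom 1 2 :: 'k poly)"
      by (simp add: monom_altdef power2_eq_square)
    \<comment> \<open>In degree 0 neither factor is suspended and the power of the suspension in the
      description is the identity, so the plain composite is described.\<close>
    moreover have "graded_comp T s s 0 0 ?X ?X = ?X \<cdot> ?X"
      unfolding graded_comp_def graded_hom_def using comp_hom[OF X X] by (intro the_equality) simp_all
    ultimately have XX: "?X \<cdot> ?X = Zero T s s"
      using zero[of 0] by simp
    have "?X \<noteq> Zero T s s"
      using inj[of 0 "[:0, 1:]" 0] Xp zero_part zero[of 0] by auto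
    moreover have "\<exists>c d. f = scale c (Id T s) \<oplus> scale d ?X" if f: "f \<in> Hom T s s" for f
    proof -
      obtain p where p: "p \<in> dual_numbers_part w 0" "f = \<phi> 0 p"
        using surj[of f 0] f by auto
      obtain c d where cd: "p = [:c, d:]"
        using dual_numbers_partE[OF p(1)] by blast
      have "smult c 1 \<in> dual_numbers_part w 0" "smult d [:0, 1:] \<in> dual_numbers_part w 0"
        using w by (auto simp: dual_numbers_part_def coeff_pCons one_pCons split: nat.splits)
      then have "\<phi> 0 (smult c 1 + smult d [:0, 1:]) = \<phi> 0 (smult c 1) \<oplus> \<phi> 0 (smult d [:0, 1:])"
        by (rule add)
      moreover have "smult c 1 + smult d [:0, 1:] = p"
        using cd by (simp add: one_pCons)
      ultimately have "f = \<phi> 0 (smult c 1) \<oplus> \<phi> 0 (smult d [:0, 1:])"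
        using p(2) by metis
      then have "f = scale c (Id T s) \<oplus> scale d ?X"
        unfolding scl[OF one_part] scl[OF Xp] one .
      then show ?thesis by blast
    qed
    ultimately show ?thesis
      unfolding dual_def using X XX by blast
  qed
qed

theorem spherical_sequence_shifts:
  assumes sph: "spherical_object T scale w s" and gen: "classically_generated T s"
    and ic: "idempotent_complete T"
  shows "spherical_sequence T (shifts s) w"
proof -
  have s: "s \<in> Obj T"
    using gen by (simp add: classically_generated_def)
  note [simp] = shifts_obj[OF s]
  have van: "van (shifts s i) (shifts s j)" if "j \<noteq> i" "j \<noteq> i + w" for i j
    using s van_iso van_sus spherical_hom(1)[OF sph, of "j - i"] that by (intro shift_invariant[where P = van]) auto
  have nonvan: "\<not> van (shifts s i) (shifts s j)" if "j = i \<or> j = i + w" for i j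
    using s van_iso van_sus spherical_hom(2)[OF sph, of "j - i"] that by (intro shift_invariant[where P = "\<lambda>a b. \<not> van a b"]) auto
  have line: "line (shifts s i) (shifts s j)" if "w \<noteq> 0" for i j
    using s line_iso line_sus spherical_hom(3)[OF sph that, of "j - i"] by (intro shift_invariant[where P = line]) auto
  have dual: "dual (shifts s i)" if "w = 0" for i
  proof (rule shift_invariant[where P = "\<lambda>a b. dual a" and j = i])
    show "dual ((Sus T ^^ nat (- (i - i))) s)"
      using spherical_hom(4)[OF sph that] by simp
  qed (use s dual_iso dual_sus in auto)
  have nonzero: "shifts s i \<notin> zero_objects T" for i
    using nonvan[of i i] van_zero_left by blast
  have division: "e = Zero T (shifts s i) (shifts s i)"
    if w: "w \<noteq> 0" and e: "e \<in> Hom T (shifts s i) (shifts s i)" "\<not> iso e" for e i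
  proof -
    let ?a = "shifts s i"
    obtain x where x: "x \<in> Hom T ?a ?a" and L: "\<And>f. f \<in> Hom T ?a ?a \<Longrightarrow> \<exists>c. f = scale c x"
      using line[OF w, of i i] by (auto simp: line_def)
    \<comment> \<open>The identity is a nonzero multiple of the generator, so conversely every
      endomorphism is a scalar.\<close>
    obtain c where c: "Id T ?a = scale c x"
      using L[OF id_hom] by auto
    have "c \<noteq> 0"
      using c x nonzero[of i] by (auto simp: hom_iff zero_objects_iff)
    obtain d where d: "e = scale d x"
      using L[OF e(1)] by blast
    have e': "e = scale (d / c) (Id T ?a)"
      unfolding c d using x \<open>c \<noteq> 0\<close> by (simp add: hom_iff)
    have "d / c = 0"
    proof (rule ccontr)
      assume "d / c \<noteq> 0"
      then have "iso (scale (d / c) (Id T ?a))"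
        by (intro iso_scale iso_id) simp_all
      then show False
        using e(2) e' by simp
    qed
    then show ?thesis
      unfolding e' by (simp only: scale_zero id_arr shifts_obj[OF s])
  qed
  have dualD: "\<exists>X \<in> Hom T (shifts s i) (shifts s i). X \<noteq> Zero T (shifts s i) (shifts s i) \<and>
      X \<cdot> X = Zero T (shifts s i) (shifts s i) \<and>
      (\<forall>f \<in> Hom T (shifts s i) (shifts s i). \<not> iso f \<longrightarrow> (\<exists>d. f = scale d X))" if w: "w = 0" for i
    using dual[OF w, of i] dual_nonunit[of "shifts s i"] unfolding dual_def by (metis shifts_obj[OF s])
  show ?thesis
  proof (unfold_locales; (intro shifts_obj[OF s] shifts_sus[OF s] van nonzero division; assumption)?)
    show "e \<cdot> e' = Zero T (shifts s i) (shifts s i)"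
      if e: "e \<in> Hom T (shifts s i) (shifts s i)" "e' \<in> Hom T (shifts s i) (shifts s i)" "\<not> iso e" "\<not> iso e'"
      for e i e'
    proof (cases "w = 0")
      case True
      obtain X where X: "X \<in> Hom T (shifts s i) (shifts s i)" "X \<cdot> X = Zero T (shifts s i) (shifts s i)"
        "\<And>f. f \<in> Hom T (shifts s i) (shifts s i) \<Longrightarrow> \<not> iso f \<Longrightarrow> \<exists>d. f = scale d X"
        using dualD[OF True, of i] by blast
      obtain d d' where "e = scale d X" "e' = scale d' X"
        using X(3) e by blast
      then show ?thesis
        using X(1,2) by (simp add: hom_iff)
    next
      case False
      then show ?thesis
        using division[OF False e(1,3)] e(2) by (simp add: hom_iff)
    qed
    show "\<exists>X \<in> Hom T (shifts s i) (shifts s (i + w)). X \<noteq> Zero T (shifts s i) (shifts s (i + w)) \<and>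
        (w = 0 \<longrightarrow> \<not> iso X)" for i
    proof (cases "w = 0")
      case True
      obtain X where X: "X \<in> Hom T (shifts s i) (shifts s i)" "X \<cdot> X = Zero T (shifts s i) (shifts s i)"
        "X \<noteq> Zero T (shifts s i) (shifts s i)"
        using dualD[OF True, of i] by blast
      then have "\<not> iso X"
        using iso_left_cancel[of X X] by (auto simp: hom_iff)
      then show ?thesis
        using X True by auto
    next
      case False
      then show ?thesis
        using nonvan[of "i + w" i] by (auto simp: van_def)
    qed
    show "\<exists>u \<in> W. \<forall>f \<in> W. (\<exists>e \<in> Hom T (shifts s i) (shifts s i). f = e \<cdot> u) \<and>
        (\<exists>e \<in> Hom T (shifts s j) (shifts s j). f = u \<cdot> e)"
      if W: "W \<subseteq> Hom T (shifts s j) (shifts s i)" "W \<noteq> {}" for W i j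
    proof (cases "w = 0")
      case False
      obtain x where "x \<in> Hom T (shifts s j) (shifts s i)"
        "\<And>f. f \<in> Hom T (shifts s j) (shifts s i) \<Longrightarrow> \<exists>c. f = scale c x"
        using line[OF False, of j i] by (auto simp: line_def)
      then show ?thesis
        using W by (intro principal_line) auto
    next
      case w: True
      show ?thesis
      proof (cases "i = j")
        case False
        then have v: "van (shifts s j) (shifts s i)"
          using van w by simp
        \<comment> \<open>A vanishing Hom set is a line with generator zero.\<close>
        have z: "\<exists>c. f = scale c (Zero T (shifts s j) (shifts s i))" if "f \<in> W" for f
        proof
          show "f = scale 0 (Zero T (shifts s j) (shifts s i))"
            using v that W by (auto simp: van_def)
        qed
        show ?thesis
          by (rule principal_line[OF W zero_hom z]) simp_all
      next
        case True
        obtain X where X: "X \<in> Hom T (shifts s i) (shifts s i)"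
          "\<And>f. f \<in> Hom T (shifts s i) (shifts s i) \<Longrightarrow> \<not> iso f \<Longrightarrow> \<exists>d. f = scale d X"
          using dualD[OF w, of i] by blast
        then show ?thesis
          using W \<open>i = j\<close> principal_local[of W "shifts s i" X] by auto
      qed
    qed
    show "Obj T \<subseteq> built_from T (shifts s 0)"
      using gen by (simp add: shifts_def classically_generated_def)
    show "idempotent_complete T"
      by (rule ic)
  qed
qed

end

theorem theoremA:
  fixes T :: "('o, 'm) tri_cat"
    and scale :: "'k::alg_closed_field \<Rightarrow> 'm \<Rightarrow> 'm"
    and E :: "('p, 'q) exact_cat"
    and w :: int
  assumes "linear_triangulated_category T scale"
    and "algebraic_via T E"
    and "idempotent_complete T"
    and "\<exists>s. spherical_object T scale w s \<and> classically_generated T s"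
  shows "(w \<le> 0 \<longrightarrow>
            (\<forall>M N. t_structure T M N \<longrightarrow> trivial_pair T M N) \<and>
            (\<exists>M\<^sub>0 N\<^sub>0. co_t_structure T M\<^sub>0 N\<^sub>0 \<and> \<not> trivial_pair T M\<^sub>0 N\<^sub>0 \<and>
               {(M, N). co_t_structure T M N \<and> \<not> trivial_pair T M N} =
               {(shift T i M\<^sub>0, shift T i N\<^sub>0) | i. True})) \<and>
         (w \<ge> 1 \<longrightarrow>
            (\<forall>M N. co_t_structure T M N \<longrightarrow> trivial_pair T M N) \<and>
            (\<exists>M\<^sub>0 N\<^sub>0. t_structure T M\<^sub>0 N\<^sub>0 \<and> \<not> trivial_pair T M\<^sub>0 N\<^sub>0 \<and>
               {(M, N). t_structure T M N \<and> \<not> trivial_pair T M N} =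
               {(shift T i M\<^sub>0, shift T i N\<^sub>0) | i. True}))"
proof -
  interpret linear_triangulated_category T scale
    by fact
  obtain s where "spherical_object T scale w s" "classically_generated T s"
    using assms(4) by blast
  then have "spherical_sequence T (shifts s) w"
    using assms(3) by (rule spherical_sequence_shifts)
  then show ?thesis
    by (rule spherical_sequence.classification)
qed

end
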